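(* Let $n\ge 3$ be an integer. For every $p$ with $1\le p\le\infty$, the operator $\mathcal G$ is a bounded operator from $L^p(B^n)$ into itself, and its norm $\|\mathcal G\|_p$ satisfies $$\|\mathcal G\|_p\le (2n)^{\frac{p-2}{p}}\,\lambda_1^{\frac{2(1-p)}{p}},\qquad 1\le p\le 2,$$ and $$\|\mathcal G\|_p\le \lambda_1^{-\frac2p}\,(2n)^{\frac{2-p}{p}},\qquad 2\le p\le\infty,$$ where for $p=\infty$ the exponents are understood as their limits ($-\frac2p=0$, $\frac{2-p}{p}=-1$). These inequalities are equalities for $p=1$, $p=2$ and $p=\infty$.
   Context: $B^n$ is the open unit ball and $S^{n-1}$ the unit sphere of $\mathbb R^n$, $|\cdot|$ is the Euclidean norm, $L^p(B^n)$ is taken with respect to Lebesgue measure $dy$. Let $\omega_{n-1}$ be the $(n-1)$-dimensional Hausdorff measure of $S^{n-1}$ and $c_n=\frac{1}{(n-2)\omega_{n-1}}$. The Green function of $B^n$ is $$G(x,y)=c_n\left(\frac1{|x-y|^{n-2}}-\frac1{[x,y]^{n-2}}\right),\qquad [x,y]=\big|\,|y|x-y/|y|\,\big|=\big|\,|x|y-x/|x|\,\big|,$$ equivalently $[x,y]=\sqrt{1-2\langle x,y\rangle+|x|^2|y|^2}$ (which also covers $x=0$ or $y=0$). The solution operator is $\mathcal G[g](x)=\int_{B^n}G(x,y)g(y)\,dy$, $x\in B^n$, and $\|\mathcal G\|_p$ is the operator norm of $\mathcal G:L^p(B^n)\to L^p(B^n)$. $\lambda_1=\lambda_1(B^n)$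 is the first (smallest) eigenvalue of the Dirichlet Laplacian on $B^n$, i.e. of the problem $-\Delta u=\lambda u$ in $B^n$, $u|_{\partial B^n}=0$. *)

theory Defs
  imports "HOL-Analysis.Analysis" "HOL-Probability.Essential_Supremum"
begin

section \<open>Hausdorff measure\<close>

text \<open>
  The d-dimensional Hausdorff (outer) measure for an integer d \<ge> 1, with the usual normalisation
  under which it agrees with Lebesgue measure on d-dimensional Euclidean space. Covers may contain
  empty sets, so finite covers are included. Boundedness is required because
  \<^const>\<open>diameter\<close> is unspecified on unbounded sets.
\<close>

definition hausdorff_premeasure :: "nat \<Rightarrow> real \<Rightarrow> 'a::metric_space set \<Rightarrow> ennreal" where
  "hausdorff_premeasure d \<delta> A =
     (INF U \<in> {U :: nat \<Rightarrow> 'a set. A \<subseteq> (\<Union>i. U i) \<and> (\<forall>i. bounded (U i) \<and> diameter (U i) \<le> \<delta>)}.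
        (\<Sum>i. ennreal (unit_ball_vol (real d) * (diameter (U i) / 2) ^ d)))"

definition hausdorff_measure :: "nat \<Rightarrow> 'a::metric_space set \<Rightarrow> ennreal" where
  "hausdorff_measure d A = (SUP \<delta> \<in> {0<..}. hausdorff_premeasure d \<delta> A)"

section \<open>The Green function of the unit ball\<close>

definition sphere_area :: "'n::finite itself \<Rightarrow> real" where
  "sphere_area _ = enn2real (hausdorff_measure (CARD('n) - 1) (sphere (0 :: real ^ 'n) 1))"

definition green_const :: "'n::finite itself \<Rightarrow> real" where
  "green_const _ = 1 / ((real CARD('n) - 2) * sphere_area TYPE('n))"

definition green_bracket :: "real ^ 'n::finite \<Rightarrow> real ^ 'n \<Rightarrow> real" where
  "green_bracket x y = sqrt (1 - 2 * (x \<bullet> y) + (norm x)\<^sup>2 * (norm y)\<^sup>2)"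

lemma green_bracket_commute: "green_bracket x y = green_bracket y x"
  by (simp add: green_bracket_def inner_commute mult.commute)

lemma green_bracket_eq_norm:
  assumes "y \<noteq> 0"
  shows "green_bracket x y = norm (norm y *\<^sub>R x - (1 / norm y) *\<^sub>R y)"
proof -
  have "(norm (norm y *\<^sub>R x - (1 / norm y) *\<^sub>R y))\<^sup>2
      = (norm y)\<^sup>2 * (x \<bullet> x) - 2 * (norm y * (1 / norm y)) * (x \<bullet> y)
        + (1 / norm y)\<^sup>2 * (y \<bullet> y)"
    unfolding power2_norm_eq_inner[of "_ - _"] inner_diff_left inner_diff_right
      inner_scaleR_left inner_scaleR_right inner_commute[of y x]
    by (simp only: power2_eq_square) algebra
  also have "\<dots> = 1 - 2 * (x \<bullet> y) + (norm x)\<^sup>2 * (norm y)\<^sup>2"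
    using assms by (simp add: dot_square_norm power_divide)
  finally show ?thesis
    unfolding green_bracket_def by (metis norm_ge_zero real_sqrt_unique)
qed

text \<open>On the (null) diagonal x = y the first summand takes the value 0, since 1 / 0 = 0.\<close>

definition green :: "real ^ 'n::finite \<Rightarrow> real ^ 'n \<Rightarrow> real" where
  "green x y = green_const TYPE('n) *
     (1 / norm (x - y) ^ (CARD('n) - 2) - 1 / green_bracket x y ^ (CARD('n) - 2))"

abbreviation unit_ball_measure :: "(real ^ 'n::finite) measure" where
  "unit_ball_measure \<equiv> lebesgue_on (ball 0 1)"

definition green_op :: "(real ^ 'n::finite \<Rightarrow> real) \<Rightarrow> real ^ 'n \<Rightarrow> real" where
  "green_op g x = (LINT y|unit_ball_measure. green x y * g y)"

section \<open>Lebesgue spaces and operators on them\<close>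

text \<open>
  Elements of the Lebesgue spaces are represented by functions; equality in the space is equality
  almost everywhere. The exponent p ranges over the extended reals with 1 \<le> p \<le> \<infinity>.
\<close>

definition Lp_space :: "ereal \<Rightarrow> 'a measure \<Rightarrow> ('a \<Rightarrow> real) set" where
  "Lp_space p M = {f \<in> borel_measurable M.
     if p = \<infinity> then esssup M (\<lambda>x. ereal \<bar>f x\<bar>) < \<infinity>
     else integrable M (\<lambda>x. \<bar>f x\<bar> powr real_of_ereal p)}"

definition Lp_norm :: "ereal \<Rightarrow> 'a measure \<Rightarrow> ('a \<Rightarrow> real) \<Rightarrow> real" where
  "Lp_norm p M f =
     (if p = \<infinity> then real_of_ereal (esssup M (\<lambda>x. ereal \<bar>f x\<bar>))
      else (LINT x|M. \<bar>f x\<bar> powr real_of_ereal p) powr (1 / real_of_ereal p))"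

definition Lp_bounded_operator ::
    "ereal \<Rightarrow> 'a measure \<Rightarrow> (('a \<Rightarrow> real) \<Rightarrow> 'a \<Rightarrow> real) \<Rightarrow> bool" where
  "Lp_bounded_operator p M T \<longleftrightarrow>
     (\<forall>f \<in> Lp_space p M. T f \<in> Lp_space p M) \<and>
     (\<forall>f \<in> Lp_space p M. \<forall>g \<in> Lp_space p M. \<forall>a b.
        AE x in M. T (\<lambda>y. a * f y + b * g y) x = a * T f x + b * T g x) \<and>
     (\<exists>C. \<forall>f \<in> Lp_space p M. Lp_norm p M (T f) \<le> C * Lp_norm p M f)"

definition Lp_operator_norm ::
    "ereal \<Rightarrow> 'a measure \<Rightarrow> (('a \<Rightarrow> real) \<Rightarrow> 'a \<Rightarrow> real) \<Rightarrow> real" where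
  "Lp_operator_norm p M T = (SUP f \<in> {f \<in> Lp_space p M. Lp_norm p M f \<le> 1}. Lp_norm p M (T f))"

section \<open>The first Dirichlet eigenvalue of the unit ball\<close>

definition partial_derivative :: "'n \<Rightarrow> (real ^ 'n::finite \<Rightarrow> real) \<Rightarrow> real ^ 'n \<Rightarrow> real" where
  "partial_derivative i u x = deriv (\<lambda>t. u (x + t *\<^sub>R axis i 1)) 0"

definition C2_on :: "(real ^ 'n::finite) set \<Rightarrow> (real ^ 'n \<Rightarrow> real) \<Rightarrow> bool" where
  "C2_on S u \<longleftrightarrow>
     u differentiable_on S \<and>
     (\<forall>i. partial_derivative i u differentiable_on S) \<and>
     (\<forall>i j. continuous_on S (partial_derivative j (partial_derivative i u)))"

definition laplacian :: "(real ^ 'n::finite \<Rightarrow> real) \<Rightarrow> real ^ 'n \<Rightarrow> real" where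
  "laplacian u x = (\<Sum>i\<in>UNIV. partial_derivative i (partial_derivative i u) x)"

definition dirichlet_eigenfunction :: "real \<Rightarrow> (real ^ 'n::finite \<Rightarrow> real) \<Rightarrow> bool" where
  "dirichlet_eigenfunction l u \<longleftrightarrow>
     C2_on (ball 0 1) u \<and> continuous_on (cball 0 1) u \<and>
     (\<exists>x \<in> ball 0 1. u x \<noteq> 0) \<and>
     (\<forall>x \<in> ball 0 1. - laplacian u x = l * u x) \<and>
     (\<forall>x \<in> sphere 0 1. u x = 0)"

definition dirichlet_eigenvalue :: "'n::finite itself \<Rightarrow> real \<Rightarrow> bool" where
  "dirichlet_eigenvalue _ l \<longleftrightarrow> (\<exists>u :: real ^ 'n \<Rightarrow> real. dirichlet_eigenfunction l u)"

definition first_dirichlet_eigenvalue :: "'n::finite itself \<Rightarrow> real" where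
  "first_dirichlet_eigenvalue _ = (LEAST l. dirichlet_eigenvalue TYPE('n) l)"

end

theory Submission
  imports Defs
begin

text \<open>
  The proof rests on two solutions of Dirichlet problems: \<open>G[1] = (1 - |x|^2) / (2 n)\<close>, and
  \<open>G[u] = u / \<lambda>\<^sub>1\<close> for the radial function \<open>u\<close> given by a Bessel power series whose first zero is
  \<open>\<lambda>\<^sub>1\<close>. Both follow from Green's second identity for a regularised Green function vanishing on the
  sphere. That the first zero is the first eigenvalue follows from a maximum principle for
  quotients. Since the kernel is symmetric and positive, a Schur test with weights that are powers
  of \<open>u\<close>, together with \<open>G[u^e] \<le> (G[1])^(1 - e) (G[u])^e\<close> for \<open>0 \<le> e \<le> 1\<close>, yields all bounds;
  equality for \<open>p = 1, 2, \<infinity>\<close> is seen on indicators of small balls, on \<open>u\<close> and on \<open>1\<close>.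

  The constant of the Green function requires the Hausdorff measure of the sphere. It is obtained
  by comparing small pieces of the sphere, via central projection to a tangent hyperplane, with the
  solid cones over them: coverings of a piece are controlled by the Vitali covering theorem from
  one side and by the isodiametric inequality (Steiner symmetrisation) from the other.
\<close>

section \<open>Hausdorff premeasures\<close>

text \<open>The stated bounds are what interpolation between the norms \<open>1 / (2 n)\<close> at p
  = 1 and p = infinity and \<open>1 / lam\<close> at p = 2 would give. A positive kernel allows a
  direct route: the one function u serves all exponents, and at p = 2 the Schur weight is u itself.
  Three definitions shape the rest. The eigenvalue is the least number with a classical
  eigenfunction, which is C2 in the open ball and merely continuous up to the sphere; integration by
  parts against it would need gradients at the boundary, a maximum principle does not. The area of
  the sphere is a Hausdorff measure, an infimum over arbitrary covers, and must be shown to equal n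
  times the volume of the ball, the number by which the representation formula normalises the
  kernel. The Green function is singular, while Green's identity is wanted for functions smooth on
  the whole space: both summands are powers of quadratic polynomials in y, and adding the same e > 0
  to each polynomial removes the singularity but keeps the zero boundary values.\<close>

lemma hausdorff_premeasure_leI:
  assumes "A \<subseteq> (\<Union>i. U i)" "\<And>i. bounded (U i)" "\<And>i. diameter (U i) \<le> \<delta>"
    and "(\<Sum>i. ennreal (unit_ball_vol (real d) * (diameter (U i) / 2) ^ d)) \<le> c"
  shows "hausdorff_premeasure d \<delta> A \<le> c"
  unfolding hausdorff_premeasure_def
  by (rule INF_lower2[of U]) (use assms in auto)

lemma hausdorff_premeasure_mono:
  assumes "A \<subseteq> B" shows "hausdorff_premeasure d \<delta> A \<le> hausdorff_premeasure d \<delta> B"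
  unfolding hausdorff_premeasure_def
  by (rule INF_superset_mono) (use assms in auto)

text \<open>Covers whose costs exceed the infimum by at most \<open>e * (1/2) ^ Suc j\<close> are
  merged into one sequence by the pairing function; the errors sum to \<open>e\<close>.\<close>

lemma hausdorff_premeasure_UN_le:
  fixes A :: "nat \<Rightarrow> 'a::metric_space set"
  shows "hausdorff_premeasure d \<delta> (\<Union>j. A j) \<le> (\<Sum>j. hausdorff_premeasure d \<delta> (A j))"
proof (rule ennreal_le_epsilon)
  fix e :: real
  assume fin: "(\<Sum>j. hausdorff_premeasure d \<delta> (A j)) < top" and e: "0 < e"
  let ?cost = "\<lambda>U. ennreal (unit_ball_vol (real d) * (diameter (U::'a set) / 2) ^ d)"
  have pe: "0 < e * (1/2) ^ Suc j" for j using e by simp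
  have "\<exists>U. A j \<subseteq> (\<Union>i. U i) \<and> (\<forall>i. bounded (U i) \<and> diameter (U i) \<le> \<delta>) \<and>
          (\<Sum>i. ?cost (U i)) \<le> hausdorff_premeasure d \<delta> (A j) + ennreal (e * (1/2) ^ Suc j)" for j
  proof -
    have "hausdorff_premeasure d \<delta> (A j) < top"
      using ennreal_suminf_lessD fin by blast
    then have "hausdorff_premeasure d \<delta> (A j) < hausdorff_premeasure d \<delta> (A j) + ennreal (e * (1/2) ^ Suc j)"
      using pe[of j] by (simp add: ennreal_add_left_cancel_less[where c=0, simplified])
    from this[unfolded hausdorff_premeasure_def] show ?thesis
      unfolding INF_less_iff hausdorff_premeasure_def by (auto intro: less_imp_le)
  qed
  then obtain U where U: "\<And>j. A j \<subseteq> (\<Union>i. U j i)" "\<And>j i. bounded (U j i)" "\<And>j i. diameter (U j i) \<le> \<delta>"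
    "\<And>j. (\<Sum>i. ?cost (U j i)) \<le> hausdorff_premeasure d \<delta> (A j) + ennreal (e * (1/2) ^ Suc j)"
    by metis
  define V where "V m = (case prod_decode m of (j, i) \<Rightarrow> U j i)" for m
  have V: "V (prod_encode (j, i)) = U j i" for j i by (simp add: V_def)
  show "hausdorff_premeasure d \<delta> (\<Union>j. A j) \<le> (\<Sum>j. hausdorff_premeasure d \<delta> (A j)) + ennreal e"
  proof (rule hausdorff_premeasure_leI[where U=V])
    show "(\<Union>j. A j) \<subseteq> (\<Union>m. V m)"
    proof safe
      fix j x assume "x \<in> A j"
      then obtain i where "x \<in> U j i" using U(1)[of j] by auto
      then show "x \<in> (\<Union>m. V m)" using V[of j i] by (metis UNIV_I UN_iff)
    qed
    show "bounded (V m)" "diameter (V m) \<le> \<delta>" for m using U by (auto simp: V_def split: prod.split)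
    have "(\<Sum>m. ?cost (V m)) = (\<Sum>m. (\<lambda>(j, i). ?cost (U j i)) (prod_decode m))"
      by (simp add: V_def split_def)
    also have "\<dots> = (\<Sum>j. \<Sum>i. ?cost (U j i))"
      by (rule suminf_ennreal_2dimen) auto
    also have "\<dots> \<le> (\<Sum>j. hausdorff_premeasure d \<delta> (A j) + ennreal (e * (1/2) ^ Suc j))"
      by (intro suminf_le U(4)) auto
    also have "\<dots> = (\<Sum>j. hausdorff_premeasure d \<delta> (A j)) + (\<Sum>j. ennreal (e * (1/2) ^ Suc j))"
      by (rule suminf_add[symmetric]) auto
    also have "(\<Sum>j. ennreal (e * (1/2) ^ Suc j)) = ennreal e"
      using sums_mult[OF power_half_series, of e] e
      by (subst suminf_ennreal2) (auto simp: sums_iff)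
    finally show "(\<Sum>m. ?cost (V m)) \<le> (\<Sum>j. hausdorff_premeasure d \<delta> (A j)) + ennreal e" .
  qed
qed

text \<open>For \<open>d = 0\<close> this fails: each empty set of a cover would cost
  \<open>0 ^ 0 = 1\<close>.\<close>

lemma hausdorff_premeasure_empty:
  assumes "d > 0" "\<delta> \<ge> 0" shows "hausdorff_premeasure d \<delta> {} = 0"
proof -
  have "hausdorff_premeasure d \<delta> {} \<le> 0"
    by (rule hausdorff_premeasure_leI[where U="\<lambda>i. {}"]) (use assms in \<open>auto simp: power_0_left\<close>)
  then show ?thesis by simp
qed

lemma hausdorff_premeasure_finite_UN_le:
  assumes "finite I" "d > 0" "\<delta> \<ge> 0"
  shows "hausdorff_premeasure d \<delta> (\<Union>i\<in>I. A i) \<le> (\<Sum>i\<in>I. hausdorff_premeasure d \<delta> (A i))"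
proof -
  obtain n and f :: "nat \<Rightarrow> _" where f: "bij_betw f {..<n} I"
    using ex_bij_betw_nat_finite[OF assms(1)] by (auto simp: atLeast0LessThan)
  let ?B = "\<lambda>j. if j < n then A (f j) else {}"
  have "(\<Union>i\<in>I. A i) = (\<Union>j. ?B j)"
    using f by (auto simp: bij_betw_def split: if_splits)
  also have "hausdorff_premeasure d \<delta> \<dots> \<le> (\<Sum>j. hausdorff_premeasure d \<delta> (?B j))"
    by (rule hausdorff_premeasure_UN_le)
  also have "\<dots> = (\<Sum>j<n. hausdorff_premeasure d \<delta> (A (f j)))"
    by (subst suminf_finite[of "{..<n}"]) (auto simp: hausdorff_premeasure_empty assms)
  also have "\<dots> = (\<Sum>i\<in>I. hausdorff_premeasure d \<delta> (A i))"
    by (rule sum.reindex_bij_betw[OF f])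
  finally show ?thesis .
qed

lemma diameter_image_le:
  assumes "bounded A" "\<And>x y. x \<in> A \<Longrightarrow> y \<in> A \<Longrightarrow> dist (f x) (f y) \<le> dist x y"
  shows "bounded (f ` A)" "diameter (f ` A) \<le> diameter A"
proof -
  have *: "dist (f x) (f y) \<le> diameter A" if "x \<in> A" "y \<in> A" for x y
    using assms diameter_bounded_bound[OF assms(1) that] that by (meson order_trans)
  show "bounded (f ` A)"
    by (rule bounded_two_points[THEN iffD2]) (use * in auto)
  show "diameter (f ` A) \<le> diameter A"
    using * by (auto simp: diameter_def[of "f ` A"] diameter_ge_0 assms intro!: cSUP_least)
qed

lemma hausdorff_premeasure_image_le:
  assumes lip: "\<And>x y. x \<in> A \<Longrightarrow> y \<in> A \<Longrightarrow> dist (f x) (f y) \<le> dist x y"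
  shows "hausdorff_premeasure d \<delta> (f ` A) \<le> hausdorff_premeasure d \<delta> A"
proof -
  have "hausdorff_premeasure d \<delta> (f ` A) \<le> (\<Sum>i. ennreal (unit_ball_vol (real d) * (diameter (U i) / 2) ^ d))"
    if U: "A \<subseteq> (\<Union>i. U i)" "\<And>i. bounded (U i)" "\<And>i. diameter (U i) \<le> \<delta>" for U :: "nat \<Rightarrow> _"
  proof (rule hausdorff_premeasure_leI[where U="\<lambda>i. f ` (U i \<inter> A)"])
    \<comment> \<open>Only points of \<open>A\<close> are known to move no further apart, so each
      cover set is cut down to \<open>A\<close> before it is mapped.\<close>
    have b: "bounded (U i \<inter> A)" for i using U(2) by (meson bounded_Int)
    have *: "bounded (f ` (U i \<inter> A))" "diameter (f ` (U i \<inter> A)) \<le> diameter (U i \<inter> A)" for i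
      by (rule diameter_image_le[OF b]; use lip in auto)+
    have **: "diameter (U i \<inter> A) \<le> diameter (U i)" for i by (rule diameter_subset) (use U in auto)
    have 3: "diameter (f ` (U i \<inter> A)) \<le> diameter (U i)" for i
      by (rule order_trans[OF *(2) **])
    show "f ` A \<subseteq> (\<Union>i. f ` (U i \<inter> A))"
      using U(1) by (subst image_UN[symmetric]) (simp add: Int_absorb1 flip: Int_UN_distrib2)
    show "bounded (f ` (U i \<inter> A))" "diameter (f ` (U i \<inter> A)) \<le> \<delta>" for i
      by (rule *(1), rule order_trans[OF 3 U(3)])
    have "(diameter (f ` (U i \<inter> A)) / 2) ^ d \<le> (diameter (U i) / 2) ^ d" for i
      by (rule power_mono) (use 3[of i] diameter_ge_0[OF *(1)[of i]] in auto)
    then have "ennreal (unit_ball_vol (real d) * (diameter (f ` (U i \<inter> A)) / 2) ^ d)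
        \<le> ennreal (unit_ball_vol (real d) * (diameter (U i) / 2) ^ d)" for i
      by (intro ennreal_leI mult_left_mono) auto
    then show "(\<Sum>i. ennreal (unit_ball_vol (real d) * (diameter (f ` (U i \<inter> A)) / 2) ^ d))
        \<le> (\<Sum>i. ennreal (unit_ball_vol (real d) * (diameter (U i) / 2) ^ d))"
      by (intro suminf_le summableI)
  qed
  then show ?thesis
    unfolding hausdorff_premeasure_def[of d \<delta> A] by (intro INF_greatest) auto
qed

text \<open>The form in which Vitali families enter: \<open>D\<close> are disjoint balls,
  \<open>B\<close> the same balls or their enlargements, and \<open>k\<close> the factor by which
  enlarging raises the volume.\<close>

lemma hausdorff_premeasure_countable_UN_le:
  assumes C: "countable C" and d: "d > 0" "\<delta> \<ge> 0"
    and dis: "disjoint_family_on D C" and meas: "\<And>i. i \<in> C \<Longrightarrow> D i \<in> sets M"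
    and le: "\<And>i. i \<in> C \<Longrightarrow> hausdorff_premeasure d \<delta> (B i) \<le> k * emeasure M (D i)"
  shows "hausdorff_premeasure d \<delta> (\<Union>i\<in>C. B i) \<le> k * emeasure M (\<Union>i\<in>C. D i)"
proof -
  let ?I = "to_nat_on C ` C"
  let ?B = "\<lambda>n. if n \<in> ?I then B (from_nat_into C n) else {}"
  let ?D = "\<lambda>n. if n \<in> ?I then D (from_nat_into C n) else {}"
  have inj: "inj_on (to_nat_on C) C" by (rule inj_on_to_nat_on[OF C])
  have UB: "(\<Union>i\<in>C. B i) = (\<Union>n. ?B n)" and UD: "(\<Union>i\<in>C. D i) = (\<Union>n. ?D n)"
    using C by (auto split: if_splits intro!: exI[of _ "to_nat_on C _"])
  have "disjoint_family ?D"
    using dis C inj by (auto simp: disjoint_family_on_def) (metis IntI empty_iff)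
  moreover have "range ?D \<subseteq> sets M"
    using C by (auto intro!: meas)
  ultimately have *: "(\<Sum>n. emeasure M (?D n)) = emeasure M (\<Union>i\<in>C. D i)"
    unfolding UD by (intro suminf_emeasure)
  have "hausdorff_premeasure d \<delta> (\<Union>i\<in>C. B i) \<le> (\<Sum>n. hausdorff_premeasure d \<delta> (?B n))"
    unfolding UB by (rule hausdorff_premeasure_UN_le)
  also have "\<dots> \<le> (\<Sum>n. k * emeasure M (?D n))"
    by (intro suminf_le summableI) (use C in \<open>auto simp: hausdorff_premeasure_empty d intro!: le\<close>)
  also have "\<dots> = k * (\<Sum>n. emeasure M (?D n))" by simp
  finally show ?thesis unfolding * .
qed

section \<open>Comparison of the premeasure with Lebesgue measure in full dimension\<close>

lemma hausdorff_premeasure_cball_le: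
  fixes a :: "'a::euclidean_space"
  assumes "0 \<le> r" "2 * r \<le> \<delta>"
  shows "hausdorff_premeasure DIM('a) \<delta> (cball a r) \<le> emeasure lebesgue (cball a r)"
proof (rule hausdorff_premeasure_leI[where U="\<lambda>i. if i = 0 then cball a r else {}"])
  show "(\<Sum>i. ennreal (unit_ball_vol (real DIM('a)) *
      (diameter (if i = (0::nat) then cball a r else {}) / 2) ^ DIM('a))) \<le> emeasure lebesgue (cball a r)"
    by (subst suminf_finite[of "{0}"])
      (use assms in \<open>auto simp: emeasure_cball power_0_left ennreal_mult'' mult.commute\<close>)
qed (use assms in \<open>auto split: if_splits\<close>)

text \<open>The 5r-covering lemma inside an open set of small measure: the enlarged balls cover the
  null set and cost at most \<open>5 ^ DIM('a)\<close> times the volume of the disjoint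
  ones.\<close>

lemma hausdorff_premeasure_negligible:
  fixes N :: "'a::euclidean_space set"
  assumes N: "negligible N" and \<delta>: "\<delta> > 0"
  shows "hausdorff_premeasure DIM('a) \<delta> N = 0"
proof -
  have "hausdorff_premeasure DIM('a) \<delta> N \<le> 0 + ennreal e" if e: "e > 0" for e
  proof -
    define e' where "e' = e / 5 ^ DIM('a)"
    have "e' > 0" using e by (simp add: e'_def)
    moreover have "N \<in> sets lebesgue" using N by (rule negligible_imp_sets)
    ultimately obtain T where T: "open T" "N \<subseteq> T" "T - N \<in> lmeasurable" "emeasure lebesgue (T - N) < ennreal e'"
      using sets_lebesgue_outer_open by blast
    have "emeasure lebesgue T \<le> emeasure lebesgue (T - N) + emeasure lebesgue N"
      using T \<open>N \<in> sets lebesgue\<close>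
      by (subst Diff_partition[OF T(2), symmetric], subst Un_commute, intro emeasure_subadditive) auto
    also have "emeasure lebesgue N = 0"
      using N by (simp add: negligible_iff_emeasure0 \<open>N \<in> sets lebesgue\<close>)
    finally have mT: "emeasure lebesgue T \<le> ennreal e'" using T(4) by auto
    \<comment> \<open>Radius at most \<open>\<delta> / 10\<close>, so that balls enlarged five times
      still have diameter at most \<open>\<delta>\<close>.\<close>
    have "\<forall>x\<in>N. \<exists>r. r > 0 \<and> r \<le> \<delta> / 10 \<and> cball x r \<subseteq> T"
    proof
      fix x assume "x \<in> N"
      then obtain s where "s > 0" "cball x s \<subseteq> T" using T open_contains_cball by blast
      then show "\<exists>r. r > 0 \<and> r \<le> \<delta> / 10 \<and> cball x r \<subseteq> T"
        using \<delta> by (intro exI[of _ "min s (\<delta>/10)"]) auto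
    qed
    then obtain r where r: "\<And>x. x \<in> N \<Longrightarrow> 0 < r x \<and> r x \<le> \<delta> / 10 \<and> cball x (r x) \<subseteq> T" by metis
    have 1: "N \<subseteq> (\<Union>i\<in>N. cball i (r i))" using r by force
    have 2: "0 < r i \<and> r i \<le> \<delta> / 10" if "i \<in> N" for i using r[OF that] by simp
    obtain C where C: "countable C" "C \<subseteq> N"
      "pairwise (\<lambda>i j. disjnt (cball i (r i)) (cball j (r j))) C" "N \<subseteq> (\<Union>i\<in>C. cball i (5 * r i))"
      by (rule Vitali_covering_lemma_cballs[where a="\<lambda>x. x", OF 1 2])
    have "hausdorff_premeasure DIM('a) \<delta> N \<le> hausdorff_premeasure DIM('a) \<delta> (\<Union>i\<in>C. cball i (5 * r i))"
      by (rule hausdorff_premeasure_mono[OF C(4)])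
    also have "\<dots> \<le> ennreal (5 ^ DIM('a)) * emeasure lebesgue (\<Union>i\<in>C. cball i (r i))"
    proof (rule hausdorff_premeasure_countable_UN_le[OF C(1)])
      show "disjoint_family_on (\<lambda>i. cball i (r i)) C"
        using C(3) by (auto simp: disjoint_family_on_def pairwise_def disjnt_def)
      show "hausdorff_premeasure DIM('a) \<delta> (cball i (5 * r i)) \<le> ennreal (5 ^ DIM('a)) * emeasure lebesgue (cball i (r i))"
        if "i \<in> C" for i
      proof -
        have "i \<in> N" using that C(2) by auto
        note ri = r[OF this]
        have "hausdorff_premeasure DIM('a) \<delta> (cball i (5 * r i)) \<le> emeasure lebesgue (cball i (5 * r i))"
          by (rule hausdorff_premeasure_cball_le) (use ri in auto)
        also have "\<dots> = ennreal (5 ^ DIM('a)) * emeasure lebesgue (cball i (r i))"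
          using ri by (simp add: emeasure_cball power_mult_distrib mult.left_commute mult_ac flip: ennreal_mult')
        finally show ?thesis .
      qed
    qed (use \<delta> in auto)
    also have "emeasure lebesgue (\<Union>i\<in>C. cball i (r i)) \<le> emeasure lebesgue T"
      by (rule emeasure_mono) (use r C(2) T(1) in auto)
    also note mT
    also have "ennreal (5 ^ DIM('a)) * ennreal e' = ennreal e"
      by (simp add: e'_def flip: ennreal_mult')
    finally show ?thesis by (simp add: mult_left_mono)
  qed
  then have "hausdorff_premeasure DIM('a) \<delta> N \<le> 0" by (rule ennreal_le_epsilon)
  then show ?thesis by simp
qed

text \<open>The costs of disjoint closed balls inside \<open>T\<close> add up to at most the volume
  of \<open>T\<close>. By the Vitali covering theorem such balls miss only a null set of
  \<open>A\<close>, and null sets cost nothing.\<close>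

lemma hausdorff_premeasure_le_lebesgue:
  fixes A :: "'a::euclidean_space set"
  assumes A: "A \<in> sets lebesgue" and \<delta>: "\<delta> > 0"
  shows "hausdorff_premeasure DIM('a) \<delta> A \<le> emeasure lebesgue A"
proof (rule ennreal_le_epsilon)
  fix e :: real assume e: "e > 0"
  obtain T where T: "open T" "A \<subseteq> T" "T - A \<in> lmeasurable" "emeasure lebesgue (T - A) < ennreal e"
    using sets_lebesgue_outer_open[OF A e] by blast
  have "emeasure lebesgue T \<le> emeasure lebesgue A + emeasure lebesgue (T - A)"
    using T A by (subst Diff_partition[OF T(2), symmetric], intro emeasure_subadditive) auto
  also have "\<dots> \<le> emeasure lebesgue A + ennreal e" using T(4) by (intro add_left_mono) auto
  finally have mT: "emeasure lebesgue T \<le> emeasure lebesgue A + ennreal e" .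
  let ?K = "{(x, r). 0 < r \<and> r \<le> \<delta> / 2 \<and> cball x r \<subseteq> T}"
  have 1: "0 < snd i" if "i \<in> ?K" for i using that by auto
  have 2: "\<exists>i. i \<in> ?K \<and> x \<in> cball (fst i) (snd i) \<and> snd i < d" if x: "x \<in> A" "0 < d" for x d
  proof -
    obtain s where "s > 0" "cball x s \<subseteq> T" using T x open_contains_cball by blast
    then show ?thesis
      using \<delta> x by (intro exI[of _ "(x, min s (min (\<delta>/2) (d/2)))"]) auto
  qed
  obtain C where C: "countable C" "C \<subseteq> ?K"
      "pairwise (\<lambda>i j. disjnt (cball (fst i) (snd i)) (cball (fst j) (snd j))) C"
      "negligible (A - (\<Union>i\<in>C. cball (fst i) (snd i)))"
    by (rule Vitali_covering_theorem_cballs[OF 1 2])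
  let ?B = "\<Union>i\<in>C. cball (fst i) (snd i)"
  have "hausdorff_premeasure DIM('a) \<delta> A \<le> hausdorff_premeasure DIM('a) \<delta> (\<Union>b::bool\<in>UNIV. if b then ?B else A - ?B)"
    by (rule hausdorff_premeasure_mono) (auto split: if_splits)
  also have "\<dots> \<le> (\<Sum>b\<in>UNIV. hausdorff_premeasure DIM('a) \<delta> (if b then ?B else A - ?B))"
    by (rule hausdorff_premeasure_finite_UN_le) (use \<delta> in auto)
  also have "\<dots> = hausdorff_premeasure DIM('a) \<delta> ?B"
    by (simp add: UNIV_bool hausdorff_premeasure_negligible[OF C(4) \<delta>])
  also have "\<dots> \<le> 1 * emeasure lebesgue ?B"
  proof (rule hausdorff_premeasure_countable_UN_le[OF C(1)])
    show "disjoint_family_on (\<lambda>i. cball (fst i) (snd i)) C"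
      using C(3) by (auto simp: disjoint_family_on_def pairwise_def disjnt_def)
    show "hausdorff_premeasure DIM('a) \<delta> (cball (fst i) (snd i)) \<le> 1 * emeasure lebesgue (cball (fst i) (snd i))"
      if "i \<in> C" for i
      using hausdorff_premeasure_cball_le[of "snd i" \<delta> "fst i"] that C(2) by auto
  qed (use \<delta> in auto)
  also have "?B \<subseteq> T"
  proof
    fix x assume "x \<in> ?B"
    then obtain i where "i \<in> C" "x \<in> cball (fst i) (snd i)" by blast
    then show "x \<in> T" using C(2) by (auto simp: subset_eq split_def)
  qed
  then have "1 * emeasure lebesgue ?B \<le> emeasure lebesgue T"
    unfolding mult_1 by (rule emeasure_mono) (use T(1) in auto)
  also note mT
  finally show "hausdorff_premeasure DIM('a) \<delta> A \<le> emeasure lebesgue A + ennreal e" .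
qed

section \<open>The isodiametric inequality\<close>

lemma nn_integral_lborel_shift:
  fixes f :: "'a::euclidean_space \<Rightarrow> ennreal"
  assumes [measurable]: "f \<in> borel_measurable borel"
  shows "(\<integral>\<^sup>+x. f (x + c) \<partial>lborel) = (\<integral>\<^sup>+x. f x \<partial>lborel)"
  by (subst lborel_distr_plus[of c, symmetric], subst nn_integral_distr) (simp_all add: add.commute)

definition fiber_length :: "'a::euclidean_space \<Rightarrow> 'a set \<Rightarrow> 'a \<Rightarrow> ennreal" where
  "fiber_length b A x = emeasure lborel {t :: real. x + t *\<^sub>R b \<in> A}"

lemma fiber_length_nn_integral:
  assumes [measurable]: "A \<in> sets borel"
  shows "fiber_length b A x = (\<integral>\<^sup>+t. indicator A (x + t *\<^sub>R b) \<partial>lborel)"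
proof -
  have "{t :: real. x + t *\<^sub>R b \<in> A} \<in> sets lborel" by measurable
  then show ?thesis
    using nn_integral_indicator[of "{t :: real. x + t *\<^sub>R b \<in> A}" lborel]
    by (simp add: fiber_length_def indicator_def)
qed

lemma borel_measurable_fiber_length [measurable]:
  assumes [measurable]: "A \<in> sets borel"
  shows "fiber_length b A \<in> borel_measurable borel"
proof -
  have "(\<lambda>x. \<integral>\<^sup>+t. indicator A (x + t *\<^sub>R b) \<partial>(lborel :: real measure)) \<in> borel_measurable borel"
    by measurable
  then show ?thesis using fiber_length_nn_integral[OF assms] by (metis (no_types, lifting) ext)
qed

lemma fiber_length_shift:
  assumes [measurable]: "A \<in> sets borel"
  shows "fiber_length b A (x + s *\<^sub>R b) = fiber_length b A x"
proof -
  have "(\<integral>\<^sup>+t. indicator A (x + (t + s) *\<^sub>R b) \<partial>lborel) = (\<integral>\<^sup>+t. indicator A (x + t *\<^sub>R b) \<partial>lborel)"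
    by (rule nn_integral_lborel_shift[where f="\<lambda>t. indicator A (x + t *\<^sub>R b)"]) measurable
  then show ?thesis by (simp add: fiber_length_nn_integral assms algebra_simps)
qed

text \<open>Cavalieri's principle without splitting off the hyperplane: fiber lengths are constant
  in the direction \<open>b\<close>, so integrating them over the slab
  \<open>0 \<le> x \<bullet> b \<le> 1\<close> of thickness 1 replaces the integral over the
  hyperplane.\<close>

lemma emeasure_lborel_fiber_length:
  assumes [measurable]: "A \<in> sets borel" and b: "b \<in> Basis"
  shows "emeasure lborel A = (\<integral>\<^sup>+x. fiber_length b A x * indicator {0..1} (x \<bullet> b) \<partial>lborel)"
proof -
  have bb: "b \<bullet> b = 1" using b by simp
  have "(\<integral>\<^sup>+x. fiber_length b A x * indicator {0..1} (x \<bullet> b) \<partial>lborel)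
      = (\<integral>\<^sup>+x. (\<integral>\<^sup>+t. indicator A (x + t *\<^sub>R b) * indicator {0..1} (x \<bullet> b) \<partial>lborel) \<partial>lborel)"
    by (simp add: fiber_length_nn_integral nn_integral_multc)
  also have "\<dots> = (\<integral>\<^sup>+t. (\<integral>\<^sup>+x. indicator A (x + t *\<^sub>R b) * indicator {0..1} (x \<bullet> b) \<partial>lborel) \<partial>lborel)"
    by (rule lborel_pair.Fubini') measurable
  also have "\<dots> = (\<integral>\<^sup>+t. (\<integral>\<^sup>+x. indicator A x * indicator {0..1} (x \<bullet> b - t) \<partial>lborel) \<partial>lborel)"
  proof (rule nn_integral_cong)
    fix t :: real
    show "(\<integral>\<^sup>+x. indicator A (x + t *\<^sub>R b) * indicator {0..1} (x \<bullet> b) \<partial>lborel)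
        = (\<integral>\<^sup>+x. indicator A x * indicator {0..1} (x \<bullet> b - t) \<partial>lborel)"
      using nn_integral_lborel_shift[where f="\<lambda>x. indicator A x * indicator {0..1} (x \<bullet> b - t)" and c="t *\<^sub>R b"]
      by (simp add: inner_add_left bb)
  qed
  also have "\<dots> = (\<integral>\<^sup>+x. (\<integral>\<^sup>+t. indicator A x * indicator {0..1} (x \<bullet> b - t) \<partial>lborel) \<partial>lborel)"
    by (rule lborel_pair.Fubini'[symmetric]) measurable
  also have "\<dots> = (\<integral>\<^sup>+x. indicator A x \<partial>lborel)"
  proof (rule nn_integral_cong)
    fix x :: 'a
    have "(\<integral>\<^sup>+t. indicator {0..1} (x \<bullet> b - t) \<partial>lborel) = (\<integral>\<^sup>+t. indicator {x \<bullet> b - 1..x \<bullet> b} t \<partial>lborel)"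
      by (rule nn_integral_cong) (auto simp: indicator_def)
    also have "\<dots> = 1" by simp
    finally show "(\<integral>\<^sup>+t. indicator A x * indicator {0..1} (x \<bullet> b - t) \<partial>lborel) = indicator A x"
      by (subst nn_integral_cmult) auto
  qed
  finally show ?thesis by simp
qed

text \<open>After passing to the convex hulls, \<open>Sup I - Inf J\<close> and
  \<open>Sup J - Inf I\<close> are both at most \<open>q\<close>, and they add up to the two
  lengths.\<close>

lemma emeasure_sum_le_of_abs_diff_le:
  fixes I J :: "real set"
  assumes ne: "I \<noteq> {}" "J \<noteq> {}" and q: "\<And>t u. t \<in> I \<Longrightarrow> u \<in> J \<Longrightarrow> \<bar>t - u\<bar> \<le> q"
  shows "emeasure lborel I + emeasure lborel J \<le> ennreal (2 * q)"
proof -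
  obtain t u where tu: "t \<in> I" "u \<in> J" using ne by auto
  have bI: "bdd_above I" "bdd_below I"
    using q[OF _ tu(2)] by (auto intro!: bdd_aboveI[of _ "u + q"] bdd_belowI[of _ "u - q"] simp: abs_le_iff) (smt (verit))+
  have bJ: "bdd_above J" "bdd_below J"
    using q[OF tu(1)] by (auto intro!: bdd_aboveI[of _ "t + q"] bdd_belowI[of _ "t - q"] simp: abs_le_iff) (smt (verit))+
  have "I \<subseteq> {Inf I..Sup I}" "J \<subseteq> {Inf J..Sup J}"
    using bI bJ by (auto intro: cInf_lower cSup_upper)
  moreover have IS: "Inf I \<le> Sup I" "Inf J \<le> Sup J"
    using bI bJ ne by (auto intro: cInf_le_cSup)
  ultimately have "emeasure lborel I \<le> ennreal (Sup I - Inf I)" "emeasure lborel J \<le> ennreal (Sup J - Inf J)"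
    using emeasure_mono[of I "{Inf I..Sup I}" lborel] emeasure_mono[of J "{Inf J..Sup J}" lborel] by auto
  then have "emeasure lborel I + emeasure lborel J \<le> ennreal (Sup I - Inf I) + ennreal (Sup J - Inf J)"
    by (rule add_mono)
  also have "\<dots> = ennreal ((Sup I - Inf I) + (Sup J - Inf J))" using IS by (simp flip: ennreal_plus)
  also have "\<dots> \<le> ennreal (2 * q)"
  proof (rule ennreal_leI)
    have "Sup I \<le> q + u" if "u \<in> J" for u
      by (rule cSup_least[OF ne(1)]) (use q that in \<open>smt (verit)\<close>)
    then have "Sup I - q \<le> Inf J" using ne(2) by (intro cInf_greatest) (auto simp: algebra_simps)
    moreover have "Sup J \<le> q + t" if "t \<in> I" for t
      by (rule cSup_least[OF ne(2)]) (use q that in \<open>smt (verit)\<close>)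
    then have "Sup J - q \<le> Inf I" using ne(1) by (intro cInf_greatest) (auto simp: algebra_simps)
    ultimately show "Sup I - Inf I + (Sup J - Inf J) \<le> 2 * q" by simp
  qed
  finally show ?thesis .
qed

text \<open>The condition that the fiber has positive length, instead of being nonempty, keeps the
  symmetrised set Borel.\<close>

definition steiner :: "'a::euclidean_space \<Rightarrow> 'a set \<Rightarrow> 'a set" where
  "steiner b A = {x. fiber_length b A x > 0 \<and> 2 * ennreal \<bar>x \<bullet> b\<bar> \<le> fiber_length b A x}"

lemma steiner_borel [measurable]:
  assumes [measurable]: "A \<in> sets borel"
  shows "steiner b A \<in> sets borel"
  unfolding steiner_def by measurable

lemma fiber_length_steiner:
  assumes A: "A \<in> sets borel" and b: "b \<in> Basis" and fin: "fiber_length b A x < top"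
  shows "fiber_length b (steiner b A) x = fiber_length b A x"
proof -
  have bb: "b \<bullet> b = 1" using b by simp
  obtain l where l: "fiber_length b A x = ennreal l" "l \<ge> 0"
    using fin by (cases "fiber_length b A x") auto
  show ?thesis
  proof (cases "l = 0")
    case True
    then have "{t. x + t *\<^sub>R b \<in> steiner b A} = {}"
      by (auto simp: steiner_def fiber_length_shift[OF A] l)
    then show ?thesis by (simp add: fiber_length_def[of _ "steiner b A"] l True)
  next
    case False
    have "{t. x + t *\<^sub>R b \<in> steiner b A} = {- (l/2) - x \<bullet> b .. l/2 - x \<bullet> b}"
    proof (intro set_eqI)
      fix t
      have "2 * ennreal \<bar>x \<bullet> b + t\<bar> \<le> ennreal l \<longleftrightarrow> 2 * \<bar>x \<bullet> b + t\<bar> \<le> l"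
        using l(2) by (simp add: ennreal_le_iff flip: ennreal_numeral ennreal_mult')
      also have "\<dots> \<longleftrightarrow> t \<in> {- (l/2) - x \<bullet> b .. l/2 - x \<bullet> b}"
         unfolding atLeastAtMost_iff using abs_le_iff[of "x \<bullet> b + t" "l / 2"] by argo
      finally show "t \<in> {t. x + t *\<^sub>R b \<in> steiner b A} \<longleftrightarrow> t \<in> {- (l/2) - x \<bullet> b .. l/2 - x \<bullet> b}"
        using False l(2) less_le[of 0 l] by (simp add: steiner_def fiber_length_shift[OF A] l inner_add_left bb)
    qed
    then show ?thesis using l(2) by (simp add: fiber_length_def[of _ "steiner b A"] l)
  qed
qed

text \<open>By Pythagoras, points of the two original fibers differ along \<open>b\<close> by at
  most \<open>q\<close>, so the fiber lengths add up to at most \<open>2 * q\<close>. The heights of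
  \<open>x\<close> and \<open>y\<close> are at most half the lengths, hence add up to at most
  \<open>q\<close>: centring the fibers does not take their points further apart.\<close>

lemma steiner_dist_le:
  assumes A: "A \<in> sets borel" and b: "b \<in> Basis" and D: "D \<ge> 0" "\<And>x y. x \<in> A \<Longrightarrow> y \<in> A \<Longrightarrow> dist x y \<le> D"
    and x: "x \<in> steiner b A" and y: "y \<in> steiner b A"
  shows "dist x y \<le> D"
proof -
  have bb: "b \<bullet> b = 1" using b by simp
  have pyth: "(norm (w + t *\<^sub>R b))\<^sup>2 = (norm w)\<^sup>2 + t\<^sup>2" if "w \<bullet> b = 0" for w t
    using that bb unfolding power2_norm_eq_inner
    by (simp add: inner_add_left inner_add_right inner_commute power2_eq_square)
  define s r x0 y0 where "s = x \<bullet> b" and "r = y \<bullet> b" and "x0 = x + (- s) *\<^sub>R b" and "y0 = y + (- r) *\<^sub>R b"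
  have x0y0: "(x0 - y0) \<bullet> b = 0" by (simp add: x0_def y0_def s_def r_def inner_add_left inner_diff_left bb)
  define I J where "I = {t. x0 + t *\<^sub>R b \<in> A}" and "J = {t. y0 + t *\<^sub>R b \<in> A}"
  have eI: "emeasure lborel I = fiber_length b A x" and eJ: "emeasure lborel J = fiber_length b A y"
    unfolding I_def J_def fiber_length_def[symmetric] x0_def y0_def by (simp_all only: fiber_length_shift[OF A])
  have ne: "I \<noteq> {}" "J \<noteq> {}" using x y eI eJ by (auto simp: steiner_def)
  have diff: "(norm (x0 - y0))\<^sup>2 + (t - u)\<^sup>2 \<le> D\<^sup>2" if "t \<in> I" "u \<in> J" for t u
  proof -
    have "(norm (x0 - y0))\<^sup>2 + (t - u)\<^sup>2 = (norm ((x0 - y0) + (t - u) *\<^sub>R b))\<^sup>2"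
      by (rule pyth[OF x0y0, symmetric])
    also have "(x0 - y0) + (t - u) *\<^sub>R b = (x0 + t *\<^sub>R b) - (y0 + u *\<^sub>R b)" by (simp add: algebra_simps)
    also have "(norm \<dots>)\<^sup>2 \<le> D\<^sup>2"
      using D(2)[of "x0 + t *\<^sub>R b" "y0 + u *\<^sub>R b"] that by (intro power_mono) (auto simp: I_def J_def dist_norm)
    finally show ?thesis .
  qed
  define q where "q = sqrt (D\<^sup>2 - (norm (x0 - y0))\<^sup>2)"
  obtain t u where "t \<in> I" "u \<in> J" using ne by auto
  from diff[OF this] have nn: "0 \<le> D\<^sup>2 - (norm (x0 - y0))\<^sup>2" by (smt (verit) zero_le_power2)
  have q0: "q \<ge> 0" using nn by (simp add: q_def)
  have "emeasure lborel I + emeasure lborel J \<le> ennreal (2 * q)"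
    by (rule emeasure_sum_le_of_abs_diff_le[OF ne])
       (use diff in \<open>auto simp: q_def intro!: real_le_rsqrt simp: algebra_simps\<close>)
  moreover have "2 * ennreal \<bar>s\<bar> \<le> emeasure lborel I" "2 * ennreal \<bar>r\<bar> \<le> emeasure lborel J"
    using x y unfolding eI eJ s_def r_def by (auto simp: steiner_def)
  ultimately have "2 * ennreal \<bar>s\<bar> + 2 * ennreal \<bar>r\<bar> \<le> ennreal (2 * q)"
    by (meson add_mono order_trans)
  also have "2 * ennreal \<bar>s\<bar> + 2 * ennreal \<bar>r\<bar> = ennreal (2 * \<bar>s\<bar> + 2 * \<bar>r\<bar>)"
    by (simp add: ennreal_mult')
  finally have "\<bar>s\<bar> + \<bar>r\<bar> \<le> q" using q0 by (simp add: ennreal_le_iff flip: ennreal_plus)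
  then have "(s - r)\<^sup>2 \<le> q\<^sup>2" using q0 by (intro power2_le_iff_abs_le[THEN iffD2]) auto
  also have "q\<^sup>2 = D\<^sup>2 - (norm (x0 - y0))\<^sup>2" using nn by (simp add: q_def)
  finally have "(norm ((x0 - y0) + (s - r) *\<^sub>R b))\<^sup>2 \<le> D\<^sup>2" by (simp add: pyth[OF x0y0])
  moreover have "(x0 - y0) + (s - r) *\<^sub>R b = x - y" by (simp add: x0_def y0_def algebra_simps)
  ultimately show ?thesis using D(1) by (simp add: dist_norm power2_le_iff_abs_le abs_le_square_iff[symmetric])
qed

definition reflect :: "'a::euclidean_space \<Rightarrow> 'a \<Rightarrow> 'a" where
  "reflect b x = x - (2 * (x \<bullet> b)) *\<^sub>R b"

lemma steiner_reflect:
  assumes A: "A \<in> sets borel" and b: "b \<in> Basis" and x: "x \<in> steiner b A"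
  shows "reflect b x \<in> steiner b A"
proof -
  have "reflect b x = x + (- (2 * (x \<bullet> b))) *\<^sub>R b" by (simp add: reflect_def)
  then have "fiber_length b A (reflect b x) = fiber_length b A x" by (simp only: fiber_length_shift[OF A])
  moreover have "reflect b x \<bullet> b = - (x \<bullet> b)" using b by (simp add: reflect_def inner_diff_left)
  ultimately show ?thesis using x by (simp add: steiner_def)
qed

text \<open>Symmetrising in a further direction keeps the symmetries already obtained, so one pass
  through the basis produces all of them.\<close>

lemma steiner_reflect_other:
  assumes b: "b \<in> Basis" and c: "c \<in> Basis" "c \<noteq> b" and sym: "\<And>x. x \<in> A \<Longrightarrow> reflect c x \<in> A"
    and x: "x \<in> steiner b A"
  shows "reflect c x \<in> steiner b A"
proof -
  have cb: "b \<bullet> c = 0" "c \<bullet> b = 0" using b c by (simp_all add: inner_Basis)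
  have inv: "reflect c (reflect c z) = z" for z
    using c by (simp add: reflect_def inner_diff_left)
  have r: "reflect c (x + t *\<^sub>R b) = reflect c x + t *\<^sub>R b" for t
    by (simp add: reflect_def inner_add_left cb)
  have "reflect c x + t *\<^sub>R b \<in> A \<longleftrightarrow> x + t *\<^sub>R b \<in> A" for t
    using sym inv r by metis
  then have "fiber_length b A (reflect c x) = fiber_length b A x" by (simp add: fiber_length_def)
  moreover have "reflect c x \<bullet> b = x \<bullet> b" by (simp add: reflect_def inner_diff_left cb)
  ultimately show ?thesis using x by (simp add: steiner_def)
qed

lemma emeasure_steiner:
  assumes A: "A \<in> sets borel" and b: "b \<in> Basis" and fin: "\<And>x. fiber_length b A x < top"
  shows "emeasure lborel (steiner b A) = emeasure lborel A"
  using A b by (simp add: emeasure_lborel_fiber_length fiber_length_steiner fin steiner_borel)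

lemma fiber_length_finite:
  assumes b: "b \<in> Basis" and D: "\<And>x y. x \<in> A \<Longrightarrow> y \<in> A \<Longrightarrow> dist x y \<le> D"
  shows "fiber_length b A x < top"
proof (cases "{t. x + t *\<^sub>R b \<in> A} = {}")
  case False
  then obtain u where u: "x + u *\<^sub>R b \<in> A" by auto
  have "{t. x + t *\<^sub>R b \<in> A} \<subseteq> {u - D..u + D}"
  proof
    fix t assume t: "t \<in> {t. x + t *\<^sub>R b \<in> A}"
    have "norm ((t - u) *\<^sub>R b) = dist (x + t *\<^sub>R b) (x + u *\<^sub>R b)"
      unfolding dist_norm by (simp add: scaleR_diff_left)
    also have "\<dots> \<le> D" by (rule D[OF _ u]) (use t in simp)
    finally have "norm ((t - u) *\<^sub>R b) \<le> D" .
    then show "t \<in> {u - D..u + D}" using b by simp linarith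
  qed
  then have "fiber_length b A x \<le> emeasure lborel {u - D..u + D}"
    unfolding fiber_length_def by (intro emeasure_mono) auto
  also have "\<dots> < top" by (simp add: emeasure_lborel_Icc_eq)
  finally show ?thesis .
qed (simp add: fiber_length_def)

text \<open>After symmetrisation in every basis direction the set is invariant under all coordinate
  reflections, hence under negation. Then \<open>2 * norm x = dist x (- x) \<le> D\<close>, and the
  set lies in a ball of radius \<open>D / 2\<close>.\<close>

theorem isodiametric:
  fixes A :: "'a::euclidean_space set"
  assumes A: "A \<in> sets borel" and D: "D \<ge> 0" "\<And>x y. x \<in> A \<Longrightarrow> y \<in> A \<Longrightarrow> dist x y \<le> D"
  shows "emeasure lborel A \<le> ennreal (unit_ball_vol DIM('a) * (D / 2) ^ DIM('a))"
proof -
  have "\<exists>B :: 'a set. B \<in> sets borel \<and> emeasure lborel B = emeasure lborel A \<and> (\<forall>x\<in>B. \<forall>y\<in>B. dist x y \<le> D) \<and>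
          (\<forall>c\<in>F. \<forall>x\<in>B. reflect c x \<in> B)" if "finite F" "F \<subseteq> Basis" for F
    using that
  proof (induction F)
    case empty
    have "\<forall>x\<in>A. \<forall>y\<in>A. dist x y \<le> D" by (intro ballI D(2))
    then show ?case by (intro exI[of _ A]) (simp add: A)
  next
    case (insert b F)
    then obtain B :: "'a set" where B: "B \<in> sets borel" "emeasure lborel B = emeasure lborel A"
      "\<And>x y. x \<in> B \<Longrightarrow> y \<in> B \<Longrightarrow> dist x y \<le> D" "\<And>c x. c \<in> F \<Longrightarrow> x \<in> B \<Longrightarrow> reflect c x \<in> B"
      by auto
    have b: "b \<in> Basis" using insert by auto
    show ?case
    proof (intro exI[of _ "steiner b B"] conjI ballI)
      show "steiner b B \<in> sets borel" by (rule steiner_borel[OF B(1)])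
      show "emeasure lborel (steiner b B) = emeasure lborel A"
        using emeasure_steiner[OF B(1) b fiber_length_finite[OF b B(3)]] B(2) by simp
      show "dist x y \<le> D" if "x \<in> steiner b B" "y \<in> steiner b B" for x y
        by (rule steiner_dist_le[OF B(1) b D(1) B(3) that])
      show "reflect c x \<in> steiner b B" if c: "c \<in> insert b F" and x: "x \<in> steiner b B" for c x
      proof (cases "c = b")
        case True then show ?thesis using steiner_reflect[OF B(1) b x] by simp
      next
        case False
        then show ?thesis using steiner_reflect_other[OF b _ False _ x] B(4) c insert.prems by auto
      qed
    qed
  qed
  then obtain B :: "'a set" where B: "B \<in> sets borel" "emeasure lborel B = emeasure lborel A"
      "\<And>x y. x \<in> B \<Longrightarrow> y \<in> B \<Longrightarrow> dist x y \<le> D" "\<And>c x. c \<in> Basis \<Longrightarrow> x \<in> B \<Longrightarrow> reflect c x \<in> B"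
    using finite_Basis subset_refl by metis
  \<comment> \<open>Composing the reflections in the directions of \<open>F\<close> flips exactly
    those coordinates; \<open>F = Basis\<close> gives \<open>- x\<close>.\<close>
  have neg: "x - (\<Sum>c\<in>F. (2 * (x \<bullet> c)) *\<^sub>R c) \<in> B" if "finite F" "F \<subseteq> Basis" "x \<in> B" for F x
    using that
  proof (induction F)
    case (insert c F)
    let ?y = "x - (\<Sum>c\<in>F. (2 * (x \<bullet> c)) *\<^sub>R c)"
    have "(\<Sum>d\<in>F. (2 * (x \<bullet> d)) *\<^sub>R d) \<bullet> c = (\<Sum>d\<in>F. 2 * (x \<bullet> d) * (d \<bullet> c))"
      by (simp add: inner_sum_left)
    also have "\<dots> = 0"
    proof (intro sum.neutral ballI)
      fix d assume "d \<in> F"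
      then have "d \<bullet> c = 0" using insert by (intro inner_not_same_Basis) auto
      then show "2 * (x \<bullet> d) * (d \<bullet> c) = 0" by simp
    qed
    finally have "?y \<bullet> c = x \<bullet> c" by (simp add: inner_diff_left)
    then have "reflect c ?y = x - (\<Sum>d\<in>insert c F. (2 * (x \<bullet> d)) *\<^sub>R d)"
      using insert.hyps by (simp add: reflect_def algebra_simps)
    then show ?case using B(4)[of c ?y] insert by auto
  qed simp
  have "B \<subseteq> cball 0 (D / 2)"
  proof
    fix x assume x: "x \<in> B"
    have "(\<Sum>c\<in>Basis. (2 * (x \<bullet> c)) *\<^sub>R c) = 2 *\<^sub>R (\<Sum>c\<in>Basis. (x \<bullet> c) *\<^sub>R c)"
      by (simp add: scaleR_right.sum)
    then have "- x \<in> B" using neg[of Basis x] x by (simp add: euclidean_representation scaleR_2)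
    from B(3)[OF x this] show "x \<in> cball 0 (D / 2)" by (simp add: dist_norm flip: scaleR_2)
  qed
  then have "emeasure lborel B \<le> emeasure lborel (cball (0 :: 'a) (D / 2))"
    by (intro emeasure_mono) auto
  then show ?thesis using B(2) D(1) by (simp add: emeasure_cball)
qed

section \<open>The Hausdorff measure of the sphere\<close>

text \<open>Multiplied by the dimension, the volume of this cone is the surface measure to be
  expected of \<open>K\<close>; the measure of the sphere is found by comparing the two on small
  pieces.\<close>

definition unit_cone :: "'a::euclidean_space set \<Rightarrow> 'a set" where
  "unit_cone K = {y. y \<noteq> 0 \<and> norm y \<le> 1 \<and> y /\<^sub>R norm y \<in> K}"

lemma unit_cone_borel [measurable]:
  assumes [measurable]: "K \<in> sets borel"
  shows "unit_cone K \<in> sets borel"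
  unfolding unit_cone_def by measurable

text \<open>The section at height \<open>s\<close> is \<open>Z\<close> scaled by \<open>s\<close>,
  of volume \<open>s ^ DIM('a)\<close> times that of \<open>Z\<close>.\<close>

lemma emeasure_straight_cone:
  fixes Z :: "'a::euclidean_space set"
  assumes [measurable]: "Z \<in> sets borel" and h: "h \<ge> 0"
  shows "emeasure lborel {(z, s :: real). 0 < s \<and> s \<le> h \<and> z /\<^sub>R s \<in> Z}
     = ennreal (h ^ (DIM('a) + 1) / (DIM('a) + 1)) * emeasure lborel Z"
proof -
  let ?d = "DIM('a)"
  let ?C = "{(z, s :: real). 0 < s \<and> s \<le> h \<and> z /\<^sub>R s \<in> Z}"
  have "{x \<in> space (borel \<Otimes>\<^sub>M borel). 0 < snd x \<and> snd x \<le> h \<and> fst x /\<^sub>R snd x \<in> Z}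
      \<in> sets ((borel :: 'a measure) \<Otimes>\<^sub>M (borel :: real measure))" by measurable
  also have "{x \<in> space ((borel :: 'a measure) \<Otimes>\<^sub>M (borel :: real measure)). 0 < snd x \<and> snd x \<le> h \<and> fst x /\<^sub>R snd x \<in> Z} = ?C"
    by (auto simp: space_pair_measure)
  finally have C: "?C \<in> sets (borel \<Otimes>\<^sub>M borel)" .
  then have "?C \<in> sets ((lborel :: 'a measure) \<Otimes>\<^sub>M (lborel :: real measure))"
    by (simp cong: sets_pair_measure_cong)
  then have "emeasure lborel ?C = (\<integral>\<^sup>+s. emeasure lborel ((\<lambda>z. (z, s)) -` ?C) \<partial>lborel)"
    by (subst lborel_prod[symmetric], rule lborel_pair.emeasure_pair_measure_alt2)
  also have "\<dots> = (\<integral>\<^sup>+s. ennreal (s ^ ?d) * indicator {0..h} s * emeasure lborel Z \<partial>lborel)"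
  proof (rule nn_integral_cong)
    fix s :: real
    show "emeasure lborel ((\<lambda>z. (z, s)) -` ?C) = ennreal (s ^ ?d) * indicator {0..h} s * emeasure lborel Z"
    proof (cases "0 < s \<and> s \<le> h")
      case True
      then have "(\<lambda>z. (z, s)) -` ?C = (\<lambda>z. s *\<^sub>R z + 0) ` Z"
        by (auto simp: image_iff intro!: bexI[of _ "_ /\<^sub>R s"])
      moreover have "emeasure lebesgue ((\<lambda>z. s *\<^sub>R z + 0) ` Z) = ennreal (s ^ ?d) * emeasure lebesgue Z"
        using emeasure_lebesgue_affine[of s 0 Z] True by simp
      moreover have "(\<lambda>z. (z, s)) -` ?C \<in> sets borel" by (rule sets_Pair2[OF C])
      ultimately show ?thesis using True by simp
    next
      case False
      then have *: "(\<lambda>z. (z, s)) -` ?C = {}" by auto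
      \<comment> \<open>Height 0 lies in \<open>{0..h}\<close> but not in the cone; there the factor
        \<open>s ^ DIM('a)\<close> is 0.\<close>
      have "s = 0 \<or> s \<notin> {0..h}" using False by auto
      then show ?thesis unfolding * by auto
    qed
  qed
  also have "\<dots> = (\<integral>\<^sup>+s. ennreal (s ^ ?d) * indicator {0..h} s \<partial>lborel) * emeasure lborel Z"
    by (rule nn_integral_multc) measurable
  also have "(\<integral>\<^sup>+s. ennreal (s ^ ?d) * indicator {0..h} s \<partial>lborel)
      = ennreal (h ^ (?d + 1) / (?d + 1) - 0 ^ (?d + 1) / (?d + 1))"
  proof (rule nn_integral_FTC_Icc)
    show "((\<lambda>s. s ^ (?d + 1) / (?d + 1)) has_real_derivative s ^ ?d) (at s)" for s :: real
      using DERIV_cdivide[OF DERIV_pow[of "Suc ?d" s], of "real (Suc ?d)"] by simp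
  qed (use h in auto)
  finally show ?thesis by simp
qed

text \<open>The central projection of the cap around the north pole onto the tangent hyperplane there.\<close>

definition gnomonic :: "'a::real_normed_vector \<times> real \<Rightarrow> 'a" where
  "gnomonic x = fst x /\<^sub>R snd x"

definition gnomonic_inv :: "'a::real_normed_vector \<Rightarrow> 'a \<times> real" where
  "gnomonic_inv z = (z, 1) /\<^sub>R norm (z, 1 :: real)"

lemma norm_Pair_one_ge: "norm (z, 1 :: real) \<ge> 1"
  by (simp add: norm_Pair)

lemma gnomonic_inverse:
  assumes "norm x = 1" "snd x > 0"
  shows "gnomonic_inv (gnomonic x) = x"
proof -
  obtain z s where x: "x = (z, s)" by (cases x)
  have s: "s > 0" using assms by (simp add: x)
  have eq: "(z /\<^sub>R s, 1 :: real) = x /\<^sub>R s" using s by (simp add: x)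
  have n: "norm (x /\<^sub>R s) = inverse s" unfolding norm_scaleR using assms by (simp add: x)
  have "gnomonic_inv (gnomonic x) = (x /\<^sub>R s) /\<^sub>R norm (x /\<^sub>R s)"
    by (simp only: gnomonic_inv_def gnomonic_def x fst_conv snd_conv eq[unfolded x])
  then show ?thesis unfolding n using s by simp
qed

lemma gnomonic_gnomonic_inv: "gnomonic (gnomonic_inv z) = z"
proof -
  have "norm (z, 1 :: real) * inverse (norm (z, 1 :: real)) = 1"
    using norm_Pair_one_ge[of z] by (intro right_inverse) linarith
  then show ?thesis by (simp add: gnomonic_def gnomonic_inv_def)
qed

lemma norm_diff_square: "(norm (x - y :: 'a::real_inner))\<^sup>2 = (norm x)\<^sup>2 + (norm y)\<^sup>2 - 2 * (x \<bullet> y)"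
  by (simp add: power2_norm_eq_inner inner_diff_left inner_diff_right inner_commute)

text \<open>With \<open>a\<close>, \<open>b\<close> the norms and \<open>w\<close> the inner
  product, the squared left side is \<open>2 * (1 - w / (a * b))\<close>. Multiplying by
  \<open>a * b \<ge> 1\<close> only enlarges it, and \<open>2 * a * b \<le> a^2 + b^2\<close>
  finishes.\<close>

lemma dist_normalize_le:
  fixes u v :: "'a::real_inner"
  assumes "norm u \<ge> 1" "norm v \<ge> 1"
  shows "dist (u /\<^sub>R norm u) (v /\<^sub>R norm v) \<le> dist u v"
proof -
  let ?a = "norm u" and ?b = "norm v" and ?w = "u \<bullet> v"
  have ab: "?a * ?b \<ge> 1" using assms mult_mono[of 1 ?a 1 ?b] by simp
  have w: "?w \<le> ?a * ?b" by (rule norm_cauchy_schwarz)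
  have nz: "u \<noteq> 0" "v \<noteq> 0" using assms by auto
  have nn: "0 \<le> 1 - ?w / (?a * ?b)" using w ab by simp
  have "(dist (u /\<^sub>R ?a) (v /\<^sub>R ?b))\<^sup>2 = 2 * (1 - ?w / (?a * ?b))"
    using nz unfolding dist_norm norm_diff_square by (simp add: field_simps)
  also have "\<dots> \<le> 2 * (1 - ?w / (?a * ?b)) * (?a * ?b)"
    using mult_left_mono[OF ab, of "2 * (1 - ?w / (?a * ?b))"] nn by simp
  also have "\<dots> = 2 * (?a * ?b) - 2 * ?w" using nz by (simp add: field_simps)
  also have "\<dots> \<le> ?a\<^sup>2 + ?b\<^sup>2 - 2 * ?w" using sum_squares_bound[of ?a ?b] by simp
  also have "\<dots> = (dist u v)\<^sup>2"
    by (simp add: dist_norm norm_diff_square)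
  finally show ?thesis by (rule power2_le_imp_le) simp
qed

lemma dist_gnomonic_inv_le: "dist (gnomonic_inv y) (gnomonic_inv z) \<le> dist y (z :: 'a::real_inner)"
proof -
  have "dist (gnomonic_inv y) (gnomonic_inv z) \<le> dist (y, 1 :: real) (z, 1)"
    unfolding gnomonic_inv_def by (rule dist_normalize_le) (rule norm_Pair_one_ge)+
  also have "\<dots> = dist y z" by (simp add: dist_Pair_Pair)
  finally show ?thesis .
qed

lemma snd_ge_near_pole:
  fixes x :: "'a::real_inner \<times> real"
  assumes "norm x = 1" "dist x (0, 1) \<le> \<rho>"
  shows "snd x \<ge> 1 - \<rho>\<^sup>2 / 2"
proof -
  have "(dist x (0, 1))\<^sup>2 = (norm x)\<^sup>2 + 1 - 2 * snd x"
    unfolding dist_norm power2_norm_eq_inner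
    by (cases x) (simp add: inner_prod_def power2_eq_square algebra_simps)
  moreover have "(dist x (0, 1))\<^sup>2 \<le> \<rho>\<^sup>2" using assms(2) by (intro power_mono) auto
  ultimately show ?thesis using assms(1) by simp
qed

text \<open>For points of the sphere \<open>x - y\<close> is orthogonal to \<open>x + y\<close>, so
  near the pole their heights differ by at most \<open>\<rho> * dist x y\<close>. The factor by
  which the projection stretches distances thus tends to 1 as \<open>\<rho>\<close> tends to 0 and
  \<open>c\<close> to 1.\<close>

lemma dist_gnomonic_le:
  fixes x y :: "'a::real_inner \<times> real"
  assumes x: "norm x = 1" "dist x (0, 1) \<le> \<rho>" and y: "norm y = 1" "dist y (0, 1) \<le> \<rho>"
    and c: "c > 0" "c \<le> snd x" "c \<le> snd y"
  shows "dist (gnomonic x) (gnomonic y) \<le> (1 / c + \<rho> / c\<^sup>2) * dist x y"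
proof -
  let ?e = "(0, 1) :: 'a \<times> real"
  have "snd x - snd y = (x - y) \<bullet> ?e" by (simp add: inner_prod_def)
  \<comment> \<open>The pole may be replaced by its difference from the midpoint of \<open>x\<close>
    and \<open>y\<close>, a vector of norm at most \<open>\<rho>\<close>.\<close>
  also have "\<dots> = (x - y) \<bullet> ((1/2) *\<^sub>R ((?e - x) + (?e - y)))"
  proof -
    have "(x - y) \<bullet> (x + y) = (norm x)\<^sup>2 - (norm y)\<^sup>2"
      by (simp add: power2_norm_eq_inner inner_diff_left inner_add_right inner_commute[of y x])
    also have "\<dots> = 0" using x y by simp
    finally have "(x - y) \<bullet> (x + y) = 0" .
    then show ?thesis by (simp add: inner_add_right inner_diff_right)
  qed
  finally have "\<bar>snd x - snd y\<bar> \<le> norm (x - y) * norm ((1/2) *\<^sub>R ((?e - x) + (?e - y)))"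
    using Cauchy_Schwarz_ineq2 by metis
  also have "\<dots> \<le> norm (x - y) * \<rho>"
    using x(2) y(2) norm_triangle_ineq[of "?e - x" "?e - y"]
    by (intro mult_left_mono) (simp_all add: dist_norm norm_minus_commute)
  finally have s: "\<bar>snd x - snd y\<bar> \<le> \<rho> * dist x y" by (simp add: dist_norm mult.commute)
  have pos: "snd x > 0" "snd y > 0" using c by auto
  have eq: "gnomonic x - gnomonic y = (fst x - fst y) /\<^sub>R snd x + ((snd y - snd x) / (snd x * snd y)) *\<^sub>R fst y"
  proof -
    have e: "(snd y - snd x) / (snd x * snd y) = inverse (snd x) - inverse (snd y)"
      using pos by (simp add: field_simps)
    show ?thesis unfolding gnomonic_def e by (simp add: scaleR_diff_left scaleR_diff_right)
  qed
  have fst_le: "norm (fst z) \<le> norm z" for z :: "'a \<times> real"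
    using norm_fst_le[of "fst z" "snd z"] by (simp only: prod.collapse)
  have f: "norm (fst x - fst y) \<le> dist x y" "norm (fst y) \<le> 1"
    using fst_le[of "x - y"] fst_le[of y] y(1) by (simp_all add: dist_norm)
  have "dist (gnomonic x) (gnomonic y)
      \<le> norm ((fst x - fst y) /\<^sub>R snd x) + norm (((snd y - snd x) / (snd x * snd y)) *\<^sub>R fst y)"
    unfolding dist_norm eq by (rule norm_triangle_ineq)
  also have "\<dots> \<le> dist x y / c + \<rho> * dist x y / c\<^sup>2"
  proof (rule add_mono)
    have "norm ((fst x - fst y) /\<^sub>R snd x) = norm (fst x - fst y) / snd x"
      using pos by (simp add: divide_inverse mult.commute)
    also have "\<dots> \<le> dist x y / c" using f c by (intro frac_le) auto
    finally show "norm ((fst x - fst y) /\<^sub>R snd x) \<le> dist x y / c" .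
    have r: "0 \<le> \<rho> * dist x y" using s by linarith
    have "c\<^sup>2 \<le> snd x * snd y" unfolding power2_eq_square using c by (intro mult_mono) auto
    then have "\<bar>snd y - snd x\<bar> / (snd x * snd y) \<le> (\<rho> * dist x y) / c\<^sup>2"
      using s c r by (intro frac_le) auto
    then have "\<bar>snd y - snd x\<bar> / (snd x * snd y) * norm (fst y) \<le> (\<rho> * dist x y) / c\<^sup>2 * 1"
      using f(2) r by (intro mult_mono) auto
    then show "norm (((snd y - snd x) / (snd x * snd y)) *\<^sub>R fst y) \<le> \<rho> * dist x y / c\<^sup>2"
      using pos by (simp add: abs_mult)
  qed
  finally show ?thesis by (simp add: algebra_simps)
qed

text \<open>The cones consist of the same rays and differ only in where they are cut: at norm 1 or
  at a fixed height. The point of norm 1 on such a ray has height between \<open>c\<close> and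
  1.\<close>

lemma unit_cone_gnomonic:
  fixes K :: "('a::euclidean_space \<times> real) set"
  assumes K: "K \<subseteq> sphere 0 1" and c: "c > 0" "\<And>x. x \<in> K \<Longrightarrow> c \<le> snd x"
  shows "unit_cone K \<subseteq> {(z, s). 0 < s \<and> s \<le> 1 \<and> z /\<^sub>R s \<in> gnomonic ` K}"
    and "{(z, s). 0 < s \<and> s \<le> c \<and> z /\<^sub>R s \<in> gnomonic ` K} \<subseteq> unit_cone K"
proof -
  show "unit_cone K \<subseteq> {(z, s). 0 < s \<and> s \<le> 1 \<and> z /\<^sub>R s \<in> gnomonic ` K}"
  proof
    fix y assume y: "y \<in> unit_cone K"
    obtain z s where zs: "y = (z, s)" by (cases y)
    have K': "y /\<^sub>R norm y \<in> K" and n: "y \<noteq> 0" "norm y \<le> 1" using y by (auto simp: unit_cone_def)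
    from c(2)[OF K'] c(1) have "0 < inverse (norm y) * s" by (simp add: zs)
    then have s: "s > 0" using n by (simp add: zero_less_mult_iff)
    have "s \<le> norm y" using norm_snd_le[of s z] by (simp add: zs)
    moreover have "gnomonic (y /\<^sub>R norm y) = z /\<^sub>R s"
      using n s by (simp add: gnomonic_def zs)
    ultimately have "s \<le> norm y" "z /\<^sub>R s \<in> gnomonic ` K" using K' by (metis imageI)+
    then show "y \<in> {(z, s). 0 < s \<and> s \<le> 1 \<and> z /\<^sub>R s \<in> gnomonic ` K}"
      using s n(2) by (simp add: zs)
  qed
  show "{(z, s). 0 < s \<and> s \<le> c \<and> z /\<^sub>R s \<in> gnomonic ` K} \<subseteq> unit_cone K"
  proof safe
    fix z s x assume s: "0 < s" "s \<le> c" and x: "x \<in> K" and eq: "z /\<^sub>R s = gnomonic x"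
    have sx: "snd x \<ge> c" "snd x > 0" using c(2)[OF x] c(1) by auto
    have nx: "norm x = 1" using K x by auto
    have "z = s *\<^sub>R (z /\<^sub>R s)" using s by simp
    then have zs: "(z, s) = (s / snd x) *\<^sub>R x" unfolding eq using sx by (cases x) (simp add: gnomonic_def divide_inverse)
    then have n: "norm (z, s) = s / snd x" using nx sx s by simp
    have "(z, s) \<noteq> 0" using s by (simp add: zero_prod_def)
    moreover have "norm (z, s) \<le> 1" unfolding n using sx s by simp
    moreover have "(z, s) /\<^sub>R norm (z, s) = x" unfolding n using sx s by (simp add: zs)
    ultimately show "(z, s) \<in> unit_cone K" using x by (simp add: unit_cone_def)
  qed
qed

text \<open>Instead of studying an image, the set is recognised as the preimage of \<open>K\<close>
  under the continuous map \<open>gnomonic_inv\<close>.\<close>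

lemma gnomonic_image_borel:
  fixes K :: "('a::euclidean_space \<times> real) set"
  assumes K: "K \<in> sets borel" "K \<subseteq> sphere 0 1" "\<And>x. x \<in> K \<Longrightarrow> 0 < snd x"
  shows "gnomonic ` K \<in> sets borel"
proof -
  have "gnomonic ` K = gnomonic_inv -` K \<inter> space borel"
  proof (intro set_eqI iffI)
    fix z assume "z \<in> gnomonic ` K"
    then obtain x where x: "x \<in> K" "z = gnomonic x" by blast
    have "norm x = 1" "0 < snd x" using K(2,3) x(1) by auto
    then show "z \<in> gnomonic_inv -` K \<inter> space borel" using x by (simp add: gnomonic_inverse)
  next
    fix z assume "z \<in> gnomonic_inv -` K \<inter> space borel"
    then have "gnomonic (gnomonic_inv z) \<in> gnomonic ` K" by (intro imageI) simp
    then show "z \<in> gnomonic ` K" by (simp only: gnomonic_gnomonic_inv)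
  qed
  moreover have "gnomonic_inv \<in> borel_measurable (borel :: 'a measure)"
  proof -
    have "norm (z, 1 :: real) \<noteq> 0" for z :: 'a using norm_Pair_one_ge[of z] by linarith
    then show ?thesis
      unfolding gnomonic_inv_def by (intro borel_measurable_continuous_onI continuous_intros) blast
  qed
  ultimately show ?thesis using measurable_sets[of gnomonic_inv borel borel K] K(1) by (simp only:)
qed

lemma straight_cone_borel:
  fixes Z :: "'a::euclidean_space set"
  assumes [measurable]: "Z \<in> sets borel"
  shows "{(z, s :: real). 0 < s \<and> s \<le> h \<and> z /\<^sub>R s \<in> Z} \<in> sets borel"
proof -
  have "{x \<in> space (borel \<Otimes>\<^sub>M borel). 0 < snd x \<and> snd x \<le> h \<and> fst x /\<^sub>R snd x \<in> Z}
      \<in> sets ((borel :: 'a measure) \<Otimes>\<^sub>M (borel :: real measure))" by measurable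
  also have "(borel :: 'a measure) \<Otimes>\<^sub>M (borel :: real measure) = borel" by (rule borel_prod)
  also have "{x \<in> space borel. 0 < snd x \<and> snd x \<le> h \<and> fst x /\<^sub>R snd x \<in> Z}
      = {(z, s :: real). 0 < s \<and> s \<le> h \<and> z /\<^sub>R s \<in> Z}" by auto
  finally show ?thesis .
qed

text \<open>The source of lower bounds for the cost of covers: projected to the tangent hyperplane,
  a piece of diameter \<open>D\<close> has at most the volume that the isodiametric inequality
  allows for the slightly larger diameter.\<close>

lemma emeasure_unit_cone_le:
  fixes K :: "('e::euclidean_space \<times> real) set"
  assumes K: "K \<in> sets borel" "K \<subseteq> sphere 0 1" "K \<subseteq> cball (0, 1) \<rho>" and \<rho>: "0 \<le> \<rho>" "\<rho> \<le> 1"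
    and D: "D \<ge> 0" "\<And>x y. x \<in> K \<Longrightarrow> y \<in> K \<Longrightarrow> dist x y \<le> D"
    and c: "c = 1 - \<rho>\<^sup>2 / 2"
  shows "ennreal (DIM('e) + 1) * emeasure lborel (unit_cone K)
    \<le> ennreal (unit_ball_vol DIM('e) * ((1 / c + \<rho> / c\<^sup>2) * D / 2) ^ DIM('e))"
proof -
  have "\<rho>\<^sup>2 \<le> 1" using \<rho> by (simp add: power_le_one)
  then have c0: "c > 0" using c by simp
  have nx: "norm x = 1" "dist x (0, 1) \<le> \<rho>" if "x \<in> K" for x
    using that K(2,3) by (auto simp: dist_commute)
  have cs: "c \<le> snd x" if "x \<in> K" for x using snd_ge_near_pole[OF nx[OF that]] c by simp
  have gK: "gnomonic ` K \<in> sets borel"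
    using gnomonic_image_borel[OF K(1,2)] cs c0 by (meson less_le_trans)
  have "emeasure lborel (unit_cone K) \<le> emeasure lborel {(z, s). 0 < s \<and> s \<le> 1 \<and> z /\<^sub>R s \<in> gnomonic ` K}"
  proof (rule emeasure_mono[OF unit_cone_gnomonic(1)[OF K(2) c0 cs]])
    show "{(z, s). 0 < s \<and> s \<le> 1 \<and> z /\<^sub>R s \<in> gnomonic ` K} \<in> sets lborel"
      using straight_cone_borel[OF gK] by simp
  qed
  also have "\<dots> = ennreal (1 / (DIM('e) + 1)) * emeasure lborel (gnomonic ` K)"
    by (subst emeasure_straight_cone[OF gK]) auto
  finally have "ennreal (DIM('e) + 1) * emeasure lborel (unit_cone K)
      \<le> ennreal (DIM('e) + 1) * (ennreal (1 / (DIM('e) + 1)) * emeasure lborel (gnomonic ` K))"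
    by (rule mult_left_mono) simp
  also have "\<dots> = emeasure lborel (gnomonic ` K)"
  proof -
    have "ennreal (DIM('e) + 1) * ennreal (1 / (DIM('e) + 1)) = 1"
      by (subst ennreal_mult'[symmetric]) (simp_all del: of_nat_add)
    then show ?thesis unfolding mult.assoc[symmetric] by simp
  qed
  also have "\<dots> \<le> ennreal (unit_ball_vol DIM('e) * ((1 / c + \<rho> / c\<^sup>2) * D / 2) ^ DIM('e))"
  proof (rule isodiametric[OF gK])
    have L: "0 \<le> 1 / c + \<rho> / c\<^sup>2" using c0 \<rho> by simp
    show "0 \<le> (1 / c + \<rho> / c\<^sup>2) * D" using L D(1) by (rule mult_nonneg_nonneg)
    fix u v assume "u \<in> gnomonic ` K" "v \<in> gnomonic ` K"
    then obtain x y where xy: "x \<in> K" "u = gnomonic x" "y \<in> K" "v = gnomonic y" by blast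
    have "dist u v \<le> (1 / c + \<rho> / c\<^sup>2) * dist x y" unfolding xy
      by (rule dist_gnomonic_le[OF nx[OF xy(1)] nx[OF xy(3)] c0 cs[OF xy(1)] cs[OF xy(3)]])
    also have "\<dots> \<le> (1 / c + \<rho> / c\<^sup>2) * D" by (rule mult_left_mono[OF D(2)[OF xy(1,3)] L])
    finally show "dist u v \<le> (1 / c + \<rho> / c\<^sup>2) * D" .
  qed
  finally show ?thesis .
qed

text \<open>The opposite comparison: lifting from the tangent hyperplane to the sphere contracts,
  and in the hyperplane the premeasure is at most Lebesgue measure.\<close>

lemma hausdorff_premeasure_le_unit_cone:
  fixes K :: "('e::euclidean_space \<times> real) set"
  assumes K: "K \<in> sets borel" "K \<subseteq> sphere 0 1" "K \<subseteq> cball (0, 1) \<rho>" and \<rho>: "0 \<le> \<rho>" "\<rho> \<le> 1"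
    and c: "c = 1 - \<rho>\<^sup>2 / 2" and \<delta>: "\<delta> > 0"
  shows "hausdorff_premeasure DIM('e) \<delta> K \<le> ennreal ((DIM('e) + 1) / c ^ (DIM('e) + 1)) * emeasure lborel (unit_cone K)"
proof -
  have "\<rho>\<^sup>2 \<le> 1" using \<rho> by (simp add: power_le_one)
  then have c0: "c > 0" using c by simp
  have nx: "norm x = 1" "dist x (0, 1) \<le> \<rho>" if "x \<in> K" for x
    using that K(2,3) by (auto simp: dist_commute)
  have cs: "c \<le> snd x" if "x \<in> K" for x using snd_ge_near_pole[OF nx[OF that]] c by simp
  have gK: "gnomonic ` K \<in> sets borel"
    using gnomonic_image_borel[OF K(1,2)] cs c0 by (meson less_le_trans)
  have "gnomonic_inv (gnomonic x) = x" if "x \<in> K" for x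
    using gnomonic_inverse[OF nx(1)[OF that]] cs[OF that] c0 by simp
  then have KK: "K = gnomonic_inv ` gnomonic ` K" by (force simp: image_image)
  have "hausdorff_premeasure DIM('e) \<delta> K \<le> hausdorff_premeasure DIM('e) \<delta> (gnomonic ` K)"
    by (subst KK, rule hausdorff_premeasure_image_le, rule dist_gnomonic_inv_le)
  also have "\<dots> \<le> emeasure lebesgue (gnomonic ` K)"
    by (rule hausdorff_premeasure_le_lebesgue) (use gK \<delta> in auto)
  also have "\<dots> = emeasure lborel (gnomonic ` K)" using gK by simp
  also have "\<dots> = ennreal ((DIM('e) + 1) / c ^ (DIM('e) + 1)) *
      (ennreal (c ^ (DIM('e) + 1) / (DIM('e) + 1)) * emeasure lborel (gnomonic ` K))"
    using c0 by (simp add: mult.assoc[symmetric] flip: ennreal_mult')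
  also have "ennreal (c ^ (DIM('e) + 1) / (DIM('e) + 1)) * emeasure lborel (gnomonic ` K)
      = emeasure lborel {(z, s). 0 < s \<and> s \<le> c \<and> z /\<^sub>R s \<in> gnomonic ` K}"
    using emeasure_straight_cone[OF gK, of c] c0 by simp
  also have "\<dots> \<le> emeasure lborel (unit_cone K)"
    by (rule emeasure_mono[OF unit_cone_gnomonic(2)[OF K(2) c0 cs]]) (use unit_cone_borel[OF K(1)] in auto)
  finally show ?thesis by (simp add: mult_left_mono)
qed

text \<open>An index type for the tangent hyperplanes of the sphere in \<open>real ^ 'n\<close>.\<close>

typedef ('n::finite) lower = "{..<max 1 (CARD('n) - 1)}"
  by (auto intro: exI[of _ 0])

instance lower :: (finite) finite
proof
  have "finite (Rep_lower ` (UNIV :: 'a lower set))"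
    by (rule finite_subset[of _ "{..<max 1 (CARD('a) - 1)}"]) (use Rep_lower in auto)
  then show "finite (UNIV :: 'a lower set)"
    by (rule finite_imageD) (simp add: Rep_lower_inject inj_on_def)
qed

lemma card_lower:
  assumes "CARD('n::finite) \<ge> 2" shows "CARD('n lower) = CARD('n) - 1"
  using type_definition.card[OF type_definition_lower[where 'n='n]] assms by simp

text \<open>Rotation invariance of Lebesgue measure is available only for well-ordered index types.\<close>

typedef ('n::finite) index = "{..<CARD('n)}"
  by (auto intro: exI[of _ 0])

instance index :: (finite) finite
proof
  have "finite (Rep_index ` (UNIV :: 'a index set))"
    by (rule finite_subset[of _ "{..<CARD('a)}"]) (use Rep_index in auto)
  then show "finite (UNIV :: 'a index set)"
    by (rule finite_imageD) (simp add: Rep_index_inject inj_on_def)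
qed

lemma card_index: "CARD('n::finite index) = CARD('n)"
  using type_definition.card[OF type_definition_index[where 'n='n]] by simp

instantiation index :: (finite) wellorder
begin

definition less_eq_index :: "'a index \<Rightarrow> 'a index \<Rightarrow> bool" where
  "less_eq_index i j \<longleftrightarrow> Rep_index i \<le> Rep_index j"

definition less_index :: "'a index \<Rightarrow> 'a index \<Rightarrow> bool" where
  "less_index i j \<longleftrightarrow> Rep_index i < Rep_index j"

instance
proof
  fix i j k :: "'a index"
  show "i < j \<longleftrightarrow> i \<le> j \<and> \<not> j \<le> i" by (auto simp: less_eq_index_def less_index_def)
  show "i \<le> i" by (simp add: less_eq_index_def)
  show "i \<le> j \<Longrightarrow> j \<le> k \<Longrightarrow> i \<le> k" by (simp add: less_eq_index_def)
  show "i \<le> j \<Longrightarrow> j \<le> i \<Longrightarrow> i = j" by (simp add: less_eq_index_def flip: Rep_index_inject)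
  show "i \<le> j \<or> j \<le> i" by (auto simp: less_eq_index_def)
next
  fix P :: "'a index \<Rightarrow> bool" and i
  assume step: "\<And>i. (\<And>j. j < i \<Longrightarrow> P j) \<Longrightarrow> P i"
  show "P i"
  proof (induction "Rep_index i" arbitrary: i rule: less_induct)
    case less
    show ?case by (rule step, rule less) (simp add: less_index_def)
  qed
qed

end

text \<open>The map matches the two bases, so preimages of boxes are boxes of equal volume, which
  characterises Lebesgue measure. It carries measures between Euclidean spaces of different
  types.\<close>

lemma basis_isometry:
  fixes b0 :: "'a::euclidean_space" and b1 :: "'b::euclidean_space"
  assumes dim: "DIM('a) = DIM('b)" and b: "b0 \<in> Basis" "b1 \<in> Basis"
  obtains T :: "'a \<Rightarrow> 'b" where "linear T" "\<And>x. norm (T x) = norm x" "bij T" "T b0 = b1"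
    "\<And>A. A \<in> sets borel \<Longrightarrow> T ` A \<in> sets borel"
    "\<And>A. A \<in> sets borel \<Longrightarrow> emeasure lborel (T ` A) = emeasure lborel A"
proof -
  have "card (Basis - {b0}) = card (Basis - {b1})" using dim b by simp
  then obtain g where g: "bij_betw g (Basis - {b0}) (Basis - {b1})"
    by (metis finite_Basis finite_Diff finite_same_card_bij)
  define f where "f = g(b0 := b1)"
  have "bij_betw f (Basis - {b0}) (Basis - {b1})"
    using g by (subst bij_betw_cong[of _ _ g]) (auto simp: f_def)
  moreover have "bij_betw f {b0} {b1}" by (simp add: bij_betw_def f_def)
  ultimately have "bij_betw f ((Basis - {b0}) \<union> {b0}) ((Basis - {b1}) \<union> {b1})"
    by (rule bij_betw_combine) simp
  then have f: "bij_betw f Basis Basis" using b by (simp add: insert_absorb)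
  have fB: "f i \<in> Basis" if "i \<in> Basis" for i using f that by (auto simp: bij_betw_def)
  define T where "T x = (\<Sum>i\<in>Basis. (x \<bullet> i) *\<^sub>R f i)" for x
  have lin: "linear T"
    by (rule linearI) (simp_all add: T_def inner_add_left algebra_simps sum.distrib scaleR_right.sum)
  have Tf: "T x \<bullet> f i = x \<bullet> i" if i: "i \<in> Basis" for x i
  proof -
    have "T x \<bullet> f i = (\<Sum>j\<in>Basis. (x \<bullet> j) * (f j \<bullet> f i))" by (simp add: T_def inner_sum_left)
    also have "\<dots> = (\<Sum>j\<in>Basis. if j = i then x \<bullet> j else 0)"
      using f i by (intro sum.cong) (auto simp: inner_Basis fB bij_betw_def inj_on_eq_iff)
    finally show ?thesis using i by simp
  qed
  have inner: "T x \<bullet> T y = x \<bullet> y" for x y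
  proof -
    have "T x \<bullet> T y = (\<Sum>j\<in>Basis. (T x \<bullet> j) * (T y \<bullet> j))" by (rule euclidean_inner)
    also have "\<dots> = (\<Sum>i\<in>Basis. (T x \<bullet> f i) * (T y \<bullet> f i))"
      by (rule sum.reindex_bij_betw[OF f, symmetric])
    also have "\<dots> = x \<bullet> y" by (subst euclidean_inner[of x y]) (simp add: Tf)
    finally show ?thesis .
  qed
  have norm: "norm (T x) = norm x" for x by (simp add: norm_eq_sqrt_inner inner)
  have inj: "inj T"
    using lin norm by (metis linear_injective_0 norm_eq_zero)
  have "T (\<Sum>i\<in>Basis. (y \<bullet> f i) *\<^sub>R i) = y" for y
  proof (rule euclidean_eqI)
    fix b :: 'b assume "b \<in> Basis"
    then obtain i where i: "i \<in> Basis" "b = f i" using f by (auto simp: bij_betw_def)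
    then show "T (\<Sum>i\<in>Basis. (y \<bullet> f i) *\<^sub>R i) \<bullet> b = y \<bullet> b"
      by (simp add: Tf)
  qed
  then have surj: "surj T" by (rule surjI)
  have bij: "bij T" using inj surj by (simp add: bij_def)
  have "T b0 = (\<Sum>i\<in>Basis. if i = b0 then f i else 0)"
    unfolding T_def using b by (intro sum.cong) (auto simp: inner_Basis)
  also have "\<dots> = b1" using b by (simp add: f_def)
  finally have T0: "T b0 = b1" .
  have cont: "continuous_on UNIV T" using lin by (simp add: linear_continuous_on linear_linear)
  then have meas: "T \<in> borel_measurable borel" by (rule borel_measurable_continuous_onI)
  have "linear (inv T)"
    by (rule linearI; rule inv_f_eq[OF inj])
      (simp_all add: linear_add[OF lin] linear_scale[OF lin] surj_f_inv_f[OF surj])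
  then have "continuous_on UNIV (inv T)" by (simp add: linear_continuous_on linear_linear)
  then have meas': "inv T \<in> borel_measurable borel" by (rule borel_measurable_continuous_onI)
  have img: "T ` A = inv T -` A" for A using bij by (simp add: bij_vimage_eq_inv_image bij_imp_bij_inv inv_inv_eq)
  have borel: "T ` A \<in> sets borel" if "A \<in> sets borel" for A
    using measurable_sets[OF meas' that] by (simp add: img)
  have "lborel = distr lborel borel T"
  proof (rule lborel_eqI)
    fix l u :: 'b assume lu: "\<And>b. b \<in> Basis \<Longrightarrow> l \<bullet> b \<le> u \<bullet> b"
    have eq: "T -` box l u = box (inv T l) (inv T u)"
    proof (intro set_eqI)
      fix x
      have "x \<in> T -` box l u \<longleftrightarrow> (\<forall>j\<in>f ` Basis. l \<bullet> j < T x \<bullet> j \<and> T x \<bullet> j < u \<bullet> j)"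
        using f by (simp add: mem_box bij_betw_def)
      also have "\<dots> \<longleftrightarrow> (\<forall>i\<in>Basis. T (inv T l) \<bullet> f i < T x \<bullet> f i \<and> T x \<bullet> f i < T (inv T u) \<bullet> f i)"
        by (simp add: surj_f_inv_f[OF surj])
      also have "\<dots> \<longleftrightarrow> x \<in> box (inv T l) (inv T u)" by (simp add: Tf mem_box)
      finally show "x \<in> T -` box l u \<longleftrightarrow> x \<in> box (inv T l) (inv T u)" .
    qed
    have c: "inv T y \<bullet> i = y \<bullet> f i" if "i \<in> Basis" for i y
      using Tf[OF that, of "inv T y"] by (simp add: surj_f_inv_f[OF surj])
    have "emeasure (distr lborel borel T) (box l u) = emeasure lborel (T -` box l u)"
      by (subst emeasure_distr) (use meas in auto)
    also have "\<dots> = (\<Prod>i\<in>Basis. (inv T u - inv T l) \<bullet> i)"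
      unfolding eq by (rule emeasure_lborel_box) (use lu fB c in auto)
    also have "\<dots> = (\<Prod>i\<in>Basis. (u - l) \<bullet> f i)"
      by (intro arg_cong[where f=ennreal] prod.cong) (auto simp: inner_diff_left c)
    also have "\<dots> = (\<Prod>b\<in>Basis. (u - l) \<bullet> b)"
      by (subst prod.reindex_bij_betw[OF f, of "\<lambda>j. (u - l) \<bullet> j"]) simp
    finally show "emeasure (distr lborel borel T) (box l u) = (\<Prod>b\<in>Basis. (u - l) \<bullet> b)" .
  qed simp
  then have "emeasure lborel (T ` A) = emeasure lborel A" if "A \<in> sets borel" for A
    using emeasure_distr[of T lborel borel "T ` A"] meas borel[OF that] inj by (simp add: inj_vimage_image_eq)
  then show thesis using that[of T] lin norm bij T0 borel by blast
qed

lemma emeasure_orthogonal_image: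
  fixes R :: "real ^ 'm::{finite, wellorder} \<Rightarrow> real ^ 'm::{finite, wellorder}"
  assumes R: "orthogonal_transformation R" and A: "A \<in> sets borel" "bounded A"
  shows "R ` A \<in> sets borel" "emeasure lborel (R ` A) = emeasure lborel A"
proof -
  have bij: "bij R" using R by (rule orthogonal_transformation_bij)
  have "linear (inv R)" using R orthogonal_transformation_inv orthogonal_transformation_linear by blast
  then have "continuous_on UNIV (inv R)" by (simp add: linear_continuous_on linear_linear)
  then have "inv R \<in> borel_measurable borel" by (rule borel_measurable_continuous_onI)
  moreover have "R ` A = inv R -` A" using bij by (simp add: bij_vimage_eq_inv_image bij_imp_bij_inv inv_inv_eq)
  ultimately show RA: "R ` A \<in> sets borel"
    using measurable_sets[of "inv R" borel borel A] A by simp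
  have L: "A \<in> lmeasurable" using A by (simp add: bounded_set_imp_lmeasurable)
  have "emeasure lebesgue (R ` A) = emeasure lebesgue A"
    using measure_orthogonal_image[OF R L] measurable_orthogonal_image[OF R L] L
    by (simp add: emeasure_eq_measure2)
  then show "emeasure lborel (R ` A) = emeasure lborel A" using A RA by simp
qed

text \<open>Only the middle factor is a true rotation, taking the image of \<open>p\<close> to a
  coordinate axis. The outer two rename coordinates: first to the well-ordered index type, at the
  end to hyperplane times line.\<close>

lemma pole_isometry:
  fixes p :: "real ^ 'n"
  assumes n: "CARD('n) \<ge> 2" and p: "norm p = 1"
  obtains T :: "real ^ 'n \<Rightarrow> (real ^ 'n lower) \<times> real"
    where "linear T" "\<And>x. norm (T x) = norm x" "bij T" "T p = (0, 1)"
      "\<And>A. A \<in> sets borel \<Longrightarrow> bounded A \<Longrightarrow> T ` A \<in> sets borel"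
      "\<And>A. A \<in> sets borel \<Longrightarrow> bounded A \<Longrightarrow> emeasure lborel (T ` A) = emeasure lborel A"
proof -
  define k :: "'n index" where "k = undefined"
  define i :: 'n where "i = undefined"
  have dim1: "DIM(real ^ 'n index) = DIM((real ^ 'n lower) \<times> real)"
    using card_lower[OF n] n by (simp add: card_index)
  have b1: "axis k (1::real) \<in> Basis" "(0 :: real ^ 'n lower, 1 :: real) \<in> Basis"
    by (auto simp: Basis_prod_def)
  obtain U :: "real ^ 'n index \<Rightarrow> (real ^ 'n lower) \<times> real" where
    U: "linear U" "\<And>x. norm (U x) = norm x" "bij U" "U (axis k 1) = (0, 1)"
    "\<And>A. A \<in> sets borel \<Longrightarrow> U ` A \<in> sets borel"
    "\<And>A. A \<in> sets borel \<Longrightarrow> emeasure lborel (U ` A) = emeasure lborel A"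
    by (rule basis_isometry[OF dim1 b1]) blast
  have dim2: "DIM(real ^ 'n) = DIM(real ^ 'n index)" by (simp add: card_index)
  have b2: "axis i (1::real) \<in> Basis" "axis k (1::real) \<in> Basis" by auto
  obtain V :: "real ^ 'n \<Rightarrow> real ^ 'n index" where
    V: "linear V" "\<And>x. norm (V x) = norm x" "bij V" "V (axis i 1) = axis k 1"
    "\<And>A. A \<in> sets borel \<Longrightarrow> V ` A \<in> sets borel"
    "\<And>A. A \<in> sets borel \<Longrightarrow> emeasure lborel (V ` A) = emeasure lborel A"
    by (rule basis_isometry[OF dim2 b2]) blast
  obtain R :: "real ^ 'n index \<Rightarrow> real ^ 'n index" where R: "orthogonal_transformation R" "R (V p) = axis k 1"
    using orthogonal_transformation_exists[of "V p" "axis k (1 :: real)"] p V(2) by auto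
  have VA: "V ` A \<in> sets borel" "bounded (V ` A)" if "A \<in> sets borel" "bounded A" for A
    using V(1,5) that by (auto intro: bounded_linear_image simp: linear_linear)
  have eq: "(U \<circ> (R \<circ> V)) ` A = U ` R ` V ` A" for A by (simp add: image_comp comp_assoc)
  show thesis
  proof (rule that[of "U \<circ> (R \<circ> V)"])
    show "linear (U \<circ> (R \<circ> V))"
      by (intro linear_compose V(1) U(1) orthogonal_transformation_linear R(1))
    show "norm ((U \<circ> (R \<circ> V)) x) = norm x" for x
      using R(1) by (simp add: U V orthogonal_transformation_norm)
    show "bij (U \<circ> (R \<circ> V))" by (intro bij_comp V(3) U(3) orthogonal_transformation_bij R(1))
    show "(U \<circ> (R \<circ> V)) p = (0, 1)" by (simp add: R U)
    fix A :: "(real ^ 'n) set" assume A: "A \<in> sets borel" "bounded A"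
    note RA = emeasure_orthogonal_image[OF R(1) VA[OF A]]
    show "(U \<circ> (R \<circ> V)) ` A \<in> sets borel" unfolding eq by (rule U(5)[OF RA(1)])
    show "emeasure lborel ((U \<circ> (R \<circ> V)) ` A) = emeasure lborel A"
      unfolding eq by (simp only: U(6)[OF RA(1)] RA(2) V(6)[OF A(1)])
  qed
qed

lemma unit_cone_image:
  assumes "linear T" "\<And>x. norm (T x) = norm x" "bij T"
  shows "unit_cone (T ` K) = T ` unit_cone K"
proof -
  have T0: "T x = 0 \<longleftrightarrow> x = 0" for x using assms(2)[of x] by (metis norm_eq_zero)
  have "T x \<in> unit_cone (T ` K) \<longleftrightarrow> x \<in> unit_cone K" for x
    unfolding unit_cone_def mem_Collect_eq T0 assms(2) linear_scale[OF assms(1), symmetric]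
    using bij_is_inj[OF assms(3)] by (simp add: inj_image_mem_iff)
  then show ?thesis using bij_is_surj[OF assms(3)]
    by (intro set_eqI) (metis (no_types, lifting) image_iff surj_def)
qed

lemma unit_cone_subset_cball: "unit_cone K \<subseteq> cball 0 1"
  by (auto simp: unit_cone_def)

lemma bounded_unit_cone: "bounded (unit_cone K)"
  by (rule bounded_subset[OF bounded_cball unit_cone_subset_cball])

section \<open>The area of the sphere from the volumes of cones\<close>

context
  fixes n assumes n: "n = CARD('n::finite)" "n \<ge> 2"
begin

lemma emeasure_unit_cone_le':
  fixes K :: "(real ^ 'n) set"
  assumes K: "K \<in> sets borel" "K \<subseteq> sphere 0 1" "K \<subseteq> cball p \<rho>" and p: "norm p = 1" and \<rho>: "0 \<le> \<rho>" "\<rho> \<le> 1"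
    and D: "D \<ge> 0" "\<And>x y. x \<in> K \<Longrightarrow> y \<in> K \<Longrightarrow> dist x y \<le> D"
    and c: "c = 1 - \<rho>\<^sup>2 / 2"
  shows "ennreal n * emeasure lborel (unit_cone K)
    \<le> ennreal (unit_ball_vol (real (n - 1)) * ((1 / c + \<rho> / c\<^sup>2) * D / 2) ^ (n - 1))"
proof -
  obtain T :: "real ^ 'n \<Rightarrow> (real ^ 'n lower) \<times> real" where T: "linear T" "\<And>x. norm (T x) = norm x" "bij T" "T p = (0, 1)"
      "\<And>A. A \<in> sets borel \<Longrightarrow> bounded A \<Longrightarrow> T ` A \<in> sets borel"
      "\<And>A. A \<in> sets borel \<Longrightarrow> bounded A \<Longrightarrow> emeasure lborel (T ` A) = emeasure lborel A"
    by (rule pole_isometry[OF n(2)[unfolded n(1)] p]) blast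
  have d: "dist (T x) (T y) = dist x y" for x y
    unfolding dist_norm linear_diff[OF T(1), symmetric] T(2) ..
  have bK: "bounded K" using K(2) bounded_subset bounded_sphere by blast
  have card: "DIM(real ^ 'n lower) = n - 1" using card_lower[where 'n='n] n by simp
  have "ennreal (DIM(real ^ 'n lower) + 1) * emeasure lborel (unit_cone (T ` K))
    \<le> ennreal (unit_ball_vol DIM(real ^ 'n lower) * ((1 / c + \<rho> / c\<^sup>2) * D / 2) ^ DIM(real ^ 'n lower))"
  proof (rule emeasure_unit_cone_le[OF T(5)[OF K(1) bK] _ _ \<rho> D(1) _ c])
    show "T ` K \<subseteq> sphere 0 1" using K(2) T(2) by auto
    show "T ` K \<subseteq> cball (0, 1) \<rho>" unfolding T(4)[symmetric] using K(3) d by auto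
    show "dist x y \<le> D" if "x \<in> T ` K" "y \<in> T ` K" for x y using that d D(2) by auto
  qed
  then show ?thesis
    unfolding card unit_cone_image[OF T(1-3)] T(6)[OF unit_cone_borel[OF K(1)] bounded_unit_cone]
    using n(2) by simp
qed

lemma hausdorff_premeasure_le_unit_cone':
  fixes K :: "(real ^ 'n) set"
  assumes K: "K \<in> sets borel" "K \<subseteq> sphere 0 1" "K \<subseteq> cball p \<rho>" and p: "norm p = 1" and \<rho>: "0 \<le> \<rho>" "\<rho> \<le> 1"
    and c: "c = 1 - \<rho>\<^sup>2 / 2" and \<delta>: "\<delta> > 0"
  shows "hausdorff_premeasure (n - 1) \<delta> K \<le> ennreal (n / c ^ n) * emeasure lborel (unit_cone K)"
proof -
  obtain T :: "real ^ 'n \<Rightarrow> (real ^ 'n lower) \<times> real" where T: "linear T" "\<And>x. norm (T x) = norm x" "bij T" "T p = (0, 1)"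
      "\<And>A. A \<in> sets borel \<Longrightarrow> bounded A \<Longrightarrow> T ` A \<in> sets borel"
      "\<And>A. A \<in> sets borel \<Longrightarrow> bounded A \<Longrightarrow> emeasure lborel (T ` A) = emeasure lborel A"
    by (rule pole_isometry[OF n(2)[unfolded n(1)] p]) blast
  have d: "dist (T x) (T y) = dist x y" for x y
    unfolding dist_norm linear_diff[OF T(1), symmetric] T(2) ..
  have bK: "bounded K" using K(2) bounded_subset bounded_sphere by blast
  have card: "DIM(real ^ 'n lower) = n - 1" using card_lower[where 'n='n] n by simp
  have KT: "K = inv T ` T ` K" using T(3) by (simp add: bij_is_inj image_inv_f_f)
  have "hausdorff_premeasure (n - 1) \<delta> K \<le> hausdorff_premeasure (n - 1) \<delta> (T ` K)"
    by (subst KT, rule hausdorff_premeasure_image_le) (use d T(3) in \<open>auto simp: bij_is_inj\<close>)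
  also have "\<dots> \<le> ennreal ((DIM(real ^ 'n lower) + 1) / c ^ (DIM(real ^ 'n lower) + 1)) * emeasure lborel (unit_cone (T ` K))"
    unfolding card[symmetric]
  proof (rule hausdorff_premeasure_le_unit_cone[OF T(5)[OF K(1) bK] _ _ \<rho> c \<delta>])
    show "T ` K \<subseteq> sphere 0 1" using K(2) T(2) by auto
    show "T ` K \<subseteq> cball (0, 1) \<rho>" unfolding T(4)[symmetric] using K(3) d by auto
  qed
  finally show ?thesis
    unfolding card unit_cone_image[OF T(1-3)] T(6)[OF unit_cone_borel[OF K(1)] bounded_unit_cone]
    using n(2) by simp
qed

lemma unit_cone_sphere: "unit_cone (sphere 0 1) = cball (0 :: real ^ 'n) 1 - {0}"
  by (auto simp: unit_cone_def)

lemma emeasure_unit_cone_sphere: "emeasure lborel (unit_cone (sphere (0 :: real ^ 'n) 1)) = ennreal (unit_ball_vol n)"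
proof -
  have "emeasure lborel (cball (0 :: real ^ 'n) 1 - {0}) = emeasure lborel (cball (0 :: real ^ 'n) 1)"
    by (rule emeasure_Diff_null_set) auto
  then show ?thesis unfolding unit_cone_sphere using n(1) by (simp add: emeasure_cball)
qed

text \<open>Finitely many caps of radius \<open>\<rho>\<close>, made disjoint, split the ball into
  cones whose volumes add up. The bound does not contain the mesh \<open>\<delta>\<close>, so
  \<open>\<rho>\<close> can tend to 0 while \<open>\<delta>\<close> is fixed.\<close>

lemma hausdorff_premeasure_sphere_le:
  assumes \<delta>: "\<delta> > 0" and \<rho>: "0 < \<rho>" "\<rho> \<le> 1" and c: "c = 1 - \<rho>\<^sup>2 / 2"
  shows "hausdorff_premeasure (n - 1) \<delta> (sphere (0 :: real ^ 'n) 1) \<le> ennreal (n / c ^ n) * ennreal (unit_ball_vol n)"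
proof -
  let ?S = "sphere (0 :: real ^ 'n) 1"
  have "compact ?S" by simp
  moreover have "?S \<subseteq> (\<Union>p\<in>?S. ball p \<rho>)" using \<rho> by force
  ultimately obtain F where F: "F \<subseteq> ?S" "finite F" "?S \<subseteq> (\<Union>p\<in>F. ball p \<rho>)"
    using compactE_image[of ?S ?S "\<lambda>p. ball p \<rho>"] by (metis open_ball)
  obtain N and q :: "nat \<Rightarrow> _" where q: "bij_betw q {..<N} F"
    using ex_bij_betw_nat_finite[OF F(2)] by (auto simp: atLeast0LessThan)
  define P where "P j = ?S \<inter> (ball (q j) \<rho> - (\<Union>i<j. ball (q i) \<rho>))" for j
  have qS: "q j \<in> ?S" if "j < N" for j using q F(1) that by (auto simp: bij_betw_def)
  have PB: "P j \<in> sets borel" for j unfolding P_def by auto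
  have SU: "?S \<subseteq> (\<Union>j\<in>{..<N}. P j)"
  proof
    fix x assume x: "x \<in> ?S"
    then obtain r where r: "r \<in> F" "x \<in> ball r \<rho>" using F(3) by blast
    then obtain j where "j < N" "r = q j" using q by (auto simp: bij_betw_def)
    then have ex: "\<exists>j. j < N \<and> x \<in> ball (q j) \<rho>" using r by blast
    define j where "j = (LEAST j. j < N \<and> x \<in> ball (q j) \<rho>)"
    have j: "j < N" "x \<in> ball (q j) \<rho>" using LeastI_ex[OF ex] by (auto simp: j_def)
    have "x \<notin> ball (q i) \<rho>" if "i < j" for i
      using not_less_Least[of i "\<lambda>j. j < N \<and> x \<in> ball (q j) \<rho>"] that j(1) by (auto simp: j_def)
    then show "x \<in> (\<Union>j\<in>{..<N}. P j)" using x j by (auto simp: P_def)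
  qed
  have disj: "disjoint_family_on (\<lambda>j. unit_cone (P j)) {..<N}"
  proof -
    have "P i \<inter> P j = {}" if "i < j" for i j using that by (auto simp: P_def)
    then have "P i \<inter> P j = {}" if "i \<noteq> j" for i j using that by (metis Int_commute nat_neq_iff)
    then show ?thesis by (fastforce simp: disjoint_family_on_def unit_cone_def)
  qed
  have "hausdorff_premeasure (n - 1) \<delta> ?S \<le> hausdorff_premeasure (n - 1) \<delta> (\<Union>j\<in>{..<N}. P j)"
    by (rule hausdorff_premeasure_mono[OF SU])
  also have "\<dots> \<le> (\<Sum>j<N. hausdorff_premeasure (n - 1) \<delta> (P j))"
    by (rule hausdorff_premeasure_finite_UN_le) (use n(2) \<delta> in auto)
  also have "\<dots> \<le> (\<Sum>j<N. ennreal (n / c ^ n) * emeasure lborel (unit_cone (P j)))"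
  proof (rule sum_mono)
    fix j assume "j \<in> {..<N}"
    then show "hausdorff_premeasure (n - 1) \<delta> (P j) \<le> ennreal (n / c ^ n) * emeasure lborel (unit_cone (P j))"
      using \<rho> \<delta> qS[of j]
      by (intro hausdorff_premeasure_le_unit_cone'[OF PB, of j "q j" \<rho>] c) (auto simp: P_def)
  qed
  also have "\<dots> = ennreal (n / c ^ n) * (\<Sum>j<N. emeasure lborel (unit_cone (P j)))"
    by (rule sum_distrib_left[symmetric])
  also have "(\<Sum>j<N. emeasure lborel (unit_cone (P j))) = emeasure lborel (\<Union>j<N. unit_cone (P j))"
    by (rule sum_emeasure[OF _ disj]) (use unit_cone_borel[OF PB] in auto)
  also have "\<dots> \<le> emeasure lborel (unit_cone ?S)"
    by (rule emeasure_mono) (use unit_cone_borel[of ?S] in \<open>auto simp: unit_cone_def P_def\<close>)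
  also note emeasure_unit_cone_sphere
  finally show ?thesis by (simp add: mult_left_mono)
qed

text \<open>Sets of diameter at most \<open>\<rho>\<close> cut the sphere into pieces, each
  contained in the cap of radius \<open>\<rho>\<close> about any of its own points. The cones over
  the pieces cover the ball up to the origin, and the volume of each is controlled by the diameter
  of its piece.\<close>

lemma hausdorff_premeasure_sphere_ge:
  assumes \<rho>: "0 < \<rho>" "\<rho> \<le> 1" and c: "c = 1 - \<rho>\<^sup>2 / 2"
  shows "ennreal (n * unit_ball_vol n)
    \<le> ennreal ((1 / c + \<rho> / c\<^sup>2) ^ (n - 1)) * hausdorff_premeasure (n - 1) \<rho> (sphere (0 :: real ^ 'n) 1)"
proof -
  let ?S = "sphere (0 :: real ^ 'n) 1"
  let ?L = "1 / c + \<rho> / c\<^sup>2"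
  have "\<rho>\<^sup>2 \<le> 1" using \<rho> by (simp add: power_le_one)
  then have c0: "c > 0" using c by simp
  then have L0: "?L > 0" using \<rho> by (intro add_pos_pos) auto
  have key: "ennreal (n * unit_ball_vol n)
     \<le> ennreal (?L ^ (n - 1)) * (\<Sum>i. ennreal (unit_ball_vol (real (n - 1)) * (diameter (U i) / 2) ^ (n - 1)))"
    if U: "?S \<subseteq> (\<Union>i. U i)" "\<And>i. bounded (U i)" "\<And>i. diameter (U i) \<le> \<rho>" for U :: "nat \<Rightarrow> (real ^ 'n) set"
  proof -
    \<comment> \<open>The sets of a cover may be non-measurable; their closures are Borel and have
      the same diameter.\<close>
    define K where "K i = closure (U i) \<inter> ?S" for i
    have KB: "K i \<in> sets borel" for i unfolding K_def by auto
    have dK: "dist x y \<le> diameter (U i)" if "x \<in> K i" "y \<in> K i" for i x y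
      using diameter_bounded_bound[of "closure (U i)" x y] that U(2)[of i]
      by (auto simp: K_def diameter_closure bounded_closure)
    have piece: "ennreal n * emeasure lborel (unit_cone (K i))
      \<le> ennreal (?L ^ (n - 1)) * ennreal (unit_ball_vol (real (n - 1)) * (diameter (U i) / 2) ^ (n - 1))" for i
    proof (cases "K i = {}")
      case True
      then show ?thesis by (simp add: unit_cone_def)
    next
      case False
      then obtain p where p: "p \<in> K i" by auto
      have "ennreal n * emeasure lborel (unit_cone (K i))
         \<le> ennreal (unit_ball_vol (real (n - 1)) * (?L * diameter (U i) / 2) ^ (n - 1))"
      proof (rule emeasure_unit_cone_le'[OF KB])
        show "K i \<subseteq> cball p \<rho>"
          using order_trans[OF dK[OF p] U(3)[of i]] by (auto simp: subset_eq)
        show "K i \<subseteq> ?S" "norm p = 1" using p by (auto simp: K_def)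
        show "0 \<le> diameter (U i)" by (rule diameter_ge_0[OF U(2)])
      qed (use \<rho> dK c in auto)
      also have "\<dots> = ennreal (?L ^ (n - 1)) * ennreal (unit_ball_vol (real (n - 1)) * (diameter (U i) / 2) ^ (n - 1))"
        using L0 by (subst ennreal_mult'[symmetric]) (simp_all add: power_mult_distrib power_divide mult.left_commute)
      finally show ?thesis .
    qed
    have "ennreal (n * unit_ball_vol n) = ennreal n * emeasure lborel (unit_cone ?S)"
      unfolding emeasure_unit_cone_sphere by (rule ennreal_mult') simp
    also have "emeasure lborel (unit_cone ?S) \<le> emeasure lborel (\<Union>i. unit_cone (K i))"
    proof (rule emeasure_mono)
      show "unit_cone ?S \<subseteq> (\<Union>i. unit_cone (K i))"
      proof
        fix y assume y: "y \<in> unit_cone ?S"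
        then have "y /\<^sub>R norm y \<in> ?S" by (auto simp: unit_cone_def)
        then obtain i where "y /\<^sub>R norm y \<in> K i" using U(1) closure_subset unfolding K_def by blast
        then show "y \<in> (\<Union>i. unit_cone (K i))" using y by (auto simp: unit_cone_def)
      qed
    qed (use unit_cone_borel[OF KB] in auto)
    also have "\<dots> \<le> (\<Sum>i. emeasure lborel (unit_cone (K i)))"
      by (rule emeasure_subadditive_countably) (use unit_cone_borel[OF KB] in auto)
    finally have "ennreal (n * unit_ball_vol n) \<le> ennreal n * (\<Sum>i. emeasure lborel (unit_cone (K i)))"
      by (simp add: mult_left_mono)
    also have "\<dots> = (\<Sum>i. ennreal n * emeasure lborel (unit_cone (K i)))" by simp
    also have "\<dots> \<le> (\<Sum>i. ennreal (?L ^ (n - 1)) * ennreal (unit_ball_vol (real (n - 1)) * (diameter (U i) / 2) ^ (n - 1)))"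
      by (intro suminf_le piece summableI)
    finally show ?thesis by (simp only: ennreal_suminf_cmult)
  qed
  have "ennreal (n * unit_ball_vol n) / ennreal (?L ^ (n - 1)) \<le> hausdorff_premeasure (n - 1) \<rho> ?S"
    unfolding hausdorff_premeasure_def
  proof (intro INF_greatest, clarify)
    fix U :: "nat \<Rightarrow> (real ^ 'n) set" assume "?S \<subseteq> (\<Union>i. U i)" "\<forall>i. bounded (U i) \<and> diameter (U i) \<le> \<rho>"
    then show "ennreal (n * unit_ball_vol n) / ennreal (?L ^ (n - 1))
      \<le> (\<Sum>i. ennreal (unit_ball_vol (real (n - 1)) * (diameter (U i) / 2) ^ (n - 1)))"
      using key[of U] L0 by (intro divide_le_posI_ennreal) (auto simp: mult.commute)
  qed
  then have "ennreal (?L ^ (n - 1)) * (ennreal (n * unit_ball_vol n) / ennreal (?L ^ (n - 1)))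
      \<le> ennreal (?L ^ (n - 1)) * hausdorff_premeasure (n - 1) \<rho> ?S"
    by (rule mult_left_mono) simp
  also have "ennreal (?L ^ (n - 1)) * (ennreal (n * unit_ball_vol n) / ennreal (?L ^ (n - 1))) = ennreal (n * unit_ball_vol n)"
    using L0 by (simp add: divide_ennreal flip: ennreal_mult')
  finally show ?thesis .
qed

text \<open>Both one-sided estimates carry factors that tend to 1 as \<open>\<rho>\<close> tends to
  0. In the lower one \<open>\<rho>\<close> is at once the mesh of the covers and the radius of the
  caps.\<close>

theorem hausdorff_measure_sphere:
  "hausdorff_measure (n - 1) (sphere (0 :: real ^ 'n) 1) = ennreal (n * unit_ball_vol n)"
proof (rule antisym)
  let ?S = "sphere (0 :: real ^ 'n) 1"
  let ?c = "\<lambda>\<rho>::real. 1 - \<rho>\<^sup>2 / 2"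
  have ev: "eventually (\<lambda>\<rho>. 0 < \<rho> \<and> \<rho> \<le> (1::real)) (at_right 0)"
    by (auto simp: eventually_at_right_field intro!: exI[of _ 1])
  show "hausdorff_measure (n - 1) ?S \<le> ennreal (n * unit_ball_vol n)"
    unfolding hausdorff_measure_def
  proof (rule SUP_least)
    fix \<delta> :: real assume "\<delta> \<in> {0<..}"
    then have \<delta>: "\<delta> > 0" by simp
    have "((\<lambda>\<rho>. ennreal (n / ?c \<rho> ^ n * unit_ball_vol n)) \<longlongrightarrow> ennreal (n / ?c 0 ^ n * unit_ball_vol n)) (at_right 0)"
      by (intro tendsto_intros) auto
    moreover have "eventually (\<lambda>\<rho>. hausdorff_premeasure (n - 1) \<delta> ?S \<le> ennreal (n / ?c \<rho> ^ n * unit_ball_vol n)) (at_right 0)"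
      using ev
    proof eventually_elim
      case (elim \<rho>)
      have "\<rho>\<^sup>2 \<le> 1" using elim by (simp add: power_le_one)
      then have "ennreal (n / ?c \<rho> ^ n * unit_ball_vol n) = ennreal (n / ?c \<rho> ^ n) * ennreal (unit_ball_vol n)"
        by (intro ennreal_mult') auto
      then show ?case using hausdorff_premeasure_sphere_le[OF \<delta> conjunct1[OF elim] conjunct2[OF elim] refl] by simp
    qed
    ultimately have "hausdorff_premeasure (n - 1) \<delta> ?S \<le> ennreal (n / ?c 0 ^ n * unit_ball_vol n)"
      by (rule tendsto_lowerbound) simp
    then show "hausdorff_premeasure (n - 1) \<delta> ?S \<le> ennreal (n * unit_ball_vol n)" by simp
  qed
  let ?L = "\<lambda>\<rho>. (1 / ?c \<rho> + \<rho> / (?c \<rho>)\<^sup>2) ^ (n - 1)"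
  show "ennreal (n * unit_ball_vol n) \<le> hausdorff_measure (n - 1) ?S"
  proof (cases "hausdorff_measure (n - 1) ?S = top")
    case False
    have "((\<lambda>\<rho>. ennreal (?L \<rho>) * hausdorff_measure (n - 1) ?S) \<longlongrightarrow> ennreal (?L 0) * hausdorff_measure (n - 1) ?S) (at_right 0)"
      using False by (intro tendsto_mult_ennreal tendsto_intros) auto
    moreover have "eventually (\<lambda>\<rho>. ennreal (n * unit_ball_vol n) \<le> ennreal (?L \<rho>) * hausdorff_measure (n - 1) ?S) (at_right 0)"
      using ev
    proof eventually_elim
      case (elim \<rho>)
      have "hausdorff_premeasure (n - 1) \<rho> ?S \<le> hausdorff_measure (n - 1) ?S"
        unfolding hausdorff_measure_def by (rule SUP_upper) (use elim in auto)
      then show ?case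
        using hausdorff_premeasure_sphere_ge[OF conjunct1[OF elim] conjunct2[OF elim] refl]
        by (meson mult_left_mono order_trans zero_le)
    qed
    ultimately have "ennreal (n * unit_ball_vol n) \<le> ennreal (?L 0) * hausdorff_measure (n - 1) ?S"
      by (rule tendsto_lowerbound) simp
    then show ?thesis by simp
  qed simp
qed

end

lemma sphere_area_eq:
  assumes "CARD('n::finite) \<ge> 2"
  shows "sphere_area TYPE('n) = CARD('n) * unit_ball_vol (CARD('n))"
  unfolding sphere_area_def hausdorff_measure_sphere[OF refl assms] by simp

section \<open>Green's identity on balls\<close>

lemma directional_diff_le:
  fixes F :: "'a::euclidean_space \<Rightarrow> real"
  assumes deriv: "\<And>x. ((\<lambda>t. F (x + t *\<^sub>R b)) has_real_derivative F' x) (at 0)"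
    and M: "\<And>x. x \<in> S \<Longrightarrow> \<bar>F' x\<bar> \<le> M" and S: "convex S" "p \<in> S" "p + s *\<^sub>R b \<in> S"
  shows "\<bar>F (p + s *\<^sub>R b) - F p\<bar> \<le> M * \<bar>s\<bar>"
proof -
  have D: "((\<lambda>\<tau>. F (p + (\<tau> * s) *\<^sub>R b)) has_real_derivative F' (p + (\<tau> * s) *\<^sub>R b) * s) (at \<tau>)" for \<tau>
  proof -
    have "((\<lambda>t. F (p + (\<tau> * s) *\<^sub>R b + t *\<^sub>R b)) has_real_derivative F' (p + (\<tau> * s) *\<^sub>R b)) (at ((\<tau> - \<tau>) * s))"
      using deriv by simp
    moreover have "((\<lambda>u. (u - \<tau>) * s) has_real_derivative s) (at \<tau>)"
      by (auto intro!: derivative_eq_intros)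
    ultimately have "((\<lambda>u. F (p + (\<tau> * s) *\<^sub>R b + ((u - \<tau>) * s) *\<^sub>R b)) has_real_derivative
        F' (p + (\<tau> * s) *\<^sub>R b) * s) (at \<tau>)"
      by (rule DERIV_chain2)
    then show ?thesis by (simp add: algebra_simps)
  qed
  obtain z where z: "0 < z" "z < 1" "F (p + (1 * s) *\<^sub>R b) - F (p + (0 * s) *\<^sub>R b) = (1 - 0) * (F' (p + (z * s) *\<^sub>R b) * s)"
    using MVT2[of 0 1 "\<lambda>\<tau>. F (p + (\<tau> * s) *\<^sub>R b)" "\<lambda>\<tau>. F' (p + (\<tau> * s) *\<^sub>R b) * s"] D by auto
  have "p + (z * s) *\<^sub>R b = (1 - z) *\<^sub>R p + z *\<^sub>R (p + s *\<^sub>R b)" by (simp add: algebra_simps)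
  also have "\<dots> \<in> S" using S z by (intro convexD) auto
  finally have "\<bar>F' (p + (z * s) *\<^sub>R b)\<bar> * \<bar>s\<bar> \<le> M * \<bar>s\<bar>" using M by (intro mult_right_mono) auto
  then show ?thesis using z(3) by (simp add: abs_mult)
qed

lemma integrable_indicator_ball:
  fixes f :: "'a::euclidean_space \<Rightarrow> real"
  assumes "continuous_on UNIV f"
  shows "integrable lborel (\<lambda>y. indicator (ball x r) y * f y)"
proof -
  have "integrable lborel (\<lambda>y. indicator (cball x r) y *\<^sub>R f y)"
    by (rule borel_integrable_compact) (use continuous_on_subset[OF assms] in auto)
  then have "integrable lborel (\<lambda>y. indicator (ball x r) y *\<^sub>R (indicator (cball x r) y *\<^sub>R f y))"
    by (rule integrable_mult_indicator[rotated]) simp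
  also have "(\<lambda>y. indicator (ball x r) y *\<^sub>R (indicator (cball x r) y *\<^sub>R f y)) = (\<lambda>y. indicator (ball x r) y * f y)"
    by (auto simp: indicator_def fun_eq_iff)
  finally show ?thesis .
qed

text \<open>The extension of F by zero is Lipschitz in the direction b, and the integrals of its
  difference quotients vanish by translation invariance.\<close>

lemma integral_ball_directional_derivative:
  fixes F :: "'a::euclidean_space \<Rightarrow> real"
  assumes deriv: "\<And>x. ((\<lambda>t. F (x + t *\<^sub>R b)) has_real_derivative F' x) (at 0)"
    and cF: "continuous_on UNIV F" and cF': "continuous_on UNIV F'"
    and zero: "\<And>x. x \<in> sphere c r \<Longrightarrow> F x = 0"
  shows "(LINT x|lborel. indicator (ball c r) x * F' x) = 0"
proof -
  have "compact (F' ` cball c r)"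
    by (intro compact_continuous_image continuous_on_subset[OF cF']) auto
  then obtain M0 where M0: "\<And>x. x \<in> cball c r \<Longrightarrow> \<bar>F' x\<bar> \<le> M0"
    using compact_imp_bounded[THEN bounded_iff[THEN iffD1]] by (metis imageI real_norm_def)
  define M where "M = max M0 0"
  have M: "\<And>x. x \<in> cball c r \<Longrightarrow> \<bar>F' x\<bar> \<le> M" and Mnn: "M \<ge> 0"
    using M0 by (fastforce simp: M_def)+
  define H where "H x = indicator (ball c r) x * F x" for x
  have [measurable]: "F \<in> borel_measurable borel" "F' \<in> borel_measurable borel"
    using cF cF' by (auto intro: borel_measurable_continuous_onI)
  have [measurable]: "ball c r \<in> sets borel" by simp
  have H[measurable]: "H \<in> borel_measurable borel" unfolding H_def by measurable
  \<comment> \<open>A segment from inside to outside meets the sphere, where \<open>F\<close>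
    vanishes; so \<open>\<bar>F p\<bar>\<close> is at most the slope times the length.\<close>
  have mixed: "\<bar>F p\<bar> \<le> M * \<bar>s\<bar>" if p: "p \<in> ball c r" and q: "p + s *\<^sub>R b \<notin> ball c r" for p s
  proof -
    have "continuous_on {0..1} (\<lambda>t. dist c (p + (t * s) *\<^sub>R b))" by (intro continuous_intros)
    then obtain t where t: "0 \<le> t" "t \<le> 1" "dist c (p + (t * s) *\<^sub>R b) = r"
      using IVT'[of "\<lambda>t. dist c (p + (t * s) *\<^sub>R b)" 0 r 1] p q by auto
    have "\<bar>F (p + (t * s) *\<^sub>R b) - F p\<bar> \<le> M * \<bar>t * s\<bar>"
      by (rule directional_diff_le[OF deriv M convex_cball]) (use p t in auto)
    moreover have "F (p + (t * s) *\<^sub>R b) = 0" using t by (intro zero) simp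
    moreover have "M * \<bar>t * s\<bar> \<le> M * \<bar>s\<bar>"
    proof (rule mult_left_mono)
      show "\<bar>t * s\<bar> \<le> \<bar>s\<bar>" using t by (simp add: abs_mult mult_left_le_one_le)
      show "0 \<le> M" by (rule Mnn)
    qed
    ultimately show ?thesis by simp
  qed
  have lip: "\<bar>H (x + s *\<^sub>R b) - H x\<bar> \<le> M * \<bar>s\<bar>" if nz: "x \<in> ball c r \<or> x + s *\<^sub>R b \<in> ball c r" for x s
  proof (cases "x \<in> ball c r"; cases "x + s *\<^sub>R b \<in> ball c r")
    assume "x \<in> ball c r" "x + s *\<^sub>R b \<in> ball c r"
    then show ?thesis using directional_diff_le[OF deriv M convex_cball[of c r], of x s] by (simp add: H_def)
  next
    assume "x \<in> ball c r" "x + s *\<^sub>R b \<notin> ball c r"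
    then show ?thesis using mixed[of x s] by (simp add: H_def)
  next
    assume "x \<notin> ball c r" "x + s *\<^sub>R b \<in> ball c r"
    then show ?thesis using mixed[of "x + s *\<^sub>R b" "- s"] by (simp add: H_def)
  qed (use nz in auto)
  define h where "h k = 1 / real (Suc k)" for k
  have h: "0 < h k" "h k \<le> 1" for k by (auto simp: h_def)
  have h0: "h \<longlonglongrightarrow> 0" unfolding h_def using LIMSEQ_inverse_real_of_nat by (simp add: inverse_eq_divide)
  let ?D = "\<lambda>k x. (H (x + h k *\<^sub>R b) - H x) / h k"
  have intH: "integrable lborel H"
    unfolding H_def[abs_def] by (rule integrable_indicator_ball[OF cF])
  have zeroD: "(LINT x|lborel. ?D k x) = 0" for k
  proof -
    have *: "integrable lborel (\<lambda>x. H (h k *\<^sub>R b + x))" "(LINT x|lborel. H (h k *\<^sub>R b + x)) = (LINT x|lborel. H x)"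
    proof -
      have e: "distr lborel borel ((+) (h k *\<^sub>R b)) = (lborel :: 'a measure)" by (rule lborel_distr_plus)
      show "integrable lborel (\<lambda>x. H (h k *\<^sub>R b + x))"
        using intH by (subst (asm) e[symmetric], subst (asm) integrable_distr_eq) auto
      show "(LINT x|lborel. H (h k *\<^sub>R b + x)) = (LINT x|lborel. H x)"
        by (subst (2) e[symmetric], subst integral_distr) auto
    qed
    then show ?thesis using intH by (simp add: add.commute)
  qed
  have "(\<lambda>k. LINT x|lborel. ?D k x) \<longlonglongrightarrow> (LINT x|lborel. indicator (ball c r) x * F' x)"
  proof (rule integral_dominated_convergence[where w="\<lambda>x. M * indicator (cball c (r + norm b)) x"])
    show "(\<lambda>x. indicator (ball c r) x * F' x) \<in> borel_measurable lborel" by measurable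
    show "?D k \<in> borel_measurable lborel" for k by measurable
    show "integrable lborel (\<lambda>x. M * indicator (cball c (r + norm b)) x)"
      by (intro integrable_mult_right integrable_real_indicator emeasure_bounded_finite bounded_cball) simp
    show "AE x in lborel. norm (?D k x) \<le> M * indicator (cball c (r + norm b)) x" for k
    proof (rule AE_I2)
      fix x
      show "norm (?D k x) \<le> M * indicator (cball c (r + norm b)) x"
      proof (cases "x \<in> ball c r \<or> x + h k *\<^sub>R b \<in> ball c r")
        case True
        have "dist c x \<le> r + norm b"
        proof (cases "x \<in> ball c r")
          case False
          with True have "dist c (x + h k *\<^sub>R b) < r" by auto
          moreover have "dist (x + h k *\<^sub>R b) x \<le> norm b"
            using h[of k] by (simp add: dist_norm mult_left_le_one_le)
          ultimately show ?thesis using dist_triangle[of c x "x + h k *\<^sub>R b"] by simp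
        qed (use norm_ge_zero[of b] in \<open>auto simp del: norm_ge_zero\<close>)
        then show ?thesis using lip[OF True] h(1)[of k] by (simp add: field_simps)
      qed (simp add: H_def Mnn)
    qed
    \<comment> \<open>At points of the sphere the extension by zero may fail to be differentiable;
      they form a null set.\<close>
    have "AE x in lborel. x \<notin> sphere c r"
      using negligible_sphere[of c r] by (intro AE_not_in) (simp add: negligible_iff_null_sets null_sets_completion_iff)
    then show "AE x in lborel. (\<lambda>k. ?D k x) \<longlonglongrightarrow> indicator (ball c r) x * F' x"
    proof eventually_elim
      case (elim x)
      have cont: "((\<lambda>k. x + h k *\<^sub>R b) \<longlongrightarrow> x + 0 *\<^sub>R b) sequentially" by (intro tendsto_intros h0)
      show ?case
      proof (cases "x \<in> ball c r")
        case True
        have "eventually (\<lambda>k. x + h k *\<^sub>R b \<in> ball c r) sequentially"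
          using cont True by (intro topological_tendstoD[OF cont]) auto
        moreover have "(\<lambda>k. (F (x + h k *\<^sub>R b) - F (x + 0 *\<^sub>R b)) / (h k - 0)) \<longlonglongrightarrow> F' x"
        proof -
          have "((\<lambda>t. (F (x + t *\<^sub>R b) - F (x + 0 *\<^sub>R b)) / (t - 0)) \<longlongrightarrow> F' x) (at 0)"
            using deriv[of x] by (simp add: has_field_derivative_iff)
          moreover have "filterlim h (at 0) sequentially"
            using h0 h(1) by (intro filterlim_atI) (auto simp: less_imp_neq[THEN not_sym])
          ultimately show ?thesis by (rule filterlim_compose)
        qed
        moreover have "eventually (\<lambda>k. (F (x + h k *\<^sub>R b) - F (x + 0 *\<^sub>R b)) / (h k - 0) = ?D k x) sequentially"
          using calculation(1) by eventually_elim (use True in \<open>simp add: H_def\<close>)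
        ultimately have "(\<lambda>k. ?D k x) \<longlonglongrightarrow> F' x" by (blast intro: Lim_transform_eventually)
        then show ?thesis using True by simp
      next
        case False
        then have "x \<in> - cball c r" using elim by auto
        then have "eventually (\<lambda>k. x + h k *\<^sub>R b \<in> - cball c r) sequentially"
          by (intro topological_tendstoD[OF cont]) auto
        then have "eventually (\<lambda>k. 0 = ?D k x) sequentially"
          by eventually_elim (use False in \<open>auto simp: H_def indicator_def\<close>)
        then show ?thesis using False by (intro Lim_transform_eventually[OF tendsto_const]) auto
      qed
    qed
  qed
  then show ?thesis unfolding zeroD by (simp add: LIMSEQ_const_iff)
qed

text \<open>A relation that holds on the whole space: the regularised kernels are smooth everywhere,
  so no domains have to be carried along.\<close>

definition has_partial :: "'n \<Rightarrow> (real ^ 'n::finite \<Rightarrow> real) \<Rightarrow> (real ^ 'n \<Rightarrow> real) \<Rightarrow> bool" where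
  "has_partial i F F' \<longleftrightarrow> (\<forall>x. ((\<lambda>t. F (x + t *\<^sub>R axis i 1)) has_real_derivative F' x) (at 0))"

lemma has_partialD: "has_partial i F F' \<Longrightarrow> ((\<lambda>t. F (x + t *\<^sub>R axis i 1)) has_real_derivative F' x) (at 0)"
  by (simp add: has_partial_def)

lemma has_partial_diff:
  "has_partial i F F' \<Longrightarrow> has_partial i G G' \<Longrightarrow> has_partial i (\<lambda>x. F x - G x) (\<lambda>x. F' x - G' x)"
  unfolding has_partial_def by (auto intro: DERIV_diff)

lemma has_partial_mult:
  "has_partial i F F' \<Longrightarrow> has_partial i G G' \<Longrightarrow> has_partial i (\<lambda>x. F x * G x) (\<lambda>x. F' x * G x + F x * G' x)"
  unfolding has_partial_def
  by (intro allI) (drule spec, drule spec, drule (1) DERIV_mult, simp add: add.commute mult.commute)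

lemma has_partial_compose:
  assumes "has_partial i Q Q'" "\<And>x. (h has_real_derivative h' x) (at (Q x))"
  shows "has_partial i (\<lambda>x. h (Q x)) (\<lambda>x. h' x * Q' x)"
  unfolding has_partial_def
proof
  fix x
  have "(h has_real_derivative h' x) (at (Q (x + 0 *\<^sub>R axis i 1)))" using assms(2)[of x] by simp
  from DERIV_chain2[OF this has_partialD[OF assms(1)]]
  show "((\<lambda>t. h (Q (x + t *\<^sub>R axis i 1))) has_real_derivative h' x * Q' x) (at 0)" .
qed

lemma has_partial_nth: "has_partial i (\<lambda>x. x $ i) (\<lambda>x. 1)"
  unfolding has_partial_def by (auto intro!: derivative_eq_intros)

lemma has_partial_const: "has_partial i (\<lambda>x. c) (\<lambda>x. 0)"
  unfolding has_partial_def by simp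

lemma has_partial_cong:
  "has_partial i F F' \<Longrightarrow> (\<And>x. F x = G x) \<Longrightarrow> (\<And>x. F' x = G' x) \<Longrightarrow> has_partial i G G'"
  by (simp add: has_partial_def)

lemma partial_derivative_eq: "has_partial i F F' \<Longrightarrow> partial_derivative i F = F'"
  unfolding partial_derivative_def using has_partialD DERIV_imp_deriv by blast

text \<open>Since \<open>u\<close> and \<open>v\<close> vanish on the sphere, so do the components
  \<open>u * v1 i - v * u1 i\<close> of the field in Green's identity; hence no surface integral
  occurs.\<close>

lemma green_second_identity:
  fixes u v :: "real ^ 'n::finite \<Rightarrow> real"
  assumes u: "\<And>i. has_partial i u (u1 i)" "\<And>i. has_partial i (u1 i) (u2 i)"
    and v: "\<And>i. has_partial i v (v1 i)" "\<And>i. has_partial i (v1 i) (v2 i)"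
    and cont: "continuous_on UNIV u" "continuous_on UNIV v" "\<And>i. continuous_on UNIV (u1 i)" "\<And>i. continuous_on UNIV (v1 i)"
       "\<And>i. continuous_on UNIV (u2 i)" "\<And>i. continuous_on UNIV (v2 i)"
    and zero: "\<And>x. x \<in> sphere c r \<Longrightarrow> u x = 0" "\<And>x. x \<in> sphere c r \<Longrightarrow> v x = 0"
  shows "(LINT x|lborel. indicator (ball c r) x * (u x * (\<Sum>i\<in>UNIV. v2 i x)))
       = (LINT x|lborel. indicator (ball c r) x * (v x * (\<Sum>i\<in>UNIV. u2 i x)))"
proof -
  note int = integrable_indicator_ball[where x=c and r=r]
  have z: "(LINT x|lborel. indicator (ball c r) x * (u x * v2 i x - v x * u2 i x)) = 0" for i
  proof (rule integral_ball_directional_derivative[where b="axis i 1" and F="\<lambda>x. u x * v1 i x - v x * u1 i x"])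
    have "has_partial i (\<lambda>x. u x * v1 i x - v x * u1 i x) (\<lambda>x. (u1 i x * v1 i x + u x * v2 i x) - (v1 i x * u1 i x + v x * u2 i x))"
      by (intro has_partial_diff has_partial_mult u v)
    then show "((\<lambda>t. u (x + t *\<^sub>R axis i 1) * v1 i (x + t *\<^sub>R axis i 1) - v (x + t *\<^sub>R axis i 1) * u1 i (x + t *\<^sub>R axis i 1))
        has_real_derivative u x * v2 i x - v x * u2 i x) (at 0)" for x
      using has_partialD[of i _ _ x] by (fastforce simp: algebra_simps)
  qed (use zero in \<open>auto intro!: continuous_intros cont\<close>)
  have "(LINT x|lborel. indicator (ball c r) x * (u x * (\<Sum>i\<in>UNIV. v2 i x)))
      - (LINT x|lborel. indicator (ball c r) x * (v x * (\<Sum>i\<in>UNIV. u2 i x)))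
      = (LINT x|lborel. indicator (ball c r) x * (u x * (\<Sum>i\<in>UNIV. v2 i x)) - indicator (ball c r) x * (v x * (\<Sum>i\<in>UNIV. u2 i x)))"
    by (rule Bochner_Integration.integral_diff[symmetric]; rule int) (intro continuous_intros cont)+
  also have "\<dots> = (LINT x|lborel. (\<Sum>i\<in>UNIV. indicator (ball c r) x * (u x * v2 i x - v x * u2 i x)))"
    by (rule Bochner_Integration.integral_cong)
      (simp_all add: sum_distrib_left sum_subtractf right_diff_distrib mult_ac)
  also have "\<dots> = (\<Sum>i\<in>UNIV. LINT x|lborel. indicator (ball c r) x * (u x * v2 i x - v x * u2 i x))"
    by (rule Bochner_Integration.integral_sum, rule int) (intro continuous_intros cont)
  also have "\<dots> = 0" by (simp add: z)
  finally show ?thesis by simp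
qed

text \<open>The quadratic polynomial whose powers with exponent \<open>(2 - n) / 2\<close> are the two (regularised)
  summands of the Green function.\<close>

definition quad :: "real \<Rightarrow> 'a::real_inner \<Rightarrow> real \<Rightarrow> 'a \<Rightarrow> real" where
  "quad a x b y = a * (y \<bullet> y) - 2 * (x \<bullet> y) + b"

lemma continuous_quad [continuous_intros]: "continuous_on S (quad a x b)"
  unfolding quad_def by (intro continuous_intros)

lemma has_partial_quad: "has_partial i (quad a x b) (\<lambda>y. 2 * (a * y $ i - x $ i))"
  unfolding has_partial_def quad_def
  by (auto intro!: derivative_eq_intros simp: inner_add_left inner_add_right inner_axis inner_axis' inner_commute[of _ "axis i 1"])

lemma has_partial_quad_powr:
  assumes "\<And>y. quad a x b y > 0"
  shows "has_partial i (\<lambda>y. quad a x b y powr s) (\<lambda>y. 2 * s * (a * y $ i - x $ i) * quad a x b y powr (s - 1))"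
proof -
  have "has_partial i (\<lambda>y. quad a x b y powr s) (\<lambda>y. (s * quad a x b y powr (s - 1)) * (2 * (a * y $ i - x $ i)))"
    by (rule has_partial_compose[OF has_partial_quad, where h="\<lambda>z. z powr s"]) (rule has_real_derivative_powr[OF assms])
  then show ?thesis by (rule has_partial_cong) (simp_all add: mult_ac)
qed

lemma has_partial_quad_powr2:
  assumes "\<And>y. quad a x b y > 0"
  shows "has_partial i (\<lambda>y. 2 * s * (a * y $ i - x $ i) * quad a x b y powr (s - 1))
     (\<lambda>y. 2 * s * a * quad a x b y powr (s - 1) + 4 * s * (s - 1) * (a * y $ i - x $ i)\<^sup>2 * quad a x b y powr (s - 2))"
proof -
  have "has_partial i (\<lambda>y. 2 * s * (a * y $ i - x $ i)) (\<lambda>y. 2 * s * a)"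
    unfolding has_partial_def by (auto intro!: derivative_eq_intros)
  from has_partial_mult[OF this has_partial_quad_powr[OF assms, of i "s - 1"]]
  show ?thesis by (rule has_partial_cong) (simp_all add: power2_eq_square algebra_simps)
qed

lemma sum_quad:
  "(\<Sum>i\<in>UNIV. (a * y $ i - x $ i)\<^sup>2) = a * quad a x b y - (a * b - x \<bullet> (x :: real ^ 'n::finite))"
proof -
  have "(\<Sum>i\<in>UNIV. (a * y $ i - x $ i)\<^sup>2) = (a *\<^sub>R y - x) \<bullet> (a *\<^sub>R y - x)"
    by (simp add: inner_vec_def power2_eq_square)
  also have "\<dots> = a * quad a x b y - (a * b - x \<bullet> x)"
    by (simp add: quad_def inner_diff_left inner_diff_right inner_commute[of y x] algebra_simps)
  finally show ?thesis .
qed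

text \<open>The exponent \<open>1 - n / 2\<close> is that of the fundamental solution: for it the
  terms with \<open>a * quad a x b y\<close> cancel. What remains carries the factor
  \<open>a * b - x \<bullet> x\<close>, which is \<open>e\<close> for the first regularised summand
  (\<open>a = 1\<close>, \<open>b = x \<bullet> x + e\<close>) and
  \<open>(x \<bullet> x) * e\<close> for the second (\<open>a = x \<bullet> x\<close>,
  \<open>b = 1 + e\<close>).\<close>

lemma laplacian_quad_powr:
  fixes x y :: "real ^ 'n::finite"
  assumes pos: "quad a x b y > 0" and s: "s = 1 - CARD('n) / 2"
  shows "(\<Sum>i\<in>UNIV. 2 * s * a * quad a x b y powr (s - 1) + 4 * s * (s - 1) * (a * y $ i - x $ i)\<^sup>2 * quad a x b y powr (s - 2))
    = - (CARD('n) * (real CARD('n) - 2)) * (a * b - x \<bullet> x) * quad a x b y powr (- (CARD('n) / 2) - 1)"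
proof -
  let ?Q = "quad a x b y" and ?n = "real CARD('n)"
  have p: "?Q powr (s - 1) = ?Q * ?Q powr (s - 2)"
    using powr_add[of ?Q 1 "s - 2"] pos by simp
  have "(\<Sum>i\<in>UNIV. 2 * s * a * ?Q powr (s - 1) + 4 * s * (s - 1) * (a * y $ i - x $ i)\<^sup>2 * ?Q powr (s - 2))
    = ?n * (2 * s * a * ?Q powr (s - 1)) + 4 * s * (s - 1) * (\<Sum>i\<in>UNIV. (a * y $ i - x $ i)\<^sup>2) * ?Q powr (s - 2)"
    by (simp add: sum.distrib sum_distrib_left sum_distrib_right)
  also have "\<dots> = (?n * 2 * s * a * ?Q + 4 * s * (s - 1) * (a * ?Q - (a * b - x \<bullet> x))) * ?Q powr (s - 2)"
    unfolding sum_quad[of a y x b] p by (simp add: algebra_simps)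
  also have "?n * 2 * s * a * ?Q + 4 * s * (s - 1) * (a * ?Q - (a * b - x \<bullet> x)) = - (?n * (?n - 2)) * (a * b - x \<bullet> x)"
    unfolding s by (simp add: field_simps)
  finally have "(\<Sum>i\<in>UNIV. 2 * s * a * ?Q powr (s - 1) + 4 * s * (s - 1) * (a * y $ i - x $ i)\<^sup>2 * ?Q powr (s - 2))
    = - (?n * (?n - 2)) * (a * b - x \<bullet> x) * ?Q powr (s - 2)" .
  moreover have "s - 2 = - (?n / 2) - 1" by (simp add: s)
  ultimately show ?thesis by (simp only:)
qed

lemma quad_norm: "quad 1 x (x \<bullet> x + e) y = (norm (x - y))\<^sup>2 + e"
  by (simp add: quad_def power2_norm_eq_inner inner_diff_left inner_diff_right inner_commute)

text \<open>The flux of the field \<open>s powr (- a / 2) (y - x)\<close> through a sphere around \<open>x\<close>, where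
  \<open>s = |x - y|^2 + e\<close>.\<close>

lemma integral_ball_flux:
  fixes x :: "real ^ 'n::finite"
  assumes e: "e > 0" and r: "r > 0"
  shows "(LINT y|lborel. indicator (ball x r) y * (CARD('n) * quad 1 x (x \<bullet> x + e) y powr (- a / 2)
           - a * (norm (x - y))\<^sup>2 * quad 1 x (x \<bullet> x + e) y powr (- a / 2 - 1)))
       = CARD('n) * (r\<^sup>2 + e) powr (- a / 2) * (unit_ball_vol CARD('n) * r ^ CARD('n))"
    and "integrable lborel (\<lambda>y. indicator (ball x r) y * (CARD('n) * quad 1 x (x \<bullet> x + e) y powr (- a / 2)
           - a * (norm (x - y))\<^sup>2 * quad 1 x (x \<bullet> x + e) y powr (- a / 2 - 1)))"
proof -
  let ?Q = "quad 1 x (x \<bullet> x + e)" and ?c = "(r\<^sup>2 + e) powr (- a / 2)"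
  have pos: "?Q y > 0" for y using e by (simp add: quad_norm add_nonneg_pos)
  have cont: "continuous_on UNIV (\<lambda>y. ?Q y powr s)" for s
    using pos by (intro continuous_intros) (simp add: less_imp_neq[THEN not_sym])
  \<comment> \<open>Subtracting the value \<open>?c\<close> of the power on the sphere makes the
    field vanish there; the divergence of the subtracted part is the constant that produces the
    volume on the right.\<close>
  define F' where "F' i y = ?Q y powr (- a / 2) - ?c - a * (y $ i - x $ i)\<^sup>2 * ?Q y powr (- a / 2 - 1)" for i y
  note int = integrable_indicator_ball[where x=x and r=r]
  have cF': "continuous_on UNIV (F' i)" for i
    unfolding F'_def by (intro continuous_intros cont)
  have z: "(LINT y|lborel. indicator (ball x r) y * F' i y) = 0" for i
  proof (rule integral_ball_directional_derivative[where b="axis i 1" and F="\<lambda>y. (y $ i - x $ i) * (?Q y powr (- a / 2) - ?c)"])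
    have "has_partial i (\<lambda>y. y $ i - x $ i) (\<lambda>y. 1)"
      using has_partial_diff[OF has_partial_nth has_partial_const, of i "x $ i"] by simp
    from has_partial_mult[OF this has_partial_diff[OF has_partial_quad_powr[OF pos, where s="- a / 2"] has_partial_const[of i ?c]]]
    have "has_partial i (\<lambda>y. (y $ i - x $ i) * (?Q y powr (- a / 2) - ?c)) (F' i)"
      by (rule has_partial_cong) (simp_all add: F'_def power2_eq_square algebra_simps)
    then show "((\<lambda>t. ((y + t *\<^sub>R axis i 1) $ i - x $ i) * (?Q (y + t *\<^sub>R axis i 1) powr (- a / 2) - ?c))
        has_real_derivative F' i y) (at 0)" for y
      by (rule has_partialD)
    show "continuous_on UNIV (\<lambda>y. (y $ i - x $ i) * (?Q y powr (- a / 2) - ?c))"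
      by (intro continuous_intros cont)
    show "(y $ i - x $ i) * (?Q y powr (- a / 2) - ?c) = 0" if "y \<in> sphere x r" for y
      using that by (simp add: quad_norm dist_norm)
  qed (rule cF')
  let ?f = "\<lambda>y. CARD('n) * ?Q y powr (- a / 2) - a * (norm (x - y))\<^sup>2 * ?Q y powr (- a / 2 - 1)"
  have eq: "indicator (ball x r) y * ?f y = (\<Sum>i\<in>UNIV. indicator (ball x r) y * F' i y) + CARD('n) * ?c * indicator (ball x r) y" for y
  proof -
    have "(norm (x - y))\<^sup>2 = (\<Sum>i\<in>UNIV. (y $ i - x $ i)\<^sup>2)"
      unfolding power2_norm_eq_inner by (simp add: inner_vec_def power2_eq_square algebra_simps)
    then have "?f y = (\<Sum>i\<in>UNIV. F' i y) + CARD('n) * ?c"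
      unfolding F'_def by (simp add: sum_subtractf sum.distrib sum_distrib_left sum_distrib_right algebra_simps)
    then show ?thesis by (simp add: algebra_simps sum_distrib_left)
  qed
  show "integrable lborel (\<lambda>y. indicator (ball x r) y * ?f y)"
    by (rule int) (intro continuous_intros cont)
  have "(LINT y|lborel. indicator (ball x r) y * ?f y)
      = (LINT y|lborel. (\<Sum>i\<in>UNIV. indicator (ball x r) y * F' i y)) + (LINT y|lborel. CARD('n) * ?c * indicator (ball x r) y)"
    unfolding eq
    by (intro Bochner_Integration.integral_add Bochner_Integration.integrable_sum int cF'
        integrable_mult_right integrable_real_indicator emeasure_bounded_finite bounded_ball) simp
  also have "(LINT y|lborel. (\<Sum>i\<in>UNIV. indicator (ball x r) y * F' i y)) = (\<Sum>i\<in>UNIV. LINT y|lborel. indicator (ball x r) y * F' i y)"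
    by (intro Bochner_Integration.integral_sum int cF')
  also have "\<dots> = 0" by (simp add: z)
  also have "(LINT y|lborel. CARD('n) * ?c * indicator (ball x r) y) = CARD('n) * ?c * (unit_ball_vol CARD('n) * r ^ CARD('n))"
    using r by (simp add: content_ball)
  finally show "(LINT y|lborel. indicator (ball x r) y * ?f y) = CARD('n) * ?c * (unit_ball_vol CARD('n) * r ^ CARD('n))"
    by simp
qed

section \<open>The representation formula\<close>

lemma quad_pos: "e > 0 \<Longrightarrow> quad 1 x (x \<bullet> x + e) y > 0"
  by (simp add: quad_norm add_nonneg_pos)

lemma quad_inversion_ge: "quad (x \<bullet> x) x (1 + e) y \<ge> (1 - norm x * norm y)\<^sup>2 + e"
proof -
  have "x \<bullet> y \<le> norm x * norm y" by (rule norm_cauchy_schwarz)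
  moreover have "(x \<bullet> x) * (y \<bullet> y) = (norm x * norm y)\<^sup>2"
    by (simp add: power_mult_distrib power2_norm_eq_inner)
  ultimately show ?thesis by (simp add: quad_def power2_eq_square algebra_simps)
qed

lemma continuous_quad_powr:
  assumes "\<And>y. quad a x b y > 0"
  shows "continuous_on S (\<lambda>y. quad a x b y powr s)"
  using assms by (intro continuous_intros) (simp add: less_imp_neq[THEN not_sym])

text \<open>With \<open>Q\<close> the quadratic, \<open>norm (x - y)^2 \<le> Q\<close> bounds the
  integrand of the flux below by \<open>(n - a) * Q powr (- a / 2)\<close>. The outcome is uniform
  in \<open>e\<close> and takes the place of an integral in polar coordinates.\<close>

lemma integral_quad_powr_le:
  fixes x :: "real ^ 'n::finite" and a :: real
  assumes e: "e > 0" and r: "r > 0" and a: "0 < a" "a < CARD('n)"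
  shows "(LINT y|lborel. indicator (ball x r) y * quad 1 x (x \<bullet> x + e) y powr (- a / 2))
    \<le> CARD('n) / (CARD('n) - a) * (r\<^sup>2) powr (- a / 2) * (unit_ball_vol CARD('n) * r ^ CARD('n))"
proof -
  let ?Q = "quad 1 x (x \<bullet> x + e)" and ?n = "real CARD('n)"
  let ?I = "LINT y|lborel. indicator (ball x r) y * ?Q y powr (- a / 2)"
  have pos: "?Q y > 0" for y using e by (rule quad_pos)
  have "(?n - a) * ?I = (LINT y|lborel. (?n - a) * (indicator (ball x r) y * ?Q y powr (- a / 2)))"
    by simp
  also have "\<dots> \<le> (LINT y|lborel. indicator (ball x r) y * (?n * ?Q y powr (- a / 2)
           - a * (norm (x - y))\<^sup>2 * ?Q y powr (- a / 2 - 1)))"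
  proof (rule integral_mono)
    show "integrable lborel (\<lambda>y. (?n - a) * (indicator (ball x r) y * ?Q y powr (- a / 2)))"
      by (intro integrable_mult_right integrable_indicator_ball continuous_quad_powr pos)
    fix y
    have "(norm (x - y))\<^sup>2 * ?Q y powr (- a / 2 - 1) \<le> ?Q y * ?Q y powr (- a / 2 - 1)"
      using e by (intro mult_right_mono) (auto simp: quad_norm)
    also have "\<dots> = ?Q y powr (- a / 2)" using powr_add[of "?Q y" 1 "- a / 2 - 1"] pos[of y] by simp
    finally have "a * ((norm (x - y))\<^sup>2 * ?Q y powr (- a / 2 - 1)) \<le> a * ?Q y powr (- a / 2)"
      using a by (intro mult_left_mono) auto
    then have "(?n - a) * ?Q y powr (- a / 2) \<le> ?n * ?Q y powr (- a / 2) - a * (norm (x - y))\<^sup>2 * ?Q y powr (- a / 2 - 1)"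
      by (simp add: algebra_simps)
    then have "indicator (ball x r) y * ((?n - a) * ?Q y powr (- a / 2))
        \<le> indicator (ball x r) y * (?n * ?Q y powr (- a / 2) - a * (norm (x - y))\<^sup>2 * ?Q y powr (- a / 2 - 1))"
      by (rule mult_left_mono) simp
    then show "(?n - a) * (indicator (ball x r) y * ?Q y powr (- a / 2))
        \<le> indicator (ball x r) y * (?n * ?Q y powr (- a / 2) - a * (norm (x - y))\<^sup>2 * ?Q y powr (- a / 2 - 1))"
      by (simp only: mult.left_commute)
  qed (rule integral_ball_flux(2)[OF e r])
  also have "\<dots> = ?n * (r\<^sup>2 + e) powr (- a / 2) * (unit_ball_vol ?n * r ^ CARD('n))"
    by (rule integral_ball_flux(1)[OF e r])
  also have "\<dots> \<le> ?n * (r\<^sup>2) powr (- a / 2) * (unit_ball_vol ?n * r ^ CARD('n))"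
    using e r a by (intro mult_right_mono mult_left_mono powr_mono2') auto
  finally show ?thesis using a by (simp add: field_simps)
qed

text \<open>For \<open>a = n\<close> the integrand of the flux collapses to \<open>n\<close> times
  \<open>e * Q powr (- n / 2 - 1)\<close>, so the mass of this kernel on a ball about
  \<open>x\<close> is known exactly.\<close>

lemma integral_approximate_identity:
  fixes x :: "real ^ 'n::finite"
  assumes e: "e > 0" and r: "r > 0"
  shows "(LINT y|lborel. indicator (ball x r) y * (e * quad 1 x (x \<bullet> x + e) y powr (- real CARD('n) / 2 - 1)))
    = (r\<^sup>2 + e) powr (- real CARD('n) / 2) * (unit_ball_vol CARD('n) * r ^ CARD('n))"
proof -
  let ?Q = "quad 1 x (x \<bullet> x + e)" and ?n = "real CARD('n)"
  have "?n * ?Q y powr (- ?n / 2) - ?n * (norm (x - y))\<^sup>2 * ?Q y powr (- ?n / 2 - 1)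
      = ?n * (e * ?Q y powr (- ?n / 2 - 1))" for y
  proof -
    have "?Q y powr (- ?n / 2) = ?Q y * ?Q y powr (- ?n / 2 - 1)"
      using powr_add[of "?Q y" 1 "- ?n / 2 - 1"] quad_pos[OF e, of x y] by simp
    then show ?thesis unfolding quad_norm by (simp add: algebra_simps)
  qed
  then have "?n * (LINT y|lborel. indicator (ball x r) y * (e * ?Q y powr (- ?n / 2 - 1)))
     = ?n * ((r\<^sup>2 + e) powr (- ?n / 2) * (unit_ball_vol ?n * r ^ CARD('n)))"
    using integral_ball_flux(1)[OF e r, of x ?n]
    by (simp add: mult.left_commute[of "indicator _ _" ?n] mult.assoc)
  then show ?thesis by simp
qed

text \<open>Fatou's lemma applied to the regularised kernels, whose integrals are bounded uniformly
  in \<open>e\<close>.\<close>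

lemma integrable_norm_powr_ball:
  fixes x :: "real ^ 'n::finite" and a :: real
  assumes r: "r > 0" and a: "0 < a" "a < CARD('n)"
  shows "integrable lborel (\<lambda>y. indicator (ball x r) y * norm (x - y) powr (- a))"
proof (rule integrableI_nonneg)
  let ?C = "CARD('n) / (CARD('n) - a) * (r\<^sup>2) powr (- a / 2) * (unit_ball_vol CARD('n) * r ^ CARD('n))"
  define e where "e k = 1 / real (Suc k)" for k
  have e: "e k > 0" for k by (simp add: e_def)
  have e0: "e \<longlonglongrightarrow> 0" unfolding e_def using LIMSEQ_inverse_real_of_nat by (simp add: inverse_eq_divide)
  let ?F = "\<lambda>k y. ennreal (indicator (ball x r) y * quad 1 x (x \<bullet> x + e k) y powr (- a / 2))"
  have "(\<integral>\<^sup>+y. ennreal (indicator (ball x r) y * norm (x - y) powr (- a)) \<partial>lborel) \<le> (\<integral>\<^sup>+y. liminf (\<lambda>k. ?F k y) \<partial>lborel)"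
  proof (rule nn_integral_mono)
    fix y
    show "ennreal (indicator (ball x r) y * norm (x - y) powr (- a)) \<le> liminf (\<lambda>k. ?F k y)"
    \<comment> \<open>At \<open>y = x\<close> the left side is 0, because
      \<open>0 powr (- a) = 0\<close>.\<close>
    proof (cases "y = x")
      case False
      have "(\<lambda>k. ?F k y) \<longlonglongrightarrow> ennreal (indicator (ball x r) y * ((norm (x - y))\<^sup>2 + 0) powr (- a / 2))"
        unfolding quad_norm using False by (intro tendsto_intros e0) auto
      then have "liminf (\<lambda>k. ?F k y) = ennreal (indicator (ball x r) y * ((norm (x - y))\<^sup>2 + 0) powr (- a / 2))"
        by (intro lim_imp_Liminf) auto
      moreover have "((norm (x - y))\<^sup>2 + 0) powr (- a / 2) = norm (x - y) powr (- a)"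
        using False by (simp add: powr_powr flip: powr_numeral)
      ultimately show ?thesis by simp
    qed simp
  qed
  also have "\<dots> \<le> liminf (\<lambda>k. \<integral>\<^sup>+y. ?F k y \<partial>lborel)"
  proof (rule nn_integral_liminf)
    fix k
    have [measurable]: "(\<lambda>y. quad 1 x (x \<bullet> x + e k) y powr (- a / 2)) \<in> borel_measurable borel"
      by (intro borel_measurable_continuous_onI continuous_quad_powr quad_pos e)
    have [measurable]: "ball x r \<in> sets borel" by simp
    show "?F k \<in> borel_measurable lborel" by measurable
  qed
  also have "\<dots> \<le> ennreal ?C"
  proof -
    have "(\<integral>\<^sup>+y. ?F k y \<partial>lborel) \<le> ennreal ?C" for k
    proof -
      have "(\<integral>\<^sup>+y. ?F k y \<partial>lborel) = ennreal (LINT y|lborel. indicator (ball x r) y * quad 1 x (x \<bullet> x + e k) y powr (- a / 2))"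
        by (rule nn_integral_eq_integral)
          (auto intro!: integrable_indicator_ball continuous_quad_powr quad_pos e)
      then show ?thesis using integral_quad_powr_le[OF e r a] by (simp add: ennreal_leI)
    qed
    then have "liminf (\<lambda>k. \<integral>\<^sup>+y. ?F k y \<partial>lborel) \<le> liminf (\<lambda>k. ennreal ?C)"
      by (intro Liminf_mono) auto
    then show ?thesis by (simp add: Liminf_const)
  qed
  finally show "(\<integral>\<^sup>+y. ennreal (indicator (ball x r) y * norm (x - y) powr (- a)) \<partial>lborel) < \<infinity>"
    by (rule order.strict_trans1) simp
  have [measurable]: "ball x r \<in> sets borel" by simp
  show "(\<lambda>y. indicator (ball x r) y * norm (x - y) powr (- a)) \<in> borel_measurable lborel" by measurable
qed auto

text \<open>The mass of the kernel tends to the volume of the unit ball. What the Lipschitz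
  condition leaves is an integral of \<open>norm (x - y) * e * Q powr (- n / 2 - 1)\<close>, in
  which a small power of \<open>e\<close> can be spared.\<close>

lemma approximate_identity_tendsto:
  fixes x :: "real ^ 'n::finite" and \<phi> :: "real ^ 'n \<Rightarrow> real"
  assumes x: "norm x < 1" and cont: "continuous_on UNIV \<phi>"
    and lip: "\<And>y. y \<in> ball 0 1 \<Longrightarrow> \<bar>\<phi> y - \<phi> x\<bar> \<le> L * norm (x - y)" and L: "L \<ge> 0"
    and e: "\<And>k. e k > (0 :: real)" and e0: "e \<longlonglongrightarrow> 0"
  shows "(\<lambda>k. LINT y|lborel. indicator (ball 0 1) y * (\<phi> y * (e k * quad 1 x (x \<bullet> x + e k) y powr (- real CARD('n) / 2 - 1))))
    \<longlonglongrightarrow> unit_ball_vol CARD('n) * \<phi> x"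
proof -
  let ?n = "real CARD('n)"
  let ?K = "\<lambda>k y. e k * quad 1 x (x \<bullet> x + e k) y powr (- ?n / 2 - 1)"
  let ?B = "ball (0 :: real ^ 'n) 1"
  have cK: "continuous_on UNIV (?K k)" for k by (intro continuous_intros continuous_quad_powr quad_pos e)
  have K0: "?K k y \<ge> 0" for k y using e[of k] by simp
  have int: "integrable lborel (\<lambda>y. indicator (ball c r) y * ?K k y)" for k c r
    by (rule integrable_indicator_ball[OF cK])
  have lim: "(\<lambda>k. (r\<^sup>2 + e k) powr (- ?n / 2) * (unit_ball_vol ?n * r ^ CARD('n))) \<longlonglongrightarrow> unit_ball_vol ?n" if r: "r > 0" for r
  proof -
    have "(\<lambda>k. (r\<^sup>2 + e k) powr (- ?n / 2) * (unit_ball_vol ?n * r ^ CARD('n)))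
       \<longlonglongrightarrow> (r\<^sup>2 + 0) powr (- ?n / 2) * (unit_ball_vol ?n * r ^ CARD('n))"
      using r by (intro tendsto_intros e0) auto
    also have "(r\<^sup>2 + 0) powr (- ?n / 2) = r powr (- ?n)" using r by (simp add: powr_powr flip: powr_numeral)
    also have "r powr (- ?n) * (unit_ball_vol ?n * r ^ CARD('n)) = unit_ball_vol ?n"
      using r by (simp add: powr_minus powr_realpow)
    finally show ?thesis .
  qed
  have mass: "(\<lambda>k. LINT y|lborel. indicator ?B y * ?K k y) \<longlonglongrightarrow> unit_ball_vol ?n"
  \<comment> \<open>The unit ball lies between two balls around \<open>x\<close>, and the exact
    masses of these have the same limit.\<close>
  proof (rule tendsto_sandwich[OF _ _ lim[of "1 - norm x"] lim[of 2]])
    have sub1: "ball x (1 - norm x) \<subseteq> ?B"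
    proof
      fix y assume "y \<in> ball x (1 - norm x)"
      then show "y \<in> ?B" using norm_triangle_ineq[of x "y - x"] by (simp add: dist_norm norm_minus_commute)
    qed
    have sub2: "?B \<subseteq> ball x 2"
    proof
      fix y assume "y \<in> ?B"
      then show "y \<in> ball x 2" using x norm_triangle_ineq4[of x y] by (simp add: dist_norm)
    qed
    have "(LINT y|lborel. indicator (ball x (1 - norm x)) y * ?K k y) \<le> (LINT y|lborel. indicator ?B y * ?K k y)" for k
      by (intro integral_mono int mult_right_mono K0) (use sub1 in \<open>auto simp: indicator_def\<close>)
    then show "\<forall>\<^sub>F k in sequentially. ((1 - norm x)\<^sup>2 + e k) powr (- ?n / 2) * (unit_ball_vol ?n * (1 - norm x) ^ CARD('n))
        \<le> (LINT y|lborel. indicator ?B y * ?K k y)"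
      using integral_approximate_identity[OF e, of "1 - norm x" x] x by simp
    have "(LINT y|lborel. indicator ?B y * ?K k y) \<le> (LINT y|lborel. indicator (ball x 2) y * ?K k y)" for k
      by (intro integral_mono int mult_right_mono K0) (use sub2 in \<open>auto simp: indicator_def\<close>)
    then show "\<forall>\<^sub>F k in sequentially. (LINT y|lborel. indicator ?B y * ?K k y)
        \<le> (2\<^sup>2 + e k) powr (- ?n / 2) * (unit_ball_vol ?n * 2 ^ CARD('n))"
      using integral_approximate_identity[OF e, of 2 x] by simp
  qed (use x in auto)
  \<comment> \<open>Any exponent strictly between \<open>n - 1\<close> and \<open>n\<close> works: it leaves a positive power of \<open>e k\<close>.\<close>
  define a where "a = ?n - 1 / 2"
  have "1 \<le> ?n" using zero_less_card_finite[where 'a='n] by linarith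
  then have a: "0 < a" "a < ?n" unfolding a_def by linarith+
  define C where "C = CARD('n) / (CARD('n) - a) * (2\<^sup>2) powr (- a / 2) * (unit_ball_vol CARD('n) * 2 ^ CARD('n))"
  have rest: "(\<lambda>k. LINT y|lborel. indicator ?B y * ((\<phi> y - \<phi> x) * ?K k y)) \<longlonglongrightarrow> 0"
  proof (rule Lim_null_comparison)
    have "norm (LINT y|lborel. indicator ?B y * ((\<phi> y - \<phi> x) * ?K k y)) \<le> L * e k powr (1 / 4) * C" for k
    proof -
      let ?Q = "quad 1 x (x \<bullet> x + e k)"
      have "norm (LINT y|lborel. indicator ?B y * ((\<phi> y - \<phi> x) * ?K k y))
          \<le> (LINT y|lborel. L * e k powr (1 / 4) * (indicator (ball x 2) y * ?Q y powr (- a / 2)))"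
      proof (rule order_trans[OF integral_norm_bound], rule integral_mono)
        show "integrable lborel (\<lambda>y. norm (indicator ?B y * ((\<phi> y - \<phi> x) * ?K k y)))"
          by (intro integrable_norm integrable_indicator_ball continuous_intros cont cK)
        show "integrable lborel (\<lambda>y. L * e k powr (1 / 4) * (indicator (ball x 2) y * ?Q y powr (- a / 2)))"
          by (intro integrable_mult_right integrable_indicator_ball continuous_quad_powr quad_pos e)
        fix y
        show "norm (indicator ?B y * ((\<phi> y - \<phi> x) * ?K k y)) \<le> L * e k powr (1 / 4) * (indicator (ball x 2) y * ?Q y powr (- a / 2))"
        proof (cases "y \<in> ?B")
          case True
          have y2: "y \<in> ball x 2" using True x norm_triangle_ineq4[of x y] by (simp add: dist_norm)
          have Q: "?Q y > 0" by (rule quad_pos[OF e])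
          have nQ: "norm (x - y) \<le> ?Q y powr (1 / 2)"
            using e[of k] Q by (simp add: powr_half_sqrt quad_norm real_le_rsqrt)
          \<comment> \<open>The power \<open>1/4\<close> of \<open>e k\<close> is kept for the
            convergence; the power \<open>3/4\<close> and the factor \<open>norm (x - y)\<close> are
            absorbed by \<open>?Q y\<close>, and \<open>1/2 + 3/4 - n/2 - 1 = - a/2\<close>.\<close>
          have "e k = e k powr (1 / 4) * e k powr (3 / 4)" using e[of k] by (simp flip: powr_add)
          also have "\<dots> \<le> e k powr (1 / 4) * ?Q y powr (3 / 4)"
            using e[of k] by (intro mult_left_mono powr_mono2) (auto simp: quad_norm)
          finally have eQ: "e k \<le> e k powr (1 / 4) * ?Q y powr (3 / 4)" .
          have "norm ((\<phi> y - \<phi> x) * ?K k y) \<le> (L * norm (x - y)) * ?K k y"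
            unfolding norm_mult using lip[OF True] K0[of k y] e[of k] by (intro mult_mono) auto
          also have "\<dots> \<le> (L * ?Q y powr (1 / 2)) * (e k powr (1 / 4) * ?Q y powr (3 / 4) * ?Q y powr (- ?n / 2 - 1))"
            using nQ eQ L e[of k] by (intro mult_mono mult_left_mono mult_right_mono) auto
          also have "\<dots> = L * e k powr (1 / 4) * (?Q y powr (1 / 2) * ?Q y powr (3 / 4) * ?Q y powr (- ?n / 2 - 1))"
            by (simp only: mult_ac)
          also have "?Q y powr (1 / 2) * ?Q y powr (3 / 4) * ?Q y powr (- ?n / 2 - 1) = ?Q y powr (- a / 2)"
            unfolding powr_add[symmetric]
            by (rule arg_cong[where f="\<lambda>s. ?Q y powr s"]) (simp add: a_def field_simps)
          finally show ?thesis using True y2 by simp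
        qed (use L in auto)
      qed
      also have "\<dots> = L * e k powr (1 / 4) * (LINT y|lborel. indicator (ball x 2) y * ?Q y powr (- a / 2))"
        by simp
      also have "\<dots> \<le> L * e k powr (1 / 4) * C"
        unfolding C_def using L by (intro mult_left_mono integral_quad_powr_le e a) auto
      finally show ?thesis .
    qed
    then show "\<forall>\<^sub>F k in sequentially. norm (LINT y|lborel. indicator ?B y * ((\<phi> y - \<phi> x) * ?K k y)) \<le> L * e k powr (1 / 4) * C"
      by simp
    have "(\<lambda>k. L * e k powr (1 / 4) * C) \<longlonglongrightarrow> L * 0 powr (1 / 4) * C"
      using e by (intro tendsto_intros tendsto_powr' e0) (auto intro!: always_eventually less_imp_le)
    then show "(\<lambda>k. L * e k powr (1 / 4) * C) \<longlonglongrightarrow> 0" by simp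
  qed
  have "(LINT y|lborel. indicator ?B y * (\<phi> y * ?K k y))
      = \<phi> x * (LINT y|lborel. indicator ?B y * ?K k y) + (LINT y|lborel. indicator ?B y * ((\<phi> y - \<phi> x) * ?K k y))" for k
  proof -
    have "(LINT y|lborel. indicator ?B y * (\<phi> y * ?K k y))
       = (LINT y|lborel. \<phi> x * (indicator ?B y * ?K k y) + indicator ?B y * ((\<phi> y - \<phi> x) * ?K k y))"
      by (rule Bochner_Integration.integral_cong) (simp_all add: algebra_simps)
    also have "\<dots> = (LINT y|lborel. \<phi> x * (indicator ?B y * ?K k y)) + (LINT y|lborel. indicator ?B y * ((\<phi> y - \<phi> x) * ?K k y))"
      by (intro Bochner_Integration.integral_add integrable_mult_right int integrable_indicator_ball continuous_intros cont cK)
    finally show ?thesis by simp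
  qed
  then show ?thesis using tendsto_add[OF tendsto_mult_left[OF mass, of "\<phi> x"] rest] by (simp add: mult.commute)
qed

section \<open>The Green function as a limit of regularised kernels\<close>

lemma green_bracket_quad: "(green_bracket x y)\<^sup>2 = quad (x \<bullet> x) x (1 + 0) y" "green_bracket x y \<ge> \<bar>1 - norm x * norm y\<bar>"
proof -
  have "(1 - norm x * norm y)\<^sup>2 \<le> quad (x \<bullet> x) x (1 + 0) y" using quad_inversion_ge[where x=x and e=0 and y=y] by simp
  moreover have "quad (x \<bullet> x) x (1 + 0) y = 1 - 2 * (x \<bullet> y) + (norm x)\<^sup>2 * (norm y)\<^sup>2"
    by (simp add: quad_def power2_norm_eq_inner)
  ultimately have q: "(1 - norm x * norm y)\<^sup>2 \<le> 1 - 2 * (x \<bullet> y) + (norm x)\<^sup>2 * (norm y)\<^sup>2"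
    and eq: "quad (x \<bullet> x) x (1 + 0) y = 1 - 2 * (x \<bullet> y) + (norm x)\<^sup>2 * (norm y)\<^sup>2" by auto
  show "(green_bracket x y)\<^sup>2 = quad (x \<bullet> x) x (1 + 0) y"
    unfolding eq green_bracket_def using order_trans[OF zero_le_power2 q] by simp
  show "green_bracket x y \<ge> \<bar>1 - norm x * norm y\<bar>"
    unfolding green_bracket_def using q by (intro real_le_rsqrt) simp
qed

text \<open>The two forms agree on the diagonal as well, where \<open>1 / 0\<close> and
  \<open>0 powr _\<close> are both 0.\<close>

lemma green_eq_powr:
  fixes x y :: "real ^ 'n::finite"
  assumes n: "CARD('n) \<ge> 3" and x: "norm x < 1" and y: "norm y \<le> 1"
  shows "green x y = green_const TYPE('n) *
    (norm (x - y) powr (2 - real CARD('n)) - green_bracket x y powr (2 - real CARD('n)))"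
proof -
  have *: "1 / z ^ (CARD('n) - 2) = z powr (2 - real CARD('n))" if "z \<ge> 0" for z :: real
  proof (cases "z = 0")
    case True then show ?thesis using n by (simp add: power_0_left)
  next
    case False
    then have "z powr (- real (CARD('n) - 2)) = 1 / z ^ (CARD('n) - 2)"
      using that by (simp add: powr_minus powr_realpow divide_inverse)
    moreover have "- real (CARD('n) - 2) = 2 - real CARD('n)" using n by simp
    ultimately show ?thesis by simp
  qed
  have "green_bracket x y \<ge> 0" using green_bracket_quad(2)[of x y] by linarith
  then show ?thesis unfolding green_def by (simp add: *)
qed

lemma bracket_pos: "norm x < 1 \<Longrightarrow> norm y \<le> 1 \<Longrightarrow> 1 - norm x \<le> green_bracket x y"
proof -
  assume "norm x < 1" "norm y \<le> 1"
  then have "norm x * norm y \<le> norm x" by (simp add: mult_left_le)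
  then show ?thesis using green_bracket_quad(2)[of x y] by linarith
qed

text \<open>Up to a constant, a common majorant of the Green function and of its regularisations,
  for the dominated convergence below.\<close>

lemma integrable_green_kernel:
  fixes x :: "real ^ 'n::finite"
  assumes n: "CARD('n) \<ge> 3" and x: "norm x < 1"
  shows "integrable lborel (\<lambda>y. indicator (ball 0 1) y * (norm (x - y) powr (2 - real CARD('n)) + (1 - norm x) powr (2 - real CARD('n))))"
proof -
  have [measurable]: "ball (0 :: real ^ 'n) 1 \<in> sets borel" by simp
  have "integrable lborel (\<lambda>y. indicator (ball x 2) y * norm (x - y) powr (2 - real CARD('n)))"
    using integrable_norm_powr_ball[of 2 "real CARD('n) - 2" x] n by simp
  then have "integrable lborel (\<lambda>y. indicator (ball 0 1) y *\<^sub>R (indicator (ball x 2) y * norm (x - y) powr (2 - real CARD('n))))"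
    by (rule integrable_mult_indicator[rotated]) simp
  also have "(\<lambda>y. indicator (ball 0 1) y *\<^sub>R (indicator (ball x 2) y * norm (x - y) powr (2 - real CARD('n))))
     = (\<lambda>y. indicator (ball 0 1) y * norm (x - y) powr (2 - real CARD('n)))"
  proof
    fix y
    have "y \<in> ball x 2" if "y \<in> ball 0 1" using that x norm_triangle_ineq4[of x y] by (simp add: dist_norm)
    then show "indicator (ball 0 1) y *\<^sub>R (indicator (ball x 2) y * norm (x - y) powr (2 - real CARD('n)))
      = indicator (ball 0 1) y * norm (x - y) powr (2 - real CARD('n))" by (auto simp: indicator_def)
  qed
  finally have "integrable lborel (\<lambda>y. indicator (ball 0 1) y * norm (x - y) powr (2 - real CARD('n)) + indicator (ball 0 1) y * (1 - norm x) powr (2 - real CARD('n)))"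
    by (intro Bochner_Integration.integrable_add integrable_mult_left integrable_real_indicator emeasure_bounded_finite bounded_ball) simp_all
  then show ?thesis by (simp add: algebra_simps)
qed

lemma green_const_eq:
  assumes "CARD('n::finite) \<ge> 3"
  shows "green_const TYPE('n) = 1 / ((real CARD('n) - 2) * (CARD('n) * unit_ball_vol (CARD('n))))"
  unfolding green_const_def using sphere_area_eq[where 'n='n] assms by simp

text \<open>Radial functions are written through \<open>y \<bullet> y\<close> rather than
  \<open>norm y\<close>, which keeps them smooth at the origin.\<close>

lemma laplacian_radial:
  fixes f f' f'' :: "real \<Rightarrow> real" and i :: "'n::finite"
  assumes f: "\<And>t. (f has_real_derivative f' t) (at t)" "\<And>t. (f' has_real_derivative f'' t) (at t)"
  shows "has_partial i (\<lambda>y. f (y \<bullet> y)) (\<lambda>y. f' (y \<bullet> y) * (2 * y $ i))"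
    and "has_partial i (\<lambda>y. f' (y \<bullet> y) * (2 * y $ i)) (\<lambda>y. 4 * (y $ i)\<^sup>2 * f'' (y \<bullet> y) + 2 * f' (y \<bullet> y))"
    and "(\<Sum>i\<in>UNIV. 4 * (y $ i)\<^sup>2 * f'' (y \<bullet> y) + 2 * f' (y \<bullet> y))
       = 4 * (y \<bullet> y) * f'' (y \<bullet> y) + 2 * real CARD('n) * f' ((y :: real ^ 'n) \<bullet> y)"
proof -
  have sq: "has_partial i (\<lambda>y :: real ^ 'n. y \<bullet> y) (\<lambda>y. 2 * y $ i)"
    by (rule has_partial_cong[OF has_partial_quad[of i 1 0 0]]) (simp_all add: quad_def)
  show "has_partial i (\<lambda>y. f (y \<bullet> y)) (\<lambda>y :: real ^ 'n. f' (y \<bullet> y) * (2 * y $ i))"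
    by (rule has_partial_compose[OF sq f(1)])
  have "has_partial i (\<lambda>y :: real ^ 'n. 2 * y $ i) (\<lambda>y. 2)"
    unfolding has_partial_def by (auto intro!: derivative_eq_intros)
  from has_partial_mult[OF has_partial_compose[OF sq f(2)] this]
  show "has_partial i (\<lambda>y. f' (y \<bullet> y) * (2 * y $ i)) (\<lambda>y :: real ^ 'n. 4 * (y $ i)\<^sup>2 * f'' (y \<bullet> y) + 2 * f' (y \<bullet> y))"
    by (rule has_partial_cong) (simp_all add: power2_eq_square)
  show "(\<Sum>i\<in>UNIV. 4 * (y $ i)\<^sup>2 * f'' (y \<bullet> y) + 2 * f' (y \<bullet> y))
       = 4 * (y \<bullet> y) * f'' (y \<bullet> y) + 2 * real CARD('n) * f' (y \<bullet> y)"
    by (simp add: sum.distrib inner_vec_def power2_eq_square sum_distrib_left sum_distrib_right mult_ac)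
qed

text \<open>Green's second identity for the regularised kernel \<open>?G k\<close> and
  \<open>f (y \<bullet> y)\<close>. As \<open>e k\<close> tends to 0, the Laplacian of the first
  summand concentrates at \<open>x\<close>, that of the second tends to 0 because its quadratic
  stays away from 0, and dominated convergence turns the other side into the Green integral.\<close>

lemma green_representation:
  fixes f f' f'' :: "real \<Rightarrow> real" and x :: "real ^ 'n::finite"
  assumes n: "CARD('n) \<ge> 3" and x: "norm x < 1"
    and f: "\<And>t. (f has_real_derivative f' t) (at t)" "\<And>t. (f' has_real_derivative f'' t) (at t)"
    and cf'': "continuous_on UNIV f''" and f1: "f 1 = 0"
  shows "(LINT y|lborel. indicator (ball 0 1) y * (green x y * - (4 * (y \<bullet> y) * f'' (y \<bullet> y) + 2 * real CARD('n) * f' (y \<bullet> y)))) = f (x \<bullet> x)"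
proof -
  let ?n = "real CARD('n)" and ?B = "ball (0 :: real ^ 'n) 1"
  have [measurable]: "?B \<in> sets borel" by simp
  define s where "s = 1 - ?n / 2"
  have s: "s < 0" "2 * s = 2 - ?n" using n by (auto simp: s_def)
  define Lf where "Lf y = 4 * (y \<bullet> y) * f'' (y \<bullet> y) + 2 * ?n * f' (y \<bullet> y)" for y :: "real ^ 'n"
  have cf: "continuous_on UNIV f" "continuous_on UNIV f'"
    using f by (auto intro!: continuous_at_imp_continuous_on DERIV_isCont)
  have cyy: "continuous_on UNIV (\<lambda>y :: real ^ 'n. g (y \<bullet> y))" if "continuous_on UNIV g" for g :: "real \<Rightarrow> real"
    by (rule continuous_on_compose2[OF that]) (auto intro!: continuous_intros)
  note cy = cyy[OF cf(1)] cyy[OF cf(2)] cyy[OF cf'']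
  have cLf: "continuous_on UNIV Lf"
    unfolding Lf_def by (intro continuous_intros cy)
  define e where "e k = 1 / real (Suc k)" for k
  have e: "e k > 0" for k by (simp add: e_def)
  have e0: "e \<longlonglongrightarrow> 0" unfolding e_def using LIMSEQ_inverse_real_of_nat by (simp add: inverse_eq_divide)
  let ?Q1 = "\<lambda>k. quad 1 x (x \<bullet> x + e k)" and ?Q2 = "\<lambda>k. quad (x \<bullet> x) x (1 + e k)"
  have pos1: "?Q1 k y > 0" for k y by (rule quad_pos[OF e])
  have pos2: "?Q2 k y > 0" for k y
    using quad_inversion_ge[where x=x and e="e k" and y=y] e[of k] by (smt (verit) zero_le_power2)
  let ?G = "\<lambda>k y. ?Q1 k y powr s - ?Q2 k y powr s"
  have cG: "continuous_on UNIV (?G k)" for k by (intro continuous_intros continuous_quad_powr pos1 pos2)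
  define u1 where "u1 k i y = 2 * s * (1 * y $ i - x $ i) * ?Q1 k y powr (s - 1) - 2 * s * ((x \<bullet> x) * y $ i - x $ i) * ?Q2 k y powr (s - 1)" for k i y
  define u2 where "u2 k i y = (2 * s * 1 * ?Q1 k y powr (s - 1) + 4 * s * (s - 1) * (1 * y $ i - x $ i)\<^sup>2 * ?Q1 k y powr (s - 2))
      - (2 * s * (x \<bullet> x) * ?Q2 k y powr (s - 1) + 4 * s * (s - 1) * ((x \<bullet> x) * y $ i - x $ i)\<^sup>2 * ?Q2 k y powr (s - 2))" for k i y
  define v1 where "v1 i y = f' (y \<bullet> y) * (2 * y $ i)" for i and y :: "real ^ 'n"
  define v2 where "v2 i y = 4 * (y $ i)\<^sup>2 * f'' (y \<bullet> y) + 2 * f' (y \<bullet> y)" for i and y :: "real ^ 'n"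
  note cq = continuous_quad_powr[where S=UNIV, OF pos1] continuous_quad_powr[where S=UNIV, OF pos2]
  have cu: "continuous_on UNIV (u1 k i)" "continuous_on UNIV (u2 k i)" for k i
    unfolding u1_def u2_def by (rule continuous_intros cq)+
  have cv: "continuous_on UNIV (v1 i)" "continuous_on UNIV (v2 i)" for i
    unfolding v1_def v2_def by (rule continuous_intros cy)+
  have pu1: "has_partial i (?G k) (u1 k i)" for i k
    unfolding u1_def by (intro has_partial_diff has_partial_quad_powr pos1 pos2)
  have pu2: "has_partial i (u1 k i) (u2 k i)" for i k
    unfolding u1_def u2_def by (intro has_partial_diff has_partial_quad_powr2 pos1 pos2)
  have pv: "has_partial i (\<lambda>y. f (y \<bullet> y)) (v1 i)" "has_partial i (v1 i) (v2 i)" for i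
    unfolding v1_def v2_def by (rule laplacian_radial[OF f])+
  have zero: "?G k y = 0" "f (y \<bullet> y) = 0" if "y \<in> sphere 0 1" for y k
  proof -
    have yy: "y \<bullet> y = 1" using that by (simp add: norm_eq_1)
    then show "f (y \<bullet> y) = 0" by (simp add: f1)
    \<comment> \<open>For \<open>y \<bullet> y = 1\<close> both quadratics equal
      \<open>1 - 2 * (x \<bullet> y) + x \<bullet> x + e k\<close>; this is why both carry the same
      \<open>e k\<close>.\<close>
    from yy have "?Q1 k y = ?Q2 k y" by (simp add: quad_def)
    then show "?G k y = 0" by (simp only: diff_self)
  qed
  have Lu: "(\<Sum>i\<in>UNIV. u2 k i y) = - (?n * (?n - 2)) * (1 * (x \<bullet> x + e k) - x \<bullet> x) * ?Q1 k y powr (- (?n / 2) - 1)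
          - - (?n * (?n - 2)) * ((x \<bullet> x) * (1 + e k) - x \<bullet> x) * ?Q2 k y powr (- (?n / 2) - 1)" for k y
    unfolding u2_def sum_subtractf
    by (simp only: laplacian_quad_powr[OF pos1 s_def] laplacian_quad_powr[OF pos2 s_def])
  have Lv: "(\<Sum>i\<in>UNIV. v2 i y) = Lf y" for y
    unfolding v2_def Lf_def by (rule laplacian_radial(3)[OF f])
  have id: "(LINT y|lborel. indicator ?B y * (?G k y * Lf y))
      = (LINT y|lborel. indicator ?B y * (f (y \<bullet> y) * (- (?n * (?n - 2)) * (1 * (x \<bullet> x + e k) - x \<bullet> x) * ?Q1 k y powr (- (?n / 2) - 1)
          - - (?n * (?n - 2)) * ((x \<bullet> x) * (1 + e k) - x \<bullet> x) * ?Q2 k y powr (- (?n / 2) - 1))))" for k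
    using green_second_identity[where c=0 and r=1, OF pu1[of _ k] pu2[of _ k] pv cG[of k] cy(1) cu(1)[of k] cv(1) cu(2)[of k] cv(2) zero(1)[of _ k] zero(2)] by (simp only: Lu Lv)
  define K1 where "K1 k y = f (y \<bullet> y) * (e k * ?Q1 k y powr (- ?n / 2 - 1))" for k y
  define K2 where "K2 k y = f (y \<bullet> y) * (e k * ((x \<bullet> x) * ?Q2 k y powr (- ?n / 2 - 1)))" for k y
  have int: "integrable lborel (\<lambda>y. indicator ?B y * K1 k y)" "integrable lborel (\<lambda>y. indicator ?B y * K2 k y)" for k
    unfolding K1_def K2_def
    by (intro integrable_indicator_ball continuous_intros continuous_quad_powr pos1 pos2 cy)+
  have id2: "(LINT y|lborel. indicator ?B y * (?G k y * Lf y))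
      = - (?n * (?n - 2)) * ((LINT y|lborel. indicator ?B y * K1 k y) - (LINT y|lborel. indicator ?B y * K2 k y))" for k
  proof -
    have "(LINT y|lborel. indicator ?B y * (?G k y * Lf y))
      = (LINT y|lborel. - (?n * (?n - 2)) * (indicator ?B y * K1 k y - indicator ?B y * K2 k y))"
      unfolding id K1_def K2_def
      by (rule Bochner_Integration.integral_cong) (simp_all add: algebra_simps)
    also have "\<dots> = - (?n * (?n - 2)) * (LINT y|lborel. indicator ?B y * K1 k y - indicator ?B y * K2 k y)"
      by (rule integral_mult_right_zero)
    also have "(LINT y|lborel. indicator ?B y * K1 k y - indicator ?B y * K2 k y)
      = (LINT y|lborel. indicator ?B y * K1 k y) - (LINT y|lborel. indicator ?B y * K2 k y)"
      by (rule Bochner_Integration.integral_diff[OF int])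
    finally show ?thesis .
  qed
  have bounded_on: "\<exists>M\<ge>0. \<forall>y\<in>cball 0 1. \<bar>g y\<bar> \<le> M" if "continuous_on UNIV g" for g :: "real ^ 'n \<Rightarrow> real"
  proof -
    have "compact (g ` cball 0 1)" by (intro compact_continuous_image continuous_on_subset[OF that]) auto
    then obtain M where "\<And>y. y \<in> cball 0 1 \<Longrightarrow> \<bar>g y\<bar> \<le> M"
      using compact_imp_bounded[THEN bounded_iff[THEN iffD1]] by (metis imageI real_norm_def)
    then show ?thesis by (intro exI[of _ "max M 0"]) fastforce
  qed
  have lim1: "(\<lambda>k. LINT y|lborel. indicator ?B y * K1 k y) \<longlonglongrightarrow> unit_ball_vol ?n * f (x \<bullet> x)"
  proof -
    have "compact (f' ` {0..1})" by (intro compact_continuous_image continuous_on_subset[OF cf(2)]) auto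
    then obtain M where M: "\<And>t. t \<in> {0..1} \<Longrightarrow> \<bar>f' t\<bar> \<le> M"
      using compact_imp_bounded[THEN bounded_iff[THEN iffD1]] by (metis imageI real_norm_def)
    have M0: "M \<ge> 0" using M[of 0] by simp
    have lip: "\<bar>f (y \<bullet> y) - f (x \<bullet> x)\<bar> \<le> (2 * M) * norm (x - y)" if "y \<in> ?B" for y
    proof -
      have n1: "norm y < 1" using that by simp
      have u: "y \<bullet> y \<in> {0..1}" "x \<bullet> x \<in> {0..1}" using n1 x by (auto simp: power_le_one simp flip: power2_norm_eq_inner)
      have "norm (f (y \<bullet> y) - f (x \<bullet> x)) \<le> M * norm (y \<bullet> y - x \<bullet> x)"
        by (rule field_differentiable_bound[of "{0..1}" f f' M]) (use f u M in \<open>auto intro: has_field_derivative_at_within\<close>)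
      moreover have "\<bar>y \<bullet> y - x \<bullet> x\<bar> \<le> 2 * norm (x - y)"
      proof -
        have "y \<bullet> y - x \<bullet> x = (norm y + norm x) * (norm y - norm x)"
          by (simp add: power2_eq_square algebra_simps flip: power2_norm_eq_inner)
        then have "\<bar>y \<bullet> y - x \<bullet> x\<bar> = (norm y + norm x) * \<bar>norm y - norm x\<bar>" by (simp add: abs_mult)
        also have "\<dots> \<le> 2 * norm (x - y)"
          using n1 x norm_triangle_ineq3[of y x] by (intro mult_mono) (auto simp: norm_minus_commute)
        finally show ?thesis .
      qed
      ultimately show ?thesis using M0 mult_left_mono[of "\<bar>y \<bullet> y - x \<bullet> x\<bar>" "2 * norm (x - y)" M] by simp
    qed
    show ?thesis unfolding K1_def
      by (rule approximate_identity_tendsto[OF x cyy[OF cf(1)] lip _ e e0]) (use M0 in auto)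
  qed
  \<comment> \<open>For \<open>y\<close> in the unit ball \<open>?Q2 k y\<close> is at least
    \<open>(1 - norm x)^2\<close>, so these integrals are of order \<open>e k\<close>.\<close>
  have lim2: "(\<lambda>k. LINT y|lborel. indicator ?B y * K2 k y) \<longlonglongrightarrow> 0"
  proof -
    obtain M where M: "M \<ge> 0" "\<And>y :: real ^ 'n. y \<in> cball 0 1 \<Longrightarrow> \<bar>f (y \<bullet> y)\<bar> \<le> M"
      using bounded_on[OF cyy[OF cf(1)]] by auto
    define C where "C = M * (1 * ((1 - norm x)\<^sup>2) powr (- ?n / 2 - 1))"
    have "norm (LINT y|lborel. indicator ?B y * K2 k y) \<le> (LINT y|lborel. e k * C * indicator ?B y)" for k
    proof (rule Bochner_Integration.integral_norm_bound_integral)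
      show "integrable lborel (\<lambda>y. e k * C * indicator ?B y)"
        by (intro integrable_mult_right integrable_real_indicator emeasure_bounded_finite bounded_ball) simp
      fix y :: "real ^ 'n"
      show "norm (indicator ?B y * K2 k y) \<le> e k * C * indicator ?B y"
      proof (cases "y \<in> ?B")
        case True
        then have y: "norm y < 1" by simp
        have "norm x * norm y \<le> norm x" using y by (simp add: mult_left_le)
        then have "(1 - norm x)\<^sup>2 \<le> (1 - norm x * norm y)\<^sup>2" using x by (intro power_mono) auto
        then have "(1 - norm x)\<^sup>2 \<le> ?Q2 k y" using quad_inversion_ge[where x=x and e="e k" and y=y] e[of k] by linarith
        then have Q: "?Q2 k y powr (- ?n / 2 - 1) \<le> ((1 - norm x)\<^sup>2) powr (- ?n / 2 - 1)"
          using x by (intro powr_mono2') auto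
        have xx: "x \<bullet> x \<le> 1" "0 \<le> x \<bullet> x" using x by (auto simp: power_le_one simp flip: power2_norm_eq_inner)
        have "\<bar>f (y \<bullet> y)\<bar> * (e k * ((x \<bullet> x) * ?Q2 k y powr (- ?n / 2 - 1))) \<le> M * (e k * (1 * ((1 - norm x)\<^sup>2) powr (- ?n / 2 - 1)))"
          using M y Q xx e[of k] by (intro mult_mono mult_left_mono) auto
        then show ?thesis using True xx e[of k] by (simp add: K2_def C_def abs_mult mult_ac)
      qed simp
    qed (rule int)
    then have le: "norm (LINT y|lborel. indicator ?B y * K2 k y) \<le> e k * C * (LINT y|lborel. indicator ?B y)" for k
      by (simp only: integral_mult_right_zero)
    show ?thesis
    proof (rule Lim_null_comparison)
      show "\<forall>\<^sub>F k in sequentially. norm (LINT y|lborel. indicator ?B y * K2 k y) \<le> e k * C * (LINT y|lborel. indicator ?B y)"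
        by (rule always_eventually, rule allI, rule le)
      have "(\<lambda>k. e k * C * (LINT y|lborel. indicator ?B y)) \<longlonglongrightarrow> 0 * C * (LINT y|lborel. indicator ?B y)"
        by (intro tendsto_mult tendsto_const e0)
      then show "(\<lambda>k. e k * C * (LINT y|lborel. indicator ?B y)) \<longlonglongrightarrow> 0" by simp
    qed
  qed
  let ?w = "\<lambda>y. norm (x - y) powr (2 - ?n) + (1 - norm x) powr (2 - ?n)"
  have limL: "(\<lambda>k. LINT y|lborel. indicator ?B y * (?G k y * Lf y))
      \<longlonglongrightarrow> (LINT y|lborel. indicator ?B y * ((norm (x - y) powr (2 - ?n) - green_bracket x y powr (2 - ?n)) * Lf y))"
  proof -
    obtain M where M: "M \<ge> 0" "\<And>y :: real ^ 'n. y \<in> cball 0 1 \<Longrightarrow> \<bar>Lf y\<bar> \<le> M"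
      using bounded_on[OF cLf] by auto
    have [measurable]: "Lf \<in> borel_measurable borel" using cLf by (rule borel_measurable_continuous_onI)
    have [measurable]: "(\<lambda>y. green_bracket x y) \<in> borel_measurable borel" unfolding green_bracket_def by measurable
    have [measurable]: "?G k \<in> borel_measurable borel" for k using cG by (rule borel_measurable_continuous_onI)
    show ?thesis
    proof (rule integral_dominated_convergence[where w="\<lambda>y. M * (indicator ?B y * ?w y)"])
      show "integrable lborel (\<lambda>y. M * (indicator ?B y * ?w y))"
        by (intro integrable_mult_right integrable_green_kernel n x)
      have ne: "AE y in lborel. y \<noteq> x" by (rule AE_lborel_singleton)
      show "AE y in lborel. norm (indicator ?B y * (?G k y * Lf y)) \<le> M * (indicator ?B y * ?w y)" for k
        using ne
      proof eventually_elim
        case (elim y)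
        show ?case
        proof (cases "y \<in> ?B")
          case True
          then have y: "norm y < 1" by simp
          have "norm x * norm y \<le> norm x" using y by (simp add: mult_left_le)
          then have "(1 - norm x)\<^sup>2 \<le> (1 - norm x * norm y)\<^sup>2" using x by (intro power_mono) auto
          then have "(1 - norm x)\<^sup>2 \<le> ?Q2 k y" using quad_inversion_ge[where x=x and e="e k" and y=y] e[of k] by linarith
          then have "?Q2 k y powr s \<le> ((1 - norm x)\<^sup>2) powr s" using x s by (intro powr_mono2') auto
          also have "\<dots> = (1 - norm x) powr (2 - ?n)" using x by (simp add: powr_powr s flip: powr_numeral)
          finally have b2: "?Q2 k y powr s \<le> (1 - norm x) powr (2 - ?n)" .
          have "?Q1 k y powr s \<le> ((norm (x - y))\<^sup>2) powr s"
            using elim s e[of k] by (intro powr_mono2') (auto simp: quad_norm)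
          also have "\<dots> = norm (x - y) powr (2 - ?n)" using elim by (simp add: powr_powr s flip: powr_numeral)
          finally have b1: "?Q1 k y powr s \<le> norm (x - y) powr (2 - ?n)" .
          have "\<bar>?G k y\<bar> \<le> ?w y" using b1 b2 powr_ge_zero[of "?Q1 k y" s] powr_ge_zero[of "?Q2 k y" s]
            by (auto simp: abs_le_iff intro: add_increasing add_increasing2 order_trans[of _ 0] simp del: powr_ge_zero)
          then have "\<bar>?G k y\<bar> * \<bar>Lf y\<bar> \<le> ?w y * M" using M y by (intro mult_mono) auto
          then show ?thesis using True by (simp add: abs_mult mult.commute)
        qed simp
      qed
      show "AE y in lborel. (\<lambda>k. indicator ?B y * (?G k y * Lf y))
          \<longlonglongrightarrow> indicator ?B y * ((norm (x - y) powr (2 - ?n) - green_bracket x y powr (2 - ?n)) * Lf y)"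
        using ne
      proof eventually_elim
        case (elim y)
        show ?case
        proof (cases "y \<in> ?B")
          case True
          then have b: "green_bracket x y > 0" using bracket_pos[of x y] x by auto
          have "(\<lambda>k. ?G k y) \<longlonglongrightarrow> ((norm (x - y))\<^sup>2 + 0) powr s - ((green_bracket x y)\<^sup>2) powr s"
            unfolding quad_norm green_bracket_quad(1) quad_def[of "x \<bullet> x" x]
            by (intro tendsto_intros e0)
              (use elim b in \<open>auto simp: quad_def green_bracket_quad(1)[symmetric, unfolded quad_def, simplified]\<close>)
          also have "((norm (x - y))\<^sup>2 + 0) powr s = norm (x - y) powr (2 - ?n)"
            using elim by (simp add: powr_powr s flip: powr_numeral)
          also have "((green_bracket x y)\<^sup>2) powr s = green_bracket x y powr (2 - ?n)"
            using b by (simp add: powr_powr s flip: powr_numeral)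
          finally have "(\<lambda>k. ?G k y) \<longlonglongrightarrow> norm (x - y) powr (2 - ?n) - green_bracket x y powr (2 - ?n)" .
          then show ?thesis by (intro tendsto_mult tendsto_const)
        qed simp
      qed
    qed measurable
  qed
  have "(\<lambda>k. - (?n * (?n - 2)) * ((LINT y|lborel. indicator ?B y * K1 k y) - (LINT y|lborel. indicator ?B y * K2 k y)))
      \<longlonglongrightarrow> - (?n * (?n - 2)) * (unit_ball_vol ?n * f (x \<bullet> x) - 0)"
    by (intro tendsto_intros lim1 lim2)
  from LIMSEQ_unique[OF limL[unfolded id2] this]
  have I: "(LINT y|lborel. indicator ?B y * ((norm (x - y) powr (2 - ?n) - green_bracket x y powr (2 - ?n)) * Lf y))
      = - (?n * (?n - 2)) * (unit_ball_vol ?n * f (x \<bullet> x))" by simp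
  have "(LINT y|lborel. indicator ?B y * (green x y * - Lf y))
     = (LINT y|lborel. - green_const TYPE('n) * (indicator ?B y * ((norm (x - y) powr (2 - ?n) - green_bracket x y powr (2 - ?n)) * Lf y)))"
  proof (rule Bochner_Integration.integral_cong[OF refl])
    fix y
    show "indicator ?B y * (green x y * - Lf y)
       = - green_const TYPE('n) * (indicator ?B y * ((norm (x - y) powr (2 - ?n) - green_bracket x y powr (2 - ?n)) * Lf y))"
      by (cases "y \<in> ?B") (simp_all add: green_eq_powr[OF n x])
  qed
  also have "\<dots> = - green_const TYPE('n) * (- (?n * (?n - 2)) * (unit_ball_vol ?n * f (x \<bullet> x)))"
    by (subst integral_mult_right_zero) (simp only: I)
  \<comment> \<open>Here the Hausdorff measure of the sphere enters: it makes
    \<open>green_const\<close> the inverse of \<open>n * (n - 2)\<close> times the volume of the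
    unit ball.\<close>
  also have "\<dots> = f (x \<bullet> x)"
    using n unit_ball_vol_pos[of ?n] by (simp add: green_const_eq less_imp_neq[THEN not_sym])
  finally show ?thesis unfolding Lf_def .
qed

section \<open>The first eigenvalue\<close>

text \<open>The recursion compares coefficients of \<open>t ^ k\<close> in
  \<open>4 * t * f'' + 2 * \<nu> * f' = - f\<close>, which is the equation
  \<open>- laplacian u = u\<close> for \<open>u x = f (x \<bullet> x)\<close> in dimension
  \<open>\<nu>\<close>.\<close>

primrec bessel_coeff :: "real \<Rightarrow> nat \<Rightarrow> real" where
  "bessel_coeff \<nu> 0 = 1"
| "bessel_coeff \<nu> (Suc k) = - bessel_coeff \<nu> k / ((real k + 1) * (4 * real k + 2 * \<nu>))"

text \<open>Up to normalisation, \<open>bessel_series n (r\<^sup>2)\<close> is \<open>J(r) / r^(n/2 - 1)\<close> for the Bessel function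
  \<open>J\<close> of order \<open>n/2 - 1\<close>.\<close>

definition bessel_series :: "real \<Rightarrow> real \<Rightarrow> real" where
  "bessel_series \<nu> t = (\<Sum>k. bessel_coeff \<nu> k * t ^ k)"

definition bessel_series' :: "real \<Rightarrow> real \<Rightarrow> real" where
  "bessel_series' \<nu> t = (\<Sum>k. diffs (bessel_coeff \<nu>) k * t ^ k)"

definition bessel_series'' :: "real \<Rightarrow> real \<Rightarrow> real" where
  "bessel_series'' \<nu> t = (\<Sum>k. diffs (diffs (bessel_coeff \<nu>)) k * t ^ k)"

context
  fixes \<nu> :: real
  assumes nu: "\<nu> \<ge> 1"
begin

text \<open>A crude comparison with the exponential series, enough for convergence everywhere: of
  the factor \<open>4 * real k + 2 * \<nu>\<close> only the lower bound 1 is kept.\<close>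

lemma abs_bessel_coeff_le: "\<bar>bessel_coeff \<nu> k\<bar> \<le> 1 / fact k"
proof (induction k)
  case (Suc k)
  have "\<bar>bessel_coeff \<nu> (Suc k)\<bar> = \<bar>bessel_coeff \<nu> k\<bar> / ((real k + 1) * (4 * real k + 2 * \<nu>))"
    using nu by (simp add: abs_mult)
  also have "\<dots> \<le> (1 / fact k) / ((real k + 1) * 1)"
    using Suc nu by (intro frac_le mult_left_mono) auto
  finally show ?case by (simp add: algebra_simps)
qed simp

lemma summable_bessel: "summable (\<lambda>k. bessel_coeff \<nu> k * t ^ k)"
proof (rule summable_comparison_test')
  show "summable (\<lambda>k. \<bar>t\<bar> ^ k / fact k)" using summable_exp[of "\<bar>t\<bar>"] by (simp add: divide_inverse mult.commute)
  show "norm (bessel_coeff \<nu> k * t ^ k) \<le> \<bar>t\<bar> ^ k / fact k" if "k \<ge> 0" for k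
    using mult_right_mono[OF abs_bessel_coeff_le[of k], of "\<bar>t\<bar> ^ k"] by (simp add: abs_mult power_abs)
qed

lemma summable_bessel':
  "summable (\<lambda>k. diffs (bessel_coeff \<nu>) k * t ^ k)" "summable (\<lambda>k. diffs (diffs (bessel_coeff \<nu>)) k * t ^ k)"
  "summable (\<lambda>k. diffs (diffs (diffs (bessel_coeff \<nu>))) k * t ^ k)"
  by (intro termdiff_converges_all summable_bessel)+

lemma bessel_series_deriv: "(bessel_series \<nu> has_real_derivative bessel_series' \<nu> t) (at t)"
  unfolding bessel_series_def[abs_def] bessel_series'_def
  by (rule termdiffs_strong_converges_everywhere[OF summable_bessel])

lemma bessel_series'_deriv: "(bessel_series' \<nu> has_real_derivative bessel_series'' \<nu> t) (at t)"
  unfolding bessel_series'_def[abs_def] bessel_series''_def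
  by (rule termdiffs_strong_converges_everywhere[OF summable_bessel'(1)])

lemma continuous_bessel_series'': "continuous_on UNIV (bessel_series'' \<nu>)"
proof -
  have "(bessel_series'' \<nu> has_real_derivative (\<Sum>k. diffs (diffs (diffs (bessel_coeff \<nu>))) k * t ^ k)) (at t)" for t
    unfolding bessel_series''_def[abs_def]
    by (rule termdiffs_strong_converges_everywhere[OF summable_bessel'(2)])
  then show ?thesis by (auto intro!: continuous_at_imp_continuous_on DERIV_isCont)
qed

lemma bessel_series_0: "bessel_series \<nu> 0 = 1"
  unfolding bessel_series_def by (simp add: powser_zero)

lemma bessel_series_ode: "4 * t * bessel_series'' \<nu> t + 2 * \<nu> * bessel_series' \<nu> t = - bessel_series \<nu> t"
proof -
  let ?d = "diffs (bessel_coeff \<nu>)"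
  have "(\<lambda>k. diffs ?d k * t ^ k * t) sums (bessel_series'' \<nu> t * t)"
    unfolding bessel_series''_def by (intro sums_mult2 summable_sums summable_bessel')
  then have "(\<lambda>k. real (Suc k) * ?d (Suc k) * t ^ Suc k) sums (bessel_series'' \<nu> t * t)"
    by (simp add: diffs_def mult_ac)
  then have "(\<lambda>k. real k * ?d k * t ^ k) sums (bessel_series'' \<nu> t * t)"
    by (subst (asm) sums_Suc_iff) simp
  then have "(\<lambda>k. 4 * (real k * ?d k * t ^ k) + 2 * \<nu> * (?d k * t ^ k)) sums
      (4 * (bessel_series'' \<nu> t * t) + 2 * \<nu> * bessel_series' \<nu> t)"
    unfolding bessel_series'_def by (intro sums_add sums_mult summable_sums summable_bessel')
  moreover have "4 * (real k * ?d k * t ^ k) + 2 * \<nu> * (?d k * t ^ k) = - (bessel_coeff \<nu> k * t ^ k)" for k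
  proof -
    have "(real k + 1) * (4 * real k + 2 * \<nu>) \<noteq> 0" using nu by (simp add: add_nonneg_pos less_imp_neq[THEN not_sym])
    then have "(4 * real k + 2 * \<nu>) * ?d k = - bessel_coeff \<nu> k"
      by (simp add: diffs_def field_simps)
    moreover have "4 * (real k * ?d k * t ^ k) + 2 * \<nu> * (?d k * t ^ k) = ((4 * real k + 2 * \<nu>) * ?d k) * t ^ k"
      by (simp add: algebra_simps)
    ultimately show ?thesis by simp
  qed
  ultimately have "(\<lambda>k. - (bessel_coeff \<nu> k * t ^ k)) sums (4 * (bessel_series'' \<nu> t * t) + 2 * \<nu> * bessel_series' \<nu> t)"
    by simp
  moreover have "(\<lambda>k. - (bessel_coeff \<nu> k * t ^ k)) sums (- bessel_series \<nu> t)"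
    unfolding bessel_series_def by (intro sums_minus summable_sums summable_bessel)
  ultimately show ?thesis using sums_unique2 by (fastforce simp: mult_ac)
qed

lemma continuous_bessel_series: "continuous_on S (bessel_series \<nu>)"
  using bessel_series_deriv by (auto intro!: continuous_at_imp_continuous_on DERIV_isCont)

end

text \<open>If \<open>c > 0\<close>, then \<open>h' 0 = 0\<close> makes \<open>h'\<close> positive
  just to the right of 0, and the mean value theorem lifts \<open>h\<close> above its
  maximum.\<close>

lemma second_derivative_le_0_of_local_max:
  fixes h :: "real \<Rightarrow> real"
  assumes d: "d > 0" and h: "\<And>t. \<bar>t\<bar> < d \<Longrightarrow> (h has_real_derivative h' t) (at t)"
    and h': "(h' has_real_derivative c) (at 0)" and max: "\<And>t. \<bar>t\<bar> < d \<Longrightarrow> h t \<le> h 0"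
  shows "c \<le> 0"
proof (rule ccontr)
  assume "\<not> c \<le> 0"
  then have c: "c > 0" by simp
  have "h' 0 = 0" by (rule DERIV_local_max[OF h d]) (use d max in auto)
  with DERIV_pos_inc_right[OF h' c] obtain e where e: "e > 0" "\<And>s. s > 0 \<Longrightarrow> s < e \<Longrightarrow> h' s > 0" by auto
  define s where "s = min e d / 2"
  have s: "0 < s" "s < e" "s < d" using e d by (auto simp: s_def)
  obtain z where z: "0 < z" "z < s" "h s - h 0 = (s - 0) * h' z"
    using MVT2[of 0 s h h'] s h by auto
  then have "h s - h 0 > 0" using e(2)[of z] s by simp
  then show False using max[of s] s by simp
qed

text \<open>At an interior maximum of \<open>v / \<phi>\<close> a multiple of \<open>\<phi>\<close> touches \<open>v\<close> from above.\<close>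

lemma eigenvalue_comparison:
  fixes v \<phi> :: "real ^ 'n::finite \<Rightarrow> real"
  assumes v: "continuous_on (cball 0 1) v"
    and v1: "\<And>i x. x \<in> ball 0 1 \<Longrightarrow> ((\<lambda>t. v (x + t *\<^sub>R axis i 1)) has_real_derivative v1 i x) (at 0)"
    and v2: "\<And>i x. x \<in> ball 0 1 \<Longrightarrow> ((\<lambda>t. v1 i (x + t *\<^sub>R axis i 1)) has_real_derivative v2 i x) (at 0)"
    and sub: "\<And>x. x \<in> ball 0 1 \<Longrightarrow> v x > 0 \<Longrightarrow> - (\<Sum>i\<in>UNIV. v2 i x) \<le> l * v x"
    and bd: "\<And>x. x \<in> sphere 0 1 \<Longrightarrow> v x \<le> 0" and x0: "x0 \<in> ball 0 1" "v x0 > 0"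
    and \<phi>: "\<And>i. has_partial i \<phi> (\<phi>1 i)" "\<And>i. has_partial i (\<phi>1 i) (\<phi>2 i)"
    and \<phi>c: "continuous_on UNIV \<phi>" and \<phi>pos: "\<And>x. x \<in> cball 0 1 \<Longrightarrow> \<phi> x > 0"
    and \<phi>e: "\<And>x. x \<in> ball 0 1 \<Longrightarrow> - (\<Sum>i\<in>UNIV. \<phi>2 i x) = \<mu> * \<phi> x"
  shows "\<mu> \<le> l"
proof -
  have "continuous_on (cball 0 1) (\<lambda>x. v x / \<phi> x)"
    using \<phi>pos by (intro continuous_intros v continuous_on_subset[OF \<phi>c]) (auto simp: less_imp_neq[THEN not_sym])
  then obtain x where x: "x \<in> cball 0 1" and xmax: "\<And>y. y \<in> cball 0 1 \<Longrightarrow> v y / \<phi> y \<le> v x / \<phi> x"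
    using continuous_attains_sup[of "cball 0 1" "\<lambda>x. v x / \<phi> x"] by auto
  define M where "M = v x / \<phi> x"
  have "v x0 / \<phi> x0 > 0" using x0 \<phi>pos[of x0] by auto
  then have M: "M > 0" using xmax[of x0] x0 by (auto simp: M_def)
  have vx: "v x = M * \<phi> x" using \<phi>pos[OF x] by (simp add: M_def)
  have vpos: "v x > 0" using vx M \<phi>pos[OF x] by simp
  have xb: "x \<in> ball 0 1" using bd[of x] vpos x by fastforce
  obtain d where d: "d > 0" "ball x d \<subseteq> ball 0 1" using open_ball[of 0 1] xb openE by blast
  have second: "v2 i x - M * \<phi>2 i x \<le> 0" for i
  proof (rule second_derivative_le_0_of_local_max[OF d(1),
        where h="\<lambda>t. v (x + t *\<^sub>R axis i 1) - M * \<phi> (x + t *\<^sub>R axis i 1)"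
        and h'="\<lambda>t. v1 i (x + t *\<^sub>R axis i 1) - M * \<phi>1 i (x + t *\<^sub>R axis i 1)"])
    have inb: "x + t *\<^sub>R axis i 1 \<in> ball 0 1" if "\<bar>t\<bar> < d" for t
      using that d(2) by (intro subsetD[OF d(2)]) (simp add: dist_norm)
    fix t :: real assume t: "\<bar>t\<bar> < d"
    let ?y = "x + t *\<^sub>R axis i 1"
    have "((\<lambda>s. v (?y + s *\<^sub>R axis i 1)) has_real_derivative v1 i ?y) (at (t - t))"
      using v1[OF inb[OF t]] by simp
    moreover have "((\<lambda>u. u - t) has_real_derivative 1) (at t)" by (auto intro!: derivative_eq_intros)
    ultimately have A: "((\<lambda>u. v (?y + (u - t) *\<^sub>R axis i 1)) has_real_derivative v1 i ?y * 1) (at t)" by (rule DERIV_chain2)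
    have "((\<lambda>s. \<phi> (?y + s *\<^sub>R axis i 1)) has_real_derivative \<phi>1 i ?y) (at (t - t))"
      using has_partialD[OF \<phi>(1)] by simp
    moreover have "((\<lambda>u. u - t) has_real_derivative 1) (at t)" by (auto intro!: derivative_eq_intros)
    ultimately have B: "((\<lambda>u. \<phi> (?y + (u - t) *\<^sub>R axis i 1)) has_real_derivative \<phi>1 i ?y * 1) (at t)" by (rule DERIV_chain2)
    have e: "?y + (u - t) *\<^sub>R axis i 1 = x + u *\<^sub>R axis i 1" for u by (simp add: algebra_simps)
    show "((\<lambda>t. v (x + t *\<^sub>R axis i 1) - M * \<phi> (x + t *\<^sub>R axis i 1)) has_real_derivative v1 i ?y - M * \<phi>1 i ?y) (at t)"
      using DERIV_diff[OF A DERIV_cmult[OF B, of M]] unfolding e by simp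
    have "v ?y / \<phi> ?y \<le> M" unfolding M_def by (rule xmax) (use inb[OF t] in auto)
    then show "v ?y - M * \<phi> ?y \<le> v (x + 0 *\<^sub>R axis i 1) - M * \<phi> (x + 0 *\<^sub>R axis i 1)"
      using \<phi>pos[of ?y] inb[OF t] vx by (simp add: pos_divide_le_eq)
  next
    show "((\<lambda>t. v1 i (x + t *\<^sub>R axis i 1) - M * \<phi>1 i (x + t *\<^sub>R axis i 1)) has_real_derivative v2 i x - M * \<phi>2 i x) (at 0)"
      by (intro DERIV_diff DERIV_cmult v2 xb has_partialD \<phi>)
  qed
  have "(\<Sum>i\<in>UNIV. v2 i x) \<le> (\<Sum>i\<in>UNIV. M * \<phi>2 i x)"
    using second by (intro sum_mono) simp
  also have "\<dots> = M * (\<Sum>i\<in>UNIV. \<phi>2 i x)" by (simp add: sum_distrib_left)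
  also have "(\<Sum>i\<in>UNIV. \<phi>2 i x) = - (\<mu> * \<phi> x)" using \<phi>e[OF xb] by linarith
  also have "M * - (\<mu> * \<phi> x) = - (\<mu> * v x)" by (simp add: vx)
  finally have "\<mu> * v x \<le> l * v x" using sub[OF xb vpos] by linarith
  then show ?thesis using vpos by simp
qed

section \<open>The radial eigenfunction and the first zero of its series\<close>

definition bessel_ball :: "real \<Rightarrow> real ^ 'n::finite \<Rightarrow> real" where
  "bessel_ball \<mu> x = bessel_series (CARD('n)) (\<mu> * (x \<bullet> x))"

lemma bessel_ball_deriv:
  fixes \<mu> :: real
  defines "\<nu> \<equiv> real CARD('n::finite)"
  shows "((\<lambda>t. bessel_series \<nu> (\<mu> * t)) has_real_derivative \<mu> * bessel_series' \<nu> (\<mu> * t)) (at t)"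
    and "((\<lambda>t. \<mu> * bessel_series' \<nu> (\<mu> * t)) has_real_derivative \<mu>\<^sup>2 * bessel_series'' \<nu> (\<mu> * t)) (at t)"
    and "continuous_on UNIV (\<lambda>t. \<mu>\<^sup>2 * bessel_series'' \<nu> (\<mu> * t))"
    and "4 * t * (\<mu>\<^sup>2 * bessel_series'' \<nu> (\<mu> * t)) + 2 * \<nu> * (\<mu> * bessel_series' \<nu> (\<mu> * t)) = - (\<mu> * bessel_series \<nu> (\<mu> * t))"
proof -
  have nu: "\<nu> \<ge> 1" using zero_less_card_finite[where 'a='n] unfolding \<nu>_def by linarith
  have m: "((\<lambda>t. \<mu> * t) has_real_derivative \<mu>) (at t)" by (auto intro!: derivative_eq_intros)
  show "((\<lambda>t. bessel_series \<nu> (\<mu> * t)) has_real_derivative \<mu> * bessel_series' \<nu> (\<mu> * t)) (at t)"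
    using DERIV_chain2[OF bessel_series_deriv[OF nu] m] by (simp add: mult.commute)
  show "((\<lambda>t. \<mu> * bessel_series' \<nu> (\<mu> * t)) has_real_derivative \<mu>\<^sup>2 * bessel_series'' \<nu> (\<mu> * t)) (at t)"
    using DERIV_cmult[OF DERIV_chain2[OF bessel_series'_deriv[OF nu] m], of \<mu>] by (simp add: power2_eq_square mult_ac)
  show "continuous_on UNIV (\<lambda>t. \<mu>\<^sup>2 * bessel_series'' \<nu> (\<mu> * t))"
    by (intro continuous_intros continuous_on_compose2[OF continuous_bessel_series''[OF nu]]) auto
  have "4 * t * (\<mu>\<^sup>2 * bessel_series'' \<nu> (\<mu> * t)) + 2 * \<nu> * (\<mu> * bessel_series' \<nu> (\<mu> * t))
     = \<mu> * (4 * (\<mu> * t) * bessel_series'' \<nu> (\<mu> * t) + 2 * \<nu> * bessel_series' \<nu> (\<mu> * t))"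
    by (simp add: power2_eq_square algebra_simps)
  then show "4 * t * (\<mu>\<^sup>2 * bessel_series'' \<nu> (\<mu> * t)) + 2 * \<nu> * (\<mu> * bessel_series' \<nu> (\<mu> * t)) = - (\<mu> * bessel_series \<nu> (\<mu> * t))"
    by (simp add: bessel_series_ode[OF nu])
qed

text \<open>If the series is positive on \<open>[0, \<mu>]\<close>, then
  \<open>bessel_ball \<mu>\<close> is positive on the closed ball and can serve as the function that
  divides \<open>v\<close>.\<close>

lemma eigenvalue_comparison_bessel:
  fixes v :: "real ^ 'n::finite \<Rightarrow> real"
  assumes v: "continuous_on (cball 0 1) v"
    and v1: "\<And>i x. x \<in> ball 0 1 \<Longrightarrow> ((\<lambda>t. v (x + t *\<^sub>R axis i 1)) has_real_derivative v1 i x) (at 0)"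
    and v2: "\<And>i x. x \<in> ball 0 1 \<Longrightarrow> ((\<lambda>t. v1 i (x + t *\<^sub>R axis i 1)) has_real_derivative v2 i x) (at 0)"
    and sub: "\<And>x. x \<in> ball 0 1 \<Longrightarrow> v x > 0 \<Longrightarrow> - (\<Sum>i\<in>UNIV. v2 i x) \<le> l * v x"
    and bd: "\<And>x. x \<in> sphere 0 1 \<Longrightarrow> v x \<le> 0" and x0: "x0 \<in> ball 0 1" "v x0 > 0"
    and \<mu>: "\<mu> \<ge> 0" "\<And>t. 0 \<le> t \<Longrightarrow> t \<le> \<mu> \<Longrightarrow> bessel_series (CARD('n)) t > 0"
  shows "\<mu> \<le> l"
proof (rule eigenvalue_comparison[OF v v1 v2 sub bd x0])
  let ?\<nu> = "real CARD('n)"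
  note B = bessel_ball_deriv[where 'n='n and \<mu>=\<mu>]
  note R = laplacian_radial[OF B(1,2)]
  show "has_partial i (bessel_ball \<mu>) (\<lambda>y :: real ^ 'n. \<mu> * bessel_series' ?\<nu> (\<mu> * (y \<bullet> y)) * (2 * y $ i))" for i
    unfolding bessel_ball_def[abs_def] by (rule R(1))
  show "has_partial i (\<lambda>y :: real ^ 'n. \<mu> * bessel_series' ?\<nu> (\<mu> * (y \<bullet> y)) * (2 * y $ i))
     (\<lambda>y. 4 * (y $ i)\<^sup>2 * (\<mu>\<^sup>2 * bessel_series'' ?\<nu> (\<mu> * (y \<bullet> y))) + 2 * (\<mu> * bessel_series' ?\<nu> (\<mu> * (y \<bullet> y))))" for i
    by (rule R(2))
  have nu: "?\<nu> \<ge> 1" using zero_less_card_finite[where 'a='n] by linarith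
  show "continuous_on UNIV (bessel_ball \<mu> :: real ^ 'n \<Rightarrow> real)" unfolding bessel_ball_def[abs_def]
    by (rule continuous_on_compose2[OF continuous_bessel_series[OF nu, of UNIV]]) (auto intro!: continuous_intros)
  show "bessel_ball \<mu> x > 0" if "x \<in> cball 0 1" for x :: "real ^ 'n"
    unfolding bessel_ball_def
  proof (rule \<mu>(2))
    have "x \<bullet> x \<le> 1" using that by (simp add: power_le_one flip: power2_norm_eq_inner)
    then show "0 \<le> \<mu> * (x \<bullet> x)" "\<mu> * (x \<bullet> x) \<le> \<mu>" using \<mu>(1) by (auto simp: mult_left_le)
  qed
  show "- (\<Sum>i\<in>UNIV. 4 * (x $ i)\<^sup>2 * (\<mu>\<^sup>2 * bessel_series'' ?\<nu> (\<mu> * (x \<bullet> x))) + 2 * (\<mu> * bessel_series' ?\<nu> (\<mu> * (x \<bullet> x))))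
      = \<mu> * bessel_ball \<mu> x" for x :: "real ^ 'n"
    unfolding R(3) B(4) bessel_ball_def by simp
qed

text \<open>Without a zero the comparison would hold for every \<open>\<mu>\<close>, yet one fixed
  subsolution caps it. Squaring \<open>1 - |x|^2\<close> makes \<open>- laplacian v\<close> negative
  near the sphere, where \<open>l * v\<close> is too small to dominate a positive constant.\<close>

lemma bessel_zero_exists: "\<exists>t\<ge>0. bessel_series (CARD('n::finite)) t \<le> 0"
proof (rule ccontr)
  let ?n = "real CARD('n)"
  assume "\<not> ?thesis"
  then have pos: "bessel_series ?n t > 0" if "t \<ge> 0" for t using that by (meson not_le)
  \<comment> \<open>The least \<open>l\<close> for which \<open>(1 - |x|^2)^2\<close> is a subsolution of \<open>- laplacian v = l v\<close>.\<close>
  define l where "l = (?n + 2)\<^sup>2 / 2"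
  have f: "((\<lambda>s. (1 - s)\<^sup>2) has_real_derivative - 2 * (1 - s)) (at s)" for s :: real
    by (auto intro!: derivative_eq_intros simp: power2_eq_square)
  have f': "((\<lambda>s. - 2 * (1 - s)) has_real_derivative 2) (at s)" for s :: real
    by (auto intro!: derivative_eq_intros)
  note R = laplacian_radial[OF f f']
  have "l + 1 \<le> l"
  proof (rule eigenvalue_comparison_bessel[where 'n='n])
    show "continuous_on (cball 0 1) (\<lambda>x :: real ^ 'n. (1 - x \<bullet> x)\<^sup>2)" by (intro continuous_intros)
    show "((\<lambda>t. (1 - (x + t *\<^sub>R axis i 1) \<bullet> (x + t *\<^sub>R axis i 1))\<^sup>2) has_real_derivative - 2 * (1 - x \<bullet> x) * (2 * x $ i)) (at 0)"
      for i and x :: "real ^ 'n" by (rule has_partialD[OF R(1)])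
    show "((\<lambda>t. - 2 * (1 - (x + t *\<^sub>R axis i 1) \<bullet> (x + t *\<^sub>R axis i 1)) * (2 * (x + t *\<^sub>R axis i 1) $ i)) has_real_derivative
        4 * (x $ i)\<^sup>2 * 2 + 2 * (- 2 * (1 - x \<bullet> x))) (at 0)" for i and x :: "real ^ 'n"
      by (rule has_partialD[OF R(2)])
    show "- (\<Sum>i\<in>UNIV. 4 * (x $ i)\<^sup>2 * 2 + 2 * (- 2 * (1 - x \<bullet> x))) \<le> l * (1 - x \<bullet> x)\<^sup>2" for x :: "real ^ 'n"
    proof -
      define q where "q = 1 - x \<bullet> x"
      have xx: "x \<bullet> x = 1 - q" by (simp add: q_def)
      \<comment> \<open>For this \<open>l\<close> the quadratic in \<open>q\<close> has a double
        root.\<close>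
      have "l * q\<^sup>2 + (4 * (1 - q) * 2 + 2 * ?n * (- 2 * q)) = ((?n + 2) * q - 4)\<^sup>2 / 2"
        unfolding l_def by (simp add: power2_eq_square field_simps)
      also have "\<dots> \<ge> 0" by simp
      finally have "- (4 * (x \<bullet> x) * 2 + 2 * ?n * (- 2 * (1 - x \<bullet> x))) \<le> l * (1 - x \<bullet> x)\<^sup>2"
        unfolding xx by simp
      then show ?thesis using R(3)[of x] by simp
    qed
    show "(1 - x \<bullet> x)\<^sup>2 \<le> 0" if "x \<in> sphere 0 1" for x :: "real ^ 'n" using that by (simp add: norm_eq_1)
    show "(0 :: real ^ 'n) \<in> ball 0 1" "(1 - (0 :: real ^ 'n) \<bullet> 0)\<^sup>2 > 0" by auto
    show "0 \<le> l + 1" by (simp add: l_def)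
  qed (use pos in auto)
  then show False by simp
qed

definition bessel_zero :: "'n::finite itself \<Rightarrow> real" where
  "bessel_zero _ = Inf {t. 0 \<le> t \<and> bessel_series (CARD('n)) t = 0}"

text \<open>The zeros form a closed nonempty set that misses 0, where the series is 1. By the
  intermediate value theorem, a value at \<open>t\<close> that is not positive forces a zero in
  \<open>[0, t]\<close>.\<close>

lemma bessel_zero:
  shows "bessel_zero TYPE('n::finite) > 0"
    and "bessel_series (CARD('n)) (bessel_zero TYPE('n)) = 0"
    and "0 \<le> t \<Longrightarrow> t < bessel_zero TYPE('n) \<Longrightarrow> bessel_series (CARD('n)) t > 0"
proof -
  let ?n = "real CARD('n)" and ?Z = "{t. 0 \<le> t \<and> bessel_series (CARD('n)) t = 0}"
  have nu: "?n \<ge> 1" using zero_less_card_finite[where 'a='n] by linarith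
  note cont = continuous_bessel_series[OF nu]
  have ivt: "\<exists>s. 0 \<le> s \<and> s \<le> t \<and> bessel_series ?n s = 0" if "0 \<le> t" "bessel_series ?n t \<le> 0" for t
    using IVT2'[of "bessel_series ?n" t 0 0] that cont bessel_series_0[OF nu] by auto
  have ne: "?Z \<noteq> {}" using bessel_zero_exists[where 'n='n] ivt by blast
  have "closed ({0..} \<inter> bessel_series ?n -` {0})"
    by (intro continuous_closed_preimage cont) auto
  moreover have "{0..} \<inter> bessel_series ?n -` {0} = ?Z" by auto
  ultimately have "closed ?Z" by simp
  then have "Inf ?Z \<in> ?Z" by (intro closed_contains_Inf ne) (auto intro: bdd_belowI[of _ 0])
  then have Z: "bessel_zero TYPE('n) \<in> ?Z" by (simp add: bessel_zero_def)
  then show "bessel_series (CARD('n)) (bessel_zero TYPE('n)) = 0" by simp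
  then show "bessel_zero TYPE('n) > 0"
    using Z bessel_series_0[OF nu] by (metis (mono_tags) mem_Collect_eq order_le_less zero_neq_one)
  show "bessel_series (CARD('n)) t > 0" if t: "0 \<le> t" "t < bessel_zero TYPE('n)"
  proof (rule ccontr)
    assume "\<not> ?thesis"
    then obtain s where "0 \<le> s" "s \<le> t" "bessel_series ?n s = 0" using ivt t by (meson not_le)
    then have "bessel_zero TYPE('n) \<le> s" unfolding bessel_zero_def
      by (intro cInf_lower) (auto intro: bdd_belowI[of _ 0])
    then show False using t \<open>s \<le> t\<close> by simp
  qed
qed

text \<open>\<open>partial_derivative\<close> is a \<open>deriv\<close>, which says something only
  where the derivative exists; differentiability supplies the existence.\<close>

lemma line_derivative:
  fixes v :: "real ^ 'n::finite \<Rightarrow> real"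
  assumes "v differentiable_on S" "open S" "x \<in> S"
  shows "((\<lambda>t. v (x + t *\<^sub>R axis i 1)) has_real_derivative partial_derivative i v x) (at 0)"
proof -
  obtain D where D: "(v has_derivative D) (at x)"
    using assms by (meson differentiable_def differentiable_on_eq_differentiable_at)
  have "((\<lambda>t :: real. x + t *\<^sub>R axis i 1) has_derivative (\<lambda>h. h *\<^sub>R axis i 1)) (at 0)"
    by (auto intro!: derivative_eq_intros)
  moreover have "(v has_derivative D) (at (x + 0 *\<^sub>R axis i 1))" using D by simp
  ultimately have "((\<lambda>t. v (x + t *\<^sub>R axis i 1)) has_derivative (\<lambda>h. D (h *\<^sub>R axis i 1))) (at 0)"
    by (rule has_derivative_compose)
  moreover have "D (h *\<^sub>R axis i 1) = D (axis i 1) * h" for h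
    using has_derivative_linear[OF D] by (simp add: linear_scale)
  ultimately have "((\<lambda>t. v (x + t *\<^sub>R axis i 1)) has_real_derivative D (axis i 1)) (at 0)"
    by (simp add: has_field_derivative_def)
  then show ?thesis unfolding partial_derivative_def using DERIV_imp_deriv by fastforce
qed

text \<open>An eigenvalue below the zero would leave room for some \<open>\<mu>\<close> strictly
  between the two, for which the comparison function is positive even on the sphere.\<close>

lemma dirichlet_eigenvalue_ge:
  assumes "dirichlet_eigenvalue TYPE('n::finite) l"
  shows "bessel_zero TYPE('n) \<le> l"
proof (rule ccontr)
  assume less: "\<not> ?thesis"
  obtain v :: "real ^ 'n \<Rightarrow> real" where "dirichlet_eigenfunction l v"
    using assms by (auto simp: dirichlet_eigenvalue_def)
  then obtain x0 where diff: "v differentiable_on ball 0 1" "\<And>i. partial_derivative i v differentiable_on ball 0 1"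
    and cont: "continuous_on (cball 0 1) v" and x0: "x0 \<in> ball 0 1" "v x0 \<noteq> 0"
    and eig: "\<And>x. x \<in> ball 0 1 \<Longrightarrow> - (\<Sum>i\<in>UNIV. partial_derivative i (partial_derivative i v) x) = l * v x"
    and bd: "\<And>x. x \<in> sphere 0 1 \<Longrightarrow> v x = 0"
    unfolding dirichlet_eigenfunction_def C2_on_def laplacian_def by blast
  \<comment> \<open>\<open>max l 0\<close> keeps \<open>\<mu>\<close> nonnegative when
    \<open>l\<close> is negative.\<close>
  define \<mu> where "\<mu> = (max l 0 + bessel_zero TYPE('n)) / 2"
  have \<mu>: "0 \<le> \<mu>" "l < \<mu>" "\<mu> < bessel_zero TYPE('n)"
    using less bessel_zero(1)[where 'n='n] by (auto simp: \<mu>_def)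
  \<comment> \<open>The sign of an eigenfunction is arbitrary; this factor makes it positive at
    \<open>x0\<close>.\<close>
  define c where "c = sgn (v x0)"
  have c: "c * v x0 > 0" using x0 by (auto simp: c_def sgn_if)
  have "\<mu> \<le> l"
  proof (rule eigenvalue_comparison_bessel[where v="\<lambda>x. c * v x"])
    show "continuous_on (cball 0 1) (\<lambda>x. c * v x)" by (intro continuous_intros cont)
    show "((\<lambda>t. c * v (x + t *\<^sub>R axis i 1)) has_real_derivative c * partial_derivative i v x) (at 0)"
      if "x \<in> ball 0 1" for i x
      by (intro DERIV_cmult line_derivative[OF diff(1) open_ball that])
    show "((\<lambda>t. c * partial_derivative i v (x + t *\<^sub>R axis i 1)) has_real_derivative
        c * partial_derivative i (partial_derivative i v) x) (at 0)" if "x \<in> ball 0 1" for i x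
      by (intro DERIV_cmult line_derivative[OF diff(2) open_ball that])
    show "- (\<Sum>i\<in>UNIV. c * partial_derivative i (partial_derivative i v) x) \<le> l * (c * v x)" if "x \<in> ball 0 1" for x
    proof -
      have "- (\<Sum>i\<in>UNIV. c * partial_derivative i (partial_derivative i v) x)
          = c * - (\<Sum>i\<in>UNIV. partial_derivative i (partial_derivative i v) x)" by (simp add: sum_distrib_left)
      also have "\<dots> = c * (l * v x)" by (simp only: eig[OF that])
      finally show ?thesis by simp
    qed
    show "bessel_series (CARD('n)) t > 0" if "0 \<le> t" "t \<le> \<mu>" for t
      by (rule bessel_zero(3)) (use that \<mu> in auto)
  qed (use x0 c bd \<mu> in auto)
  then show False using \<mu> by simp
qed

lemma differentiable_on_radial:
  fixes g :: "real \<Rightarrow> real"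
  assumes "\<And>t. (g has_real_derivative g' t) (at t)"
  shows "(\<lambda>x :: real ^ 'n::finite. g (x \<bullet> x)) differentiable_on S"
proof -
  have "((\<lambda>x :: real ^ 'n. g (x \<bullet> x)) has_derivative (\<lambda>h. (x \<bullet> h + h \<bullet> x) * g' (x \<bullet> x))) (at x within S)" for x
    by (rule DERIV_compose_FDERIV[OF assms]) (auto intro!: derivative_eq_intros)
  then show ?thesis unfolding differentiable_on_def differentiable_def by blast
qed

text \<open>\<open>C2_on\<close> asks for the mixed second partials too, so these are computed here
  in addition to the pure ones of \<open>laplacian_radial\<close>.\<close>

lemma dirichlet_eigenfunction_bessel:
  "dirichlet_eigenfunction (bessel_zero TYPE('n)) (bessel_ball (bessel_zero TYPE('n)) :: real ^ 'n::finite \<Rightarrow> real)"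
proof -
  let ?\<nu> = "real CARD('n)"
  let ?\<mu> = "bessel_zero TYPE('n)"
  define f f' f'' where "f t = bessel_series ?\<nu> (?\<mu> * t)" and "f' t = ?\<mu> * bessel_series' ?\<nu> (?\<mu> * t)"
    and "f'' t = ?\<mu>\<^sup>2 * bessel_series'' ?\<nu> (?\<mu> * t)" for t
  note B = bessel_ball_deriv[where 'n='n and \<mu>="?\<mu>", folded f_def f'_def f''_def]
  let ?u = "\<lambda>x :: real ^ 'n. f (x \<bullet> x)"
  have u: "bessel_ball ?\<mu> = ?u" by (simp add: bessel_ball_def f_def fun_eq_iff)
  note R = laplacian_radial[OF B(1,2)]
  have p1: "partial_derivative i ?u = (\<lambda>y. f' (y \<bullet> y) * (2 * y $ i))" for i
    by (rule partial_derivative_eq[OF R(1)])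
  have sq: "has_partial j (\<lambda>y :: real ^ 'n. y \<bullet> y) (\<lambda>y. 2 * y $ j)" for j
    by (rule has_partial_cong[OF has_partial_quad[of j 1 0 0]]) (simp_all add: quad_def)
  have p2: "partial_derivative j (\<lambda>y :: real ^ 'n. f' (y \<bullet> y) * (2 * y $ i))
      = (\<lambda>y. f'' (y \<bullet> y) * (2 * y $ j) * (2 * y $ i) + f' (y \<bullet> y) * (2 * axis j 1 $ i))" for i j
  proof (rule partial_derivative_eq)
    have "has_partial j (\<lambda>y :: real ^ 'n. 2 * y $ i) (\<lambda>y. 2 * axis j 1 $ i)"
      unfolding has_partial_def by (auto intro!: derivative_eq_intros)
    then show "has_partial j (\<lambda>y :: real ^ 'n. f' (y \<bullet> y) * (2 * y $ i))
      (\<lambda>y. f'' (y \<bullet> y) * (2 * y $ j) * (2 * y $ i) + f' (y \<bullet> y) * (2 * axis j 1 $ i))"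
      by (rule has_partial_mult[OF has_partial_compose[OF sq B(2)]])
  qed
  have cf: "continuous_on UNIV f" "continuous_on UNIV f'" "continuous_on UNIV f''"
    using B by (auto intro!: continuous_at_imp_continuous_on DERIV_isCont)
  have cyy: "continuous_on S (\<lambda>y :: real ^ 'n. g (y \<bullet> y))" if "continuous_on UNIV g" for g :: "real \<Rightarrow> real" and S
    by (rule continuous_on_compose2[OF that]) (auto intro!: continuous_intros)
  have C2: "C2_on (ball 0 1) ?u"
    unfolding C2_on_def p1 p2
  proof (intro conjI allI)
    show "?u differentiable_on ball 0 1" by (rule differentiable_on_radial[OF B(1)])
    have "(\<lambda>y :: real ^ 'n. 2 * y $ i) differentiable_on ball 0 1" for i
      by (intro linear_imp_differentiable_on linearI) (auto simp: algebra_simps)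
    then show "(\<lambda>y :: real ^ 'n. f' (y \<bullet> y) * (2 * y $ i)) differentiable_on ball 0 1" for i
      by (rule differentiable_on_mult[OF differentiable_on_radial[OF B(2)]])
    show "continuous_on (ball 0 1) (\<lambda>y :: real ^ 'n. f'' (y \<bullet> y) * (2 * y $ j) * (2 * y $ i) + f' (y \<bullet> y) * (2 * axis j 1 $ i))" for i j
      by (intro continuous_on_add continuous_on_mult continuous_on_const continuous_on_component continuous_on_id cyy[OF cf(2)] cyy[OF cf(3)])
  qed
  have lap: "- laplacian ?u x = ?\<mu> * ?u x" for x
  proof -
    have "laplacian ?u x = (\<Sum>i\<in>UNIV. 4 * (x $ i)\<^sup>2 * f'' (x \<bullet> x) + 2 * f' (x \<bullet> x))"
      unfolding laplacian_def p1 p2 by (simp add: power2_eq_square axis_def mult_ac)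
    also have "\<dots> = - (?\<mu> * ?u x)" unfolding R(3) by (rule B(4))
    finally show ?thesis by simp
  qed
  have nu: "?\<nu> \<ge> 1" using zero_less_card_finite[where 'a='n] by linarith
  show ?thesis
    unfolding dirichlet_eigenfunction_def u
  proof (intro conjI ballI)
    show "\<exists>x\<in>ball 0 1. ?u x \<noteq> 0"
      by (rule bexI[of _ 0]) (auto simp: f_def bessel_series_0[OF nu])
    show "?u x = 0" if "x \<in> sphere 0 1" for x
      using that bessel_zero(2)[where 'n='n] by (simp add: f_def norm_eq_1)
  qed (use C2 lap cyy[OF cf(1)] in auto)
qed

theorem first_dirichlet_eigenvalue_eq: "first_dirichlet_eigenvalue TYPE('n::finite) = bessel_zero TYPE('n)"
  unfolding first_dirichlet_eigenvalue_def
proof (rule Least_equality)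
  show "dirichlet_eigenvalue TYPE('n) (bessel_zero TYPE('n))"
    unfolding dirichlet_eigenvalue_def using dirichlet_eigenfunction_bessel by blast
qed (rule dirichlet_eigenvalue_ge)

section \<open>The Schur test\<close>

text \<open>Concavity of \<open>z powr e\<close> in tangent form. The right side is linear in
  \<open>z\<close>, so integrating it gives Jensen's inequality without normalising a measure, and
  \<open>m\<close> can be adapted to each point.\<close>

lemma powr_le_tangent:
  fixes z m e :: real
  assumes "z > 0" "m > 0" "0 \<le> e" "e \<le> 1"
  shows "z powr e \<le> m powr (e - 1) * (e * z + (1 - e) * m)"
proof -
  have "z powr e * m powr (1 - e) \<le> e * z + (1 - e) * m"
    using assms by (intro Youngs_inequality_0) auto
  then have "m powr (e - 1) * (z powr e * m powr (1 - e)) \<le> m powr (e - 1) * (e * z + (1 - e) * m)"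
    by (rule mult_left_mono) simp
  moreover have "m powr (e - 1) * m powr (1 - e) = 1" using assms by (simp flip: powr_add)
  ultimately show ?thesis by (simp add: mult.left_commute)
qed

text \<open>The convex counterpart: \<open>s powr p\<close> lies above its tangent at
  \<open>m\<close>.\<close>

lemma tangent_le_powr:
  fixes s m p :: real
  assumes "s \<ge> 0" "m > 0" "p \<ge> 1"
  shows "p * m powr (p - 1) * s \<le> s powr p + (p - 1) * m powr p"
proof (cases "s = 0")
  case True then show ?thesis using assms by simp
next
  case False
  have "(s powr p) powr (1 / p) * (m powr p) powr (1 - 1 / p) \<le> 1 / p * (s powr p) + (1 - 1 / p) * (m powr p)"
    using assms False by (intro Youngs_inequality_0) auto
  moreover have "(s powr p) powr (1 / p) = s" "(m powr p) powr (1 - 1 / p) = m powr (p - 1)"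
    using assms False by (simp_all add: powr_powr algebra_simps)
  ultimately have "p * (s * m powr (p - 1)) \<le> p * (1 / p * (s powr p) + (1 - 1 / p) * (m powr p))"
    using assms by (intro mult_left_mono) auto
  also have "\<dots> = s powr p + (p - 1) * m powr p" using assms by (simp add: field_simps)
  finally show ?thesis by (simp add: mult_ac)
qed

text \<open>\<open>A\<close> and \<open>lam\<close> abstract \<open>1 / (2 n)\<close> and the first
  eigenvalue. The Schur test asks only for upper bounds on the images of 1 and of \<open>u\<close>,
  so \<open>u\<close> enters as a positive supersolution; exact images matter for the lower bounds
  on the norms.\<close>

locale positive_kernel = finite_measure M for M :: "'a measure" +
  fixes K :: "'a \<Rightarrow> 'a \<Rightarrow> real" and A lam :: real and u :: "'a \<Rightarrow> real"
  assumes K_measurable [measurable]: "(\<lambda>z. K (fst z) (snd z)) \<in> borel_measurable (M \<Otimes>\<^sub>M M)"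
    and K_nonneg: "x \<in> space M \<Longrightarrow> y \<in> space M \<Longrightarrow> K x y \<ge> 0"
    and K_sym: "x \<in> space M \<Longrightarrow> y \<in> space M \<Longrightarrow> K x y = K y x"
    and A: "A > 0" and K_one: "x \<in> space M \<Longrightarrow> (\<integral>\<^sup>+y. ennreal (K x y) \<partial>M) \<le> ennreal A"
    and lam: "lam > 0" and u_measurable [measurable]: "u \<in> borel_measurable M"
    and u_pos: "x \<in> space M \<Longrightarrow> u x > 0"
    and K_u: "x \<in> space M \<Longrightarrow> (\<integral>\<^sup>+y. ennreal (K x y * u y) \<partial>M) \<le> ennreal (u x / lam)"
begin

definition kernel_op :: "('a \<Rightarrow> real) \<Rightarrow> 'a \<Rightarrow> real" where
  "kernel_op f x = (LINT y|M. K x y * f y)"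

lemma K_measurable_x [measurable]: "x \<in> space M \<Longrightarrow> K x \<in> borel_measurable M"
  using measurable_Pair2[OF K_measurable] by simp

lemma K_measurable_y [measurable]: "y \<in> space M \<Longrightarrow> (\<lambda>x. K x y) \<in> borel_measurable M"
  using measurable_Pair1[OF K_measurable] by simp

lemma op_measurable [measurable]:
  assumes [measurable]: "f \<in> borel_measurable M"
  shows "kernel_op f \<in> borel_measurable M"
proof -
  have "case_prod (\<lambda>x y. K x y * f y) \<in> borel_measurable (M \<Otimes>\<^sub>M M)" by (simp add: split_def)
  from borel_measurable_lebesgue_integral[OF this]
  show ?thesis by (simp add: kernel_op_def[abs_def])
qed

sublocale pair_sigma_finite M M ..

text \<open>The tangent of \<open>z powr e\<close> at \<open>m\<close> bounds the integrand by a
  combination of \<open>u\<close> and 1 with nonnegative coefficients, to which \<open>K_u\<close>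
  and \<open>K_one\<close> apply.\<close>

lemma K_u_powr:
  assumes x: "x \<in> space M" and e: "0 \<le> e" "e \<le> 1"
  shows "(\<integral>\<^sup>+y. ennreal (K x y * u y powr e) \<partial>M) \<le> ennreal (A powr (1 - e) * (u x / lam) powr e)"
proof -
  note [measurable] = K_measurable_x[OF x]
  \<comment> \<open>The quotient of the bounds in \<open>K_u\<close> and \<open>K_one\<close>; at
    this point of tangency the two contributions combine to \<open>m powr e * A\<close>, the claimed
    product.\<close>
  define m where "m = u x / lam / A"
  have m: "m > 0" using u_pos[OF x] lam A by (simp add: m_def)
  have "(\<integral>\<^sup>+y. ennreal (K x y * u y powr e) \<partial>M)
     \<le> (\<integral>\<^sup>+y. ennreal (m powr (e - 1) * e) * ennreal (K x y * u y) + ennreal (m powr (e - 1) * ((1 - e) * m)) * ennreal (K x y) \<partial>M)"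
  proof (rule nn_integral_mono)
    fix y assume y: "y \<in> space M"
    have k: "K x y \<ge> 0" "u y > 0" using K_nonneg x y u_pos by auto
    have "K x y * u y powr e \<le> K x y * (m powr (e - 1) * (e * u y + (1 - e) * m))"
      using k m e by (intro mult_left_mono powr_le_tangent) auto
    also have "\<dots> = m powr (e - 1) * e * (K x y * u y) + m powr (e - 1) * ((1 - e) * m) * K x y"
      by (simp add: algebra_simps)
    finally show "ennreal (K x y * u y powr e)
      \<le> ennreal (m powr (e - 1) * e) * ennreal (K x y * u y) + ennreal (m powr (e - 1) * ((1 - e) * m)) * ennreal (K x y)"
      using k m e by (simp add: ennreal_leI flip: ennreal_mult ennreal_plus)
  qed
  also have "\<dots> = ennreal (m powr (e - 1) * e) * (\<integral>\<^sup>+y. ennreal (K x y * u y) \<partial>M)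
      + ennreal (m powr (e - 1) * ((1 - e) * m)) * (\<integral>\<^sup>+y. ennreal (K x y) \<partial>M)"
    by (subst nn_integral_add) (simp_all add: nn_integral_cmult)
  also have "\<dots> \<le> ennreal (m powr (e - 1) * e) * ennreal (u x / lam) + ennreal (m powr (e - 1) * ((1 - e) * m)) * ennreal A"
    by (intro add_mono mult_left_mono K_u K_one x) auto
  also have "\<dots> = ennreal (m powr (e - 1) * e * (u x / lam) + m powr (e - 1) * ((1 - e) * m) * A)"
    using m e A lam u_pos[OF x] by (simp flip: ennreal_mult ennreal_plus)
  also have "m powr (e - 1) * e * (u x / lam) + m powr (e - 1) * ((1 - e) * m) * A = m powr (e - 1) * m * A"
  proof -
    have "u x / lam = m * A" using A by (simp add: m_def)
    then show ?thesis by (simp add: algebra_simps)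
  qed
  also have "m powr (e - 1) * m = m powr e" using powr_add[of m "e - 1" 1] m by simp
  also have "m powr e * A = A powr (1 - e) * (u x / lam) powr e"
  proof -
    have "m powr e = (u x / lam) powr e * A powr (- e)"
      unfolding m_def using u_pos[OF x] lam A powr_divide[of "u x / lam" A e]
      by (simp add: powr_minus_divide)
    moreover have "A powr (- e) * A = A powr (1 - e)" using powr_add[of A "- e" 1] A by simp
    ultimately show ?thesis by simp
  qed
  finally show ?thesis .
qed

text \<open>Jensen's inequality for \<open>\<bar>f y\<bar> * u y powr (- t)\<close> against the
  density \<open>K x y * u y powr t\<close>, whose mass is at most \<open>w\<close> by
  \<open>K_u_powr\<close>. As only a bound on the mass is known, it is run through the tangent at
  \<open>m = i / w\<close>.\<close>

lemma schur_pointwise: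
  assumes x: "x \<in> space M" and f[measurable]: "f \<in> borel_measurable M" and p: "p \<ge> 1" and t: "0 \<le> t" "t \<le> 1"
    and fin: "(\<integral>\<^sup>+y. ennreal (K x y * \<bar>f y\<bar>) \<partial>M) = ennreal i" and i: "i \<ge> 0"
  shows "ennreal (i powr p) \<le> ennreal ((A powr (1 - t) * (u x / lam) powr t) powr (p - 1))
      * (\<integral>\<^sup>+y. ennreal (K x y * (\<bar>f y\<bar> powr p * u y powr (- (t * (p - 1))))) \<partial>M)"
proof (cases "i = 0")
  case True then show ?thesis by simp
next
  case False
  note [measurable] = K_measurable_x[OF x]
  define w where "w = A powr (1 - t) * (u x / lam) powr t"
  have w: "w > 0" using A u_pos[OF x] lam by (simp add: w_def)
  define m where "m = i / w"
  have m: "m > 0" using False i w by (simp add: m_def)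
  let ?J = "\<integral>\<^sup>+y. ennreal (K x y * (\<bar>f y\<bar> powr p * u y powr (- (t * (p - 1))))) \<partial>M"
  have c: "0 \<le> p * m powr (p - 1)" "0 \<le> (p - 1) * m powr p" using p by auto
  have "ennreal (p * m powr (p - 1) * i) = ennreal (p * m powr (p - 1)) * (\<integral>\<^sup>+y. ennreal (K x y * \<bar>f y\<bar>) \<partial>M)"
    unfolding fin using c by (simp add: ennreal_mult')
  also have "\<dots> = (\<integral>\<^sup>+y. ennreal (p * m powr (p - 1)) * ennreal (K x y * \<bar>f y\<bar>) \<partial>M)"
    by (subst nn_integral_cmult) simp_all
  also have "\<dots> \<le> (\<integral>\<^sup>+y. ennreal (K x y * (\<bar>f y\<bar> powr p * u y powr (- (t * (p - 1)))))
        + ennreal ((p - 1) * m powr p) * ennreal (K x y * u y powr t) \<partial>M)"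
  proof (rule nn_integral_mono)
    fix y assume y: "y \<in> space M"
    have k: "K x y \<ge> 0" "u y > 0" using K_nonneg x y u_pos by auto
    let ?s = "\<bar>f y\<bar> * u y powr (- t)"
    have "p * m powr (p - 1) * ?s \<le> ?s powr p + (p - 1) * m powr p"
      by (rule tangent_le_powr) (use m p in auto)
    then have "(p * m powr (p - 1) * ?s) * (K x y * u y powr t) \<le> (?s powr p + (p - 1) * m powr p) * (K x y * u y powr t)"
      using k by (intro mult_right_mono) auto
    moreover have "u y powr (- t) * u y powr t = 1" using k by (simp flip: powr_add)
    then have "(p * m powr (p - 1) * ?s) * (K x y * u y powr t) = p * m powr (p - 1) * (K x y * \<bar>f y\<bar>)"
      by (simp add: mult_ac)
    moreover have "?s powr p * u y powr t = \<bar>f y\<bar> powr p * u y powr (- (t * (p - 1)))"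
    proof -
      have "?s powr p = \<bar>f y\<bar> powr p * u y powr (- t * p)" by (simp add: powr_mult powr_powr)
      moreover have "u y powr (- t * p) * u y powr t = u y powr (- (t * (p - 1)))"
        using k by (simp add: algebra_simps flip: powr_add)
      ultimately show ?thesis by (simp add: mult.assoc)
    qed
    moreover have "(?s powr p + (p - 1) * m powr p) * (K x y * u y powr t)
        = K x y * (?s powr p * u y powr t) + (p - 1) * m powr p * (K x y * u y powr t)"
      by (simp add: algebra_simps)
    ultimately have "p * m powr (p - 1) * (K x y * \<bar>f y\<bar>)
        \<le> K x y * (\<bar>f y\<bar> powr p * u y powr (- (t * (p - 1)))) + (p - 1) * m powr p * (K x y * u y powr t)"
      by (simp only:)
    then show "ennreal (p * m powr (p - 1)) * ennreal (K x y * \<bar>f y\<bar>)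
        \<le> ennreal (K x y * (\<bar>f y\<bar> powr p * u y powr (- (t * (p - 1))))) + ennreal ((p - 1) * m powr p) * ennreal (K x y * u y powr t)"
      using k c by (simp add: ennreal_leI flip: ennreal_mult ennreal_plus)
  qed
  also have "\<dots> = ?J + ennreal ((p - 1) * m powr p) * (\<integral>\<^sup>+y. ennreal (K x y * u y powr t) \<partial>M)"
    by (subst nn_integral_add) (simp_all add: nn_integral_cmult)
  also have "\<dots> \<le> ?J + ennreal ((p - 1) * m powr p) * ennreal w"
    unfolding w_def by (intro add_left_mono mult_left_mono K_u_powr x t) auto
  finally have key: "ennreal (p * m powr (p - 1) * i) \<le> ?J + ennreal ((p - 1) * m powr p * w)"
    using c w by (simp add: ennreal_mult)
  have mm: "m powr (p - 1) * i = m powr p * w"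
  proof -
    have "i = m * w" using w by (simp add: m_def)
    moreover have "m powr (p - 1) * m = m powr p" using powr_add[of m "p - 1" 1] m by simp
    ultimately show ?thesis by (simp add: mult.assoc[symmetric])
  qed
  have ip: "w powr (p - 1) * (m powr p * w) = i powr p"
  proof -
    have "w powr (p - 1) * w = w powr p" using powr_add[of w "p - 1" 1] w by simp
    then have "w powr (p - 1) * (m powr p * w) = m powr p * w powr p" by (simp add: mult_ac)
    also have "\<dots> = (m * w) powr p" using m w by (simp add: powr_mult)
    also have "m * w = i" using w by (simp add: m_def)
    finally show ?thesis .
  qed
  \<comment> \<open>\<open>key\<close> reads \<open>p * z \<le> J + (p - 1) * z\<close> with
    \<open>z = m powr p * w\<close>. Cancelling requires \<open>J\<close> to be finite; for infinite
    \<open>J\<close> the claim is trivial.\<close>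
  have "ennreal (m powr p * w) \<le> ?J"
  proof (cases ?J)
    case (real j)
    from key[unfolded real(2)] have "ennreal (p * m powr (p - 1) * i) \<le> ennreal (j + (p - 1) * m powr p * w)"
      using real(1) c w by (simp flip: ennreal_plus)
    then have "p * m powr (p - 1) * i \<le> j + (p - 1) * m powr p * w"
      using real(1) c w by (subst (asm) ennreal_le_iff) auto
    moreover have "p * m powr (p - 1) * i = p * (m powr p * w)" using mm by (simp add: mult.assoc)
    moreover have "(p - 1) * m powr p * w = p * (m powr p * w) - m powr p * w" by (simp add: algebra_simps)
    ultimately have "m powr p * w \<le> j" by linarith
    then show ?thesis using real by (simp add: ennreal_leI)
  qed simp
  then have "ennreal (w powr (p - 1)) * ennreal (m powr p * w) \<le> ennreal (w powr (p - 1)) * ?J"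
    by (rule mult_left_mono) simp
  also have "ennreal (w powr (p - 1)) * ennreal (m powr p * w) = ennreal (i powr p)"
    using w by (simp add: ip flip: ennreal_mult)
  finally show ?thesis by (simp only: w_def)
qed

text \<open>By Tonelli and symmetry the double integral of \<open>K x y * \<bar>f y\<bar>\<close> is
  at most \<open>A\<close> times the integral of \<open>\<bar>f y\<bar>\<close>, so the inner
  integral is finite for almost every \<open>x\<close>.\<close>

lemma AE_integrable:
  assumes f: "integrable M f"
  shows "AE x in M. integrable M (\<lambda>y. K x y * f y)"
proof -
  have [measurable]: "f \<in> borel_measurable M" using f by auto
  have "(\<integral>\<^sup>+x. (\<integral>\<^sup>+y. ennreal (K x y * \<bar>f y\<bar>) \<partial>M) \<partial>M) = (\<integral>\<^sup>+y. (\<integral>\<^sup>+x. ennreal (K x y * \<bar>f y\<bar>) \<partial>M) \<partial>M)"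
    by (rule Fubini'[symmetric]) (simp add: split_def)
  also have "\<dots> \<le> (\<integral>\<^sup>+y. ennreal A * ennreal \<bar>f y\<bar> \<partial>M)"
  proof (rule nn_integral_mono)
    fix y assume y: "y \<in> space M"
    note [measurable] = K_measurable_y[OF y]
    have "(\<integral>\<^sup>+x. ennreal (K x y * \<bar>f y\<bar>) \<partial>M) = (\<integral>\<^sup>+x. ennreal (K y x) * ennreal \<bar>f y\<bar> \<partial>M)"
      by (rule nn_integral_cong) (simp add: ennreal_mult'' K_sym[OF _ y])
    also have "\<dots> = (\<integral>\<^sup>+x. ennreal (K y x) \<partial>M) * ennreal \<bar>f y\<bar>"
      using K_measurable_x[OF y] by (subst nn_integral_multc) auto
    also have "\<dots> \<le> ennreal A * ennreal \<bar>f y\<bar>" by (intro mult_right_mono K_one y) simp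
    finally show "(\<integral>\<^sup>+x. ennreal (K x y * \<bar>f y\<bar>) \<partial>M) \<le> ennreal A * ennreal \<bar>f y\<bar>" .
  qed
  also have "\<dots> = ennreal A * (\<integral>\<^sup>+y. ennreal \<bar>f y\<bar> \<partial>M)" by (rule nn_integral_cmult) simp
  also have "\<dots> < \<infinity>" using f by (simp add: integrable_iff_bounded ennreal_mult_less_top)
  finally have "AE x in M. (\<integral>\<^sup>+y. ennreal (K x y * \<bar>f y\<bar>) \<partial>M) \<noteq> \<infinity>"
    by (intro nn_integral_PInf_AE) (auto simp: split_def)
  then show ?thesis
  proof (rule AE_mp, intro AE_I2 impI)
    fix x assume x: "x \<in> space M" and fin: "(\<integral>\<^sup>+y. ennreal (K x y * \<bar>f y\<bar>) \<partial>M) \<noteq> \<infinity>"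
    note [measurable] = K_measurable_x[OF x]
    have "(\<integral>\<^sup>+y. ennreal (norm (K x y * f y)) \<partial>M) = (\<integral>\<^sup>+y. ennreal (K x y * \<bar>f y\<bar>) \<partial>M)"
      by (rule nn_integral_cong) (simp add: abs_mult K_nonneg[OF x])
    then show "integrable M (\<lambda>y. K x y * f y)"
      using fin by (intro integrableI_bounded) (auto simp: top.not_eq_extremum)
  qed
qed

lemma integrable_of_powr:
  fixes f :: "'a \<Rightarrow> real"
  assumes [measurable]: "f \<in> borel_measurable M" and p: "p \<ge> 1" and f: "integrable M (\<lambda>x. \<bar>f x\<bar> powr p)"
  shows "integrable M f"
proof (rule Bochner_Integration.integrable_bound)
  show "integrable M (\<lambda>x. 1 + \<bar>f x\<bar> powr p)" using f by simp
  show "AE x in M. norm (f x) \<le> norm (1 + \<bar>f x\<bar> powr p)"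
  proof (rule AE_I2)
    fix x
    have "\<bar>f x\<bar> \<le> 1 + \<bar>f x\<bar> powr p"
    proof (cases "\<bar>f x\<bar> \<le> 1")
      case False
      then have "\<bar>f x\<bar> powr 1 \<le> \<bar>f x\<bar> powr p" using p by (intro powr_mono) auto
      then show ?thesis using False by simp
    qed (simp add: add_increasing2)
    then show "norm (f x) \<le> norm (1 + \<bar>f x\<bar> powr p)" by simp
  qed
qed measurable

text \<open>Jensen's inequality for the measures \<open>K x y * u y powr t\<close> and then \<open>K_u_powr\<close> with exponent
  \<open>t * (p - 1)\<close>; the optimal choice is \<open>t = 1\<close> for \<open>p \<le> 2\<close> and \<open>t = 1 / (p - 1)\<close> for \<open>p \<ge> 2\<close>.\<close>

theorem schur_bound:
  assumes [measurable]: "f \<in> borel_measurable M" and p: "p \<ge> 1" and t: "0 \<le> t" "t \<le> 1" "t * (p - 1) \<le> 1"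
    and f: "integrable M (\<lambda>x. \<bar>f x\<bar> powr p)"
  shows "integrable M (\<lambda>x. \<bar>kernel_op f x\<bar> powr p)"
    and "(LINT x|M. \<bar>kernel_op f x\<bar> powr p) \<le> A powr (p - 2 * (t * (p - 1))) * lam powr (- 2 * (t * (p - 1))) * (LINT x|M. \<bar>f x\<bar> powr p)"
proof -
  \<comment> \<open>The power of \<open>1 / u\<close> that \<open>schur_pointwise\<close> attaches
    to \<open>f\<close>. That it is at most 1 lets \<open>K_u_powr\<close> be applied once more
    after the exchange of integrals.\<close>
  define e where "e = t * (p - 1)"
  have e: "0 \<le> e" "e \<le> 1" using t p by (auto simp: e_def)
  define C where "C = A powr ((1 - t) * (p - 1)) * lam powr (- e)"
  have C0: "C \<ge> 0" by (simp add: C_def)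
  let ?w = "\<lambda>x. (A powr (1 - t) * (u x / lam) powr t) powr (p - 1)"
  have w: "?w x = C * u x powr e" if "x \<in> space M" for x
  proof -
    have "?w x = A powr ((1 - t) * (p - 1)) * (u x / lam) powr e"
      using u_pos[OF that] A lam by (simp add: powr_mult powr_powr e_def)
    also have "(u x / lam) powr e = lam powr (- e) * u x powr e"
      using u_pos[OF that] lam powr_divide[of "u x" lam e] by (simp add: powr_minus_divide)
    finally show ?thesis by (simp add: C_def)
  qed
  let ?g = "\<lambda>y. \<bar>f y\<bar> powr p * u y powr (- e)"
  have AEint: "AE x in M. integrable M (\<lambda>y. K x y * f y)"
    by (rule AE_integrable[OF integrable_of_powr[OF _ p f]]) simp
  have le: "(\<integral>\<^sup>+x. ennreal (\<bar>kernel_op f x\<bar> powr p) \<partial>M)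
     \<le> (\<integral>\<^sup>+x. ennreal (C * u x powr e) * (\<integral>\<^sup>+y. ennreal (K x y * ?g y) \<partial>M) \<partial>M)"
    using AEint
  proof (intro nn_integral_mono_AE, rule AE_mp[OF _ AE_I2], intro impI)
    fix x assume x: "x \<in> space M" and int: "integrable M (\<lambda>y. K x y * f y)"
    have "(\<integral>\<^sup>+y. ennreal (K x y * \<bar>f y\<bar>) \<partial>M) = (\<integral>\<^sup>+y. ennreal (norm (K x y * f y)) \<partial>M)"
      by (rule nn_integral_cong) (simp add: abs_mult K_nonneg[OF x])
    also have "\<dots> = ennreal (LINT y|M. norm (K x y * f y))"
      using int by (intro nn_integral_eq_integral) auto
    finally have i: "(\<integral>\<^sup>+y. ennreal (K x y * \<bar>f y\<bar>) \<partial>M) = ennreal (LINT y|M. norm (K x y * f y))" .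
    have "\<bar>kernel_op f x\<bar> \<le> (LINT y|M. norm (K x y * f y))"
      unfolding kernel_op_def using integral_norm_bound[of M "\<lambda>y. K x y * f y"] by simp
    then have "\<bar>kernel_op f x\<bar> powr p \<le> (LINT y|M. norm (K x y * f y)) powr p" using p by (intro powr_mono2) auto
    then have "ennreal (\<bar>kernel_op f x\<bar> powr p) \<le> ennreal ((LINT y|M. norm (K x y * f y)) powr p)" by (rule ennreal_leI)
    also have "\<dots> \<le> ennreal (?w x) * (\<integral>\<^sup>+y. ennreal (K x y * ?g y) \<partial>M)"
      unfolding e_def by (rule schur_pointwise[OF x _ p t(1,2) i]) auto
    finally show "ennreal (\<bar>kernel_op f x\<bar> powr p) \<le> ennreal (C * u x powr e) * (\<integral>\<^sup>+y. ennreal (K x y * ?g y) \<partial>M)"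
      unfolding w[OF x] .
  qed
  also have "\<dots> = (\<integral>\<^sup>+x. (\<integral>\<^sup>+y. ennreal (C * u x powr e) * ennreal (K x y * ?g y) \<partial>M) \<partial>M)"
  proof (rule nn_integral_cong)
    fix x assume x: "x \<in> space M"
    note [measurable] = K_measurable_x[OF x]
    show "ennreal (C * u x powr e) * (\<integral>\<^sup>+y. ennreal (K x y * ?g y) \<partial>M)
       = (\<integral>\<^sup>+y. ennreal (C * u x powr e) * ennreal (K x y * ?g y) \<partial>M)"
      by (rule nn_integral_cmult[symmetric]) simp
  qed
  also have "\<dots> = (\<integral>\<^sup>+y. (\<integral>\<^sup>+x. ennreal (C * u x powr e) * ennreal (K x y * ?g y) \<partial>M) \<partial>M)"
    by (rule Fubini'[symmetric]) (simp add: split_def)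
  also have "\<dots> \<le> (\<integral>\<^sup>+y. ennreal (C * (A powr (1 - e) * lam powr (- e))) * ennreal (\<bar>f y\<bar> powr p) \<partial>M)"
  proof (rule nn_integral_mono)
    fix y assume y: "y \<in> space M"
    note [measurable] = K_measurable_x[OF y]
    have "(\<integral>\<^sup>+x. ennreal (C * u x powr e) * ennreal (K x y * ?g y) \<partial>M)
        = (\<integral>\<^sup>+x. ennreal (C * ?g y) * ennreal (K y x * u x powr e) \<partial>M)"
      by (rule nn_integral_cong)
        (simp add: K_sym[OF _ y] K_nonneg[OF y] C0 mult_ac flip: ennreal_mult)
    also have "\<dots> = ennreal (C * ?g y) * (\<integral>\<^sup>+x. ennreal (K y x * u x powr e) \<partial>M)"
      by (rule nn_integral_cmult) simp
    also have "\<dots> \<le> ennreal (C * ?g y) * ennreal (A powr (1 - e) * (u y / lam) powr e)"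
      by (intro mult_left_mono K_u_powr y e) simp
    also have "\<dots> = ennreal (C * ?g y * (A powr (1 - e) * (u y / lam) powr e))"
      using C0 by (simp flip: ennreal_mult)
    \<comment> \<open>The factor \<open>u y powr e\<close> produced by the kernel cancels the
      \<open>u y powr (- e)\<close> carried by \<open>?g\<close>.\<close>
    also have "C * ?g y * (A powr (1 - e) * (u y / lam) powr e) = C * (A powr (1 - e) * lam powr (- e)) * \<bar>f y\<bar> powr p"
    proof -
      have "(u y / lam) powr e = lam powr (- e) * u y powr e"
        using u_pos[OF y] lam powr_divide[of "u y" lam e] by (simp add: powr_minus_divide)
      moreover have "u y powr (- e) * u y powr e = 1" using u_pos[OF y] by (simp flip: powr_add)
      ultimately show ?thesis by (simp add: mult_ac)
    qed
    finally show "(\<integral>\<^sup>+x. ennreal (C * u x powr e) * ennreal (K x y * ?g y) \<partial>M)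
       \<le> ennreal (C * (A powr (1 - e) * lam powr (- e))) * ennreal (\<bar>f y\<bar> powr p)"
      using C0 by (simp flip: ennreal_mult)
  qed
  also have "\<dots> = ennreal (C * (A powr (1 - e) * lam powr (- e))) * (\<integral>\<^sup>+y. ennreal (\<bar>f y\<bar> powr p) \<partial>M)"
    by (rule nn_integral_cmult) simp
  also have "(\<integral>\<^sup>+y. ennreal (\<bar>f y\<bar> powr p) \<partial>M) = ennreal (LINT y|M. \<bar>f y\<bar> powr p)"
    using f by (intro nn_integral_eq_integral) auto
  also have "C * (A powr (1 - e) * lam powr (- e)) = A powr (p - 2 * e) * lam powr (- 2 * e)"
  proof -
    have "(1 - t) * (p - 1) + (1 - e) = p - 2 * e" by (simp add: e_def algebra_simps)
    then have "A powr ((1 - t) * (p - 1)) * A powr (1 - e) = A powr (p - 2 * e)"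
      unfolding powr_add[symmetric] by (simp only:)
    moreover have "lam powr (- e) * lam powr (- e) = lam powr (- 2 * e)" by (simp flip: powr_add)
    ultimately show ?thesis unfolding C_def by (simp add: mult_ac)
  qed
  finally have fin: "(\<integral>\<^sup>+x. ennreal (\<bar>kernel_op f x\<bar> powr p) \<partial>M)
      \<le> ennreal (A powr (p - 2 * e) * lam powr (- 2 * e) * (LINT y|M. \<bar>f y\<bar> powr p))"
    by (simp add: ennreal_mult)
  show int: "integrable M (\<lambda>x. \<bar>kernel_op f x\<bar> powr p)"
    by (rule integrableI_bounded) (use fin in \<open>auto intro: le_less_trans\<close>)
  have "ennreal (LINT x|M. \<bar>kernel_op f x\<bar> powr p) = (\<integral>\<^sup>+x. ennreal (\<bar>kernel_op f x\<bar> powr p) \<partial>M)"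
    using int by (intro nn_integral_eq_integral[symmetric]) auto
  with fin have "ennreal (LINT x|M. \<bar>kernel_op f x\<bar> powr p) \<le> ennreal (A powr (p - 2 * e) * lam powr (- 2 * e) * (LINT y|M. \<bar>f y\<bar> powr p))"
    by simp
  then show "(LINT x|M. \<bar>kernel_op f x\<bar> powr p) \<le> A powr (p - 2 * (t * (p - 1))) * lam powr (- 2 * (t * (p - 1))) * (LINT x|M. \<bar>f x\<bar> powr p)"
    unfolding e_def[symmetric] by (subst (asm) ennreal_le_iff) auto
qed

end

section \<open>Operator norms\<close>

lemma Lp_space_ereal:
  "f \<in> Lp_space (ereal r) M \<longleftrightarrow> f \<in> borel_measurable M \<and> integrable M (\<lambda>x. \<bar>f x\<bar> powr r)"
  by (simp add: Lp_space_def)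

lemma Lp_norm_ereal: "Lp_norm (ereal r) M f = (LINT x|M. \<bar>f x\<bar> powr r) powr (1 / r)"
  by (simp add: Lp_norm_def)

text \<open>On a space of measure 0 the essential supremum of a measurable function is
  \<open>- \<infinity>\<close>, which the hypothesis excludes.\<close>

lemma esssup_abs_nonneg:
  assumes M: "emeasure M (space M) \<noteq> 0"
  shows "0 \<le> esssup M (\<lambda>x. ereal \<bar>f x\<bar>)"
proof (rule ccontr)
  assume neg: "\<not> ?thesis"
  have "AE x in M. ereal \<bar>f x\<bar> \<le> esssup M (\<lambda>x. ereal \<bar>f x\<bar>)" by (rule esssup_AE)
  then have "AE x in M. False"
  proof eventually_elim
    case (elim x)
    have "0 \<le> ereal \<bar>f x\<bar>" by simp
    then show False using elim neg by (meson order_trans)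
  qed
  then show False using M by (simp add: AE_iff_measurable[OF _ refl])
qed

lemma Lp_infinity_AE_le:
  assumes M: "emeasure M (space M) \<noteq> 0" and f: "f \<in> Lp_space \<infinity> M"
  shows "0 \<le> Lp_norm \<infinity> M f" "AE x in M. \<bar>f x\<bar> \<le> Lp_norm \<infinity> M f"
proof -
  let ?s = "esssup M (\<lambda>x. ereal \<bar>f x\<bar>)"
  have "?s < \<infinity>" "0 \<le> ?s" using f esssup_abs_nonneg[OF M, of f] by (auto simp: Lp_space_def)
  then have s: "?s = ereal (Lp_norm \<infinity> M f)" by (cases ?s) (auto simp: Lp_norm_def)
  show "0 \<le> Lp_norm \<infinity> M f" using \<open>0 \<le> ?s\<close> unfolding s by simp
  show "AE x in M. \<bar>f x\<bar> \<le> Lp_norm \<infinity> M f"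
    using esssup_AE[of "\<lambda>x. ereal \<bar>f x\<bar>" M] unfolding s by simp
qed

lemma Lp_infinityI:
  assumes M: "emeasure M (space M) \<noteq> 0" and [measurable]: "f \<in> borel_measurable M" and le: "AE x in M. \<bar>f x\<bar> \<le> c"
  shows "f \<in> Lp_space \<infinity> M" "Lp_norm \<infinity> M f \<le> c"
proof -
  let ?s = "esssup M (\<lambda>x. ereal \<bar>f x\<bar>)"
  have "?s \<le> ereal c" by (rule esssup_I) (use le in auto)
  moreover have "0 \<le> ?s" by (rule esssup_abs_nonneg[OF M])
  ultimately have "?s < \<infinity>" "real_of_ereal ?s \<le> c" by (cases ?s; auto)+
  then show "f \<in> Lp_space \<infinity> M" "Lp_norm \<infinity> M f \<le> c" by (auto simp: Lp_space_def Lp_norm_def)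
qed

lemma Lp_norm_nonneg:
  assumes "emeasure M (space M) \<noteq> 0" "f \<in> Lp_space p M" shows "0 \<le> Lp_norm p M f"
  using Lp_infinity_AE_le(1)[OF assms(1)] assms(2) by (cases "p = \<infinity>") (auto simp: Lp_norm_def)

lemma zero_in_Lp:
  assumes "emeasure M (space M) \<noteq> 0" shows "(\<lambda>x. 0) \<in> Lp_space p M" "Lp_norm p M (\<lambda>x. 0) \<le> 1"
proof -
  have "(\<lambda>x. 0) \<in> Lp_space p M \<and> Lp_norm p M (\<lambda>x. 0) \<le> 1"
  proof (cases "p = \<infinity>")
    case True
    then show ?thesis using Lp_infinityI[OF assms, of "\<lambda>x. 0" 0] by auto
  next
    case False
    then show ?thesis by (simp add: Lp_space_def Lp_norm_def)
  qed
  then show "(\<lambda>x. 0) \<in> Lp_space p M" "Lp_norm p M (\<lambda>x. 0) \<le> 1" by auto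
qed

lemma Lp_operator_norm_le:
  assumes M: "emeasure M (space M) \<noteq> 0" and c: "c \<ge> 0"
    and le: "\<And>f. f \<in> Lp_space p M \<Longrightarrow> Lp_norm p M (T f) \<le> c * Lp_norm p M f"
  shows "Lp_operator_norm p M T \<le> c"
  unfolding Lp_operator_norm_def
proof (rule cSUP_least)
  show "{f \<in> Lp_space p M. Lp_norm p M f \<le> 1} \<noteq> {}" using zero_in_Lp[OF M] by blast
  fix f assume "f \<in> {f \<in> Lp_space p M. Lp_norm p M f \<le> 1}"
  then show "Lp_norm p M (T f) \<le> c"
    using le[of f] mult_left_mono[of "Lp_norm p M f" 1 c] c by auto
qed

text \<open>A \<open>SUP\<close> of reals has its meaning only for sets bounded above, which the
  constant \<open>c\<close> guarantees.\<close>

lemma Lp_operator_norm_ge: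
  assumes c: "c \<ge> 0" and le: "\<And>f. f \<in> Lp_space p M \<Longrightarrow> Lp_norm p M (T f) \<le> c * Lp_norm p M f"
    and f: "f \<in> Lp_space p M" "Lp_norm p M f \<le> 1"
  shows "Lp_norm p M (T f) \<le> Lp_operator_norm p M T"
  unfolding Lp_operator_norm_def
proof (rule cSUP_upper)
  show "bdd_above ((\<lambda>f. Lp_norm p M (T f)) ` {f \<in> Lp_space p M. Lp_norm p M f \<le> 1})"
  proof (rule bdd_aboveI2)
    fix f assume "f \<in> {f \<in> Lp_space p M. Lp_norm p M f \<le> 1}"
    then show "Lp_norm p M (T f) \<le> c"
      using le[of f] mult_left_mono[of "Lp_norm p M f" 1 c] c by auto
  qed
qed (use f in auto)

locale positive_kernel_nonzero = positive_kernel +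
  assumes M_nonzero: "emeasure M (space M) \<noteq> 0"
begin

lemma Lp_space_integrable:
  assumes p: "1 \<le> p" and f: "f \<in> Lp_space p M"
  shows "integrable M f"
proof (cases p)
  case (real r)
  then show ?thesis using f p by (intro integrable_of_powr[of f r]) (auto simp: Lp_space_ereal)
next
  case PInf
  with f have f': "f \<in> Lp_space \<infinity> M" by simp
  show ?thesis
    by (rule integrable_const_bound[where B="Lp_norm \<infinity> M f"])
      (use Lp_infinity_AE_le(2)[OF M_nonzero f'] f' in \<open>auto simp: Lp_space_def\<close>)
qed (use p in auto)

lemma op_Lp_finite:
  assumes r: "1 \<le> r" and t: "0 \<le> t" "t \<le> 1" "t * (r - 1) \<le> 1" and f: "f \<in> Lp_space (ereal r) M"
  shows "kernel_op f \<in> Lp_space (ereal r) M"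
    and "Lp_norm (ereal r) M (kernel_op f) \<le> (A powr (r - 2 * (t * (r - 1))) * lam powr (- 2 * (t * (r - 1)))) powr (1 / r) * Lp_norm (ereal r) M f"
proof -
  have [measurable]: "f \<in> borel_measurable M" and int: "integrable M (\<lambda>x. \<bar>f x\<bar> powr r)"
    using f by (auto simp: Lp_space_ereal)
  note S = schur_bound[OF \<open>f \<in> borel_measurable M\<close> r t int]
  show "kernel_op f \<in> Lp_space (ereal r) M" using S(1) by (simp add: Lp_space_ereal)
  have "Lp_norm (ereal r) M (kernel_op f) \<le> (A powr (r - 2 * (t * (r - 1))) * lam powr (- 2 * (t * (r - 1))) * (LINT x|M. \<bar>f x\<bar> powr r)) powr (1 / r)"
    unfolding Lp_norm_ereal using S(2) r by (intro powr_mono2) auto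
  also have "\<dots> = (A powr (r - 2 * (t * (r - 1))) * lam powr (- 2 * (t * (r - 1)))) powr (1 / r) * Lp_norm (ereal r) M f"
    unfolding Lp_norm_ereal by (rule powr_mult)
  finally show "Lp_norm (ereal r) M (kernel_op f) \<le> (A powr (r - 2 * (t * (r - 1))) * lam powr (- 2 * (t * (r - 1)))) powr (1 / r) * Lp_norm (ereal r) M f" .
qed

lemma op_bound_infinity:
  assumes [measurable]: "f \<in> borel_measurable M" and c: "c \<ge> 0" "AE y in M. \<bar>f y\<bar> \<le> c" and x: "x \<in> space M"
  shows "integrable M (\<lambda>y. K x y * f y)" "\<bar>kernel_op f x\<bar> \<le> A * c"
proof -
  note [measurable] = K_measurable_x[OF x]
  have "(\<integral>\<^sup>+y. ennreal (norm (K x y * f y)) \<partial>M) \<le> (\<integral>\<^sup>+y. ennreal (K x y) * ennreal c \<partial>M)"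
    using c(2)
  proof (intro nn_integral_mono_AE, rule AE_mp[OF _ AE_I2], intro impI)
    fix y assume y: "y \<in> space M" "\<bar>f y\<bar> \<le> c"
    have "norm (K x y * f y) \<le> K x y * c" using y K_nonneg[OF x y(1)] by (simp add: abs_mult mult_left_mono)
    then show "ennreal (norm (K x y * f y)) \<le> ennreal (K x y) * ennreal c"
      using K_nonneg[OF x y(1)] c(1) by (simp add: ennreal_leI flip: ennreal_mult)
  qed
  also have "\<dots> = (\<integral>\<^sup>+y. ennreal (K x y) \<partial>M) * ennreal c" by (rule nn_integral_multc) simp
  also have "\<dots> \<le> ennreal A * ennreal c" by (intro mult_right_mono K_one x) simp
  also have "\<dots> = ennreal (A * c)" using A c by (simp add: ennreal_mult)
  finally have le: "(\<integral>\<^sup>+y. ennreal (norm (K x y * f y)) \<partial>M) \<le> ennreal (A * c)" .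
  show int: "integrable M (\<lambda>y. K x y * f y)"
    by (rule integrableI_bounded) (use le in \<open>auto intro: le_less_trans\<close>)
  have "ennreal (norm (kernel_op f x)) \<le> ennreal (A * c)"
    unfolding kernel_op_def by (rule order_trans[OF integral_norm_bound_ennreal[OF int] le])
  then show "\<bar>kernel_op f x\<bar> \<le> A * c" using A c by (simp add: ennreal_le_iff)
qed

lemma op_Lp_infinity:
  assumes f: "f \<in> Lp_space \<infinity> M"
  shows "kernel_op f \<in> Lp_space \<infinity> M" "Lp_norm \<infinity> M (kernel_op f) \<le> A * Lp_norm \<infinity> M f"
proof -
  have [measurable]: "f \<in> borel_measurable M" using f by (simp add: Lp_space_def)
  have "AE x in M. \<bar>kernel_op f x\<bar> \<le> A * Lp_norm \<infinity> M f"
    by (intro AE_I2 op_bound_infinity Lp_infinity_AE_le M_nonzero f) simp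
  from Lp_infinityI[OF M_nonzero _ this]
  show "kernel_op f \<in> Lp_space \<infinity> M" "Lp_norm \<infinity> M (kernel_op f) \<le> A * Lp_norm \<infinity> M f" by auto
qed

theorem Lp_bounded_operator_op:
  assumes p: "1 \<le> p"
  shows "Lp_bounded_operator p M kernel_op"
  unfolding Lp_bounded_operator_def
proof (intro conjI ballI allI)
  have bound: "\<exists>c. \<forall>f\<in>Lp_space p M. kernel_op f \<in> Lp_space p M \<and> Lp_norm p M (kernel_op f) \<le> c * Lp_norm p M f"
  proof (cases p)
    case (real r)
    \<comment> \<open>\<open>t = 0\<close> is admissible for every \<open>r \<ge> 1\<close> and
      gives the constant \<open>A\<close>.\<close>
    then show ?thesis using p op_Lp_finite[of r 0] by (intro exI ballI conjI) auto
  next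
    case PInf
    then show ?thesis using op_Lp_infinity by blast
  qed (use p in auto)
  show "kernel_op f \<in> Lp_space p M" if "f \<in> Lp_space p M" for f using bound that by blast
  show "\<exists>c. \<forall>f\<in>Lp_space p M. Lp_norm p M (kernel_op f) \<le> c * Lp_norm p M f" using bound by blast
  fix f g a b assume f: "f \<in> Lp_space p M" and g: "g \<in> Lp_space p M"
  \<comment> \<open>Additivity holds where both integrals converge, which is almost
    everywhere.\<close>
  show "AE x in M. kernel_op (\<lambda>y. a * f y + b * g y) x = a * kernel_op f x + b * kernel_op g x"
    using AE_integrable[OF Lp_space_integrable[OF p f]] AE_integrable[OF Lp_space_integrable[OF p g]]
  proof eventually_elim
    case (elim x)
    have "kernel_op (\<lambda>y. a * f y + b * g y) x = (LINT y|M. a * (K x y * f y) + b * (K x y * g y))"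
      unfolding kernel_op_def by (rule Bochner_Integration.integral_cong) (simp_all add: algebra_simps)
    also have "\<dots> = a * kernel_op f x + b * kernel_op g x"
      unfolding kernel_op_def using elim by (subst Bochner_Integration.integral_add) auto
    finally show ?case .
  qed
qed

lemma operator_norm_le_finite:
  assumes r: "1 \<le> r" and t: "0 \<le> t" "t \<le> 1" "t * (r - 1) \<le> 1"
  shows "Lp_operator_norm (ereal r) M kernel_op \<le> (A powr (r - 2 * (t * (r - 1))) * lam powr (- 2 * (t * (r - 1)))) powr (1 / r)"
  by (intro Lp_operator_norm_le M_nonzero op_Lp_finite r t) auto

lemma operator_norm_le_infinity: "Lp_operator_norm \<infinity> M kernel_op \<le> A"
  using A by (intro Lp_operator_norm_le M_nonzero op_Lp_infinity) auto

lemma Lp_norm_le_operator_norm: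
  assumes p: "1 \<le> p" and f: "f \<in> Lp_space p M" "Lp_norm p M f \<le> 1"
  shows "Lp_norm p M (kernel_op f) \<le> Lp_operator_norm p M kernel_op"
proof -
  obtain c where c: "\<And>f. f \<in> Lp_space p M \<Longrightarrow> Lp_norm p M (kernel_op f) \<le> c * Lp_norm p M f"
    using Lp_bounded_operator_op[OF p] unfolding Lp_bounded_operator_def by blast
  have "Lp_norm p M (kernel_op f) \<le> max c 0 * Lp_norm p M f" if "f \<in> Lp_space p M" for f
    using c[OF that] mult_right_mono[OF max.cobounded1 Lp_norm_nonneg[OF M_nonzero that], of c 0] by linarith
  then show ?thesis by (intro Lp_operator_norm_ge[where c="max c 0"] f) auto
qed

section \<open>Lower bounds from test functions\<close>

lemma L2_operator_norm_ge:
  assumes eig: "\<And>x. x \<in> space M \<Longrightarrow> kernel_op u x = u x / lam" and u: "integrable M (\<lambda>x. \<bar>u x\<bar> powr 2)"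
  shows "1 / lam \<le> Lp_operator_norm 2 M kernel_op"
proof -
  let ?S = "LINT x|M. \<bar>u x\<bar> powr 2"
  have S0: "?S \<ge> 0" by simp
  have "?S \<noteq> 0"
  proof
    assume "?S = 0"
    then have "AE x in M. \<bar>u x\<bar> powr 2 = 0" using integral_nonneg_eq_0_iff_AE[OF u] by simp
    then have "AE x in M. False"
      by (rule AE_mp, intro AE_I2 impI) (use u_pos in force)
    then show False using M_nonzero by (simp add: AE_iff_measurable[OF _ refl])
  qed
  then have S: "?S > 0" using S0 by linarith
  define c where "c = 1 / ?S powr (1 / 2)"
  have c: "c > 0" using S by (simp add: c_def)
  have norm: "Lp_norm (ereal 2) M (\<lambda>x. k * u x) = k * ?S powr (1 / 2)" if "k > 0" for k
  proof -
    have "(LINT x|M. \<bar>k * u x\<bar> powr 2) = k powr 2 * ?S"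
      using that by (simp add: abs_mult powr_mult)
    then show ?thesis unfolding Lp_norm_ereal using that by (simp add: powr_mult powr_powr)
  qed
  have in_L2: "(\<lambda>x. c * u x) \<in> Lp_space (ereal 2) M"
    unfolding Lp_space_ereal using u c by (simp add: abs_mult powr_mult)
  have "kernel_op (\<lambda>y. c * u y) x = c / lam * u x" if x: "x \<in> space M" for x
  proof -
    have "kernel_op (\<lambda>y. c * u y) x = (LINT y|M. c * (K x y * u y))"
      unfolding kernel_op_def by (simp add: mult.left_commute)
    also have "\<dots> = c * kernel_op u x" unfolding kernel_op_def by simp
    finally show ?thesis using eig[OF x] by simp
  qed
  then have "Lp_norm (ereal 2) M (kernel_op (\<lambda>y. c * u y)) = Lp_norm (ereal 2) M (\<lambda>x. c / lam * u x)"
    unfolding Lp_norm_ereal by (intro arg_cong2[where f="(powr)"] Bochner_Integration.integral_cong) auto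
  also have "\<dots> = c / lam * ?S powr (1 / 2)" by (rule norm) (use c lam in simp)
  also have "\<dots> = 1 / lam" using S by (simp add: c_def)
  finally have "Lp_norm (ereal 2) M (kernel_op (\<lambda>y. c * u y)) = 1 / lam" .
  moreover have "Lp_norm (ereal 2) M (\<lambda>y. c * u y) \<le> 1" using norm[OF c] S by (simp add: c_def)
  moreover have "(2 :: ereal) = ereal 2" by simp
  ultimately show ?thesis using Lp_norm_le_operator_norm[OF _ in_L2] by simp
qed

text \<open>With \<open>f\<close> the normalised indicator of \<open>S\<close>, Tonelli and symmetry
  turn the norm of its image into the average of \<open>kernel_op (\<lambda>_. 1)\<close> over
  \<open>S\<close>.\<close>

lemma L1_operator_norm_ge:
  assumes S: "S \<in> sets M" "measure M S > 0" and g: "\<And>y. y \<in> S \<Longrightarrow> c \<le> kernel_op (\<lambda>_. 1) y"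
  shows "c \<le> Lp_operator_norm 1 M kernel_op"
proof -
  define f where "f y = indicator S y / measure M S" for y
  have SM: "S \<subseteq> space M" using S(1) by (rule sets.sets_into_space)
  have [measurable]: "f \<in> borel_measurable M" unfolding f_def using S(1) by measurable
  have f0: "f y \<ge> 0" for y by (simp add: f_def)
  have fb: "\<bar>f y\<bar> \<le> 1 / measure M S" for y by (simp add: f_def indicator_def)
  have intf: "integrable M f" by (rule integrable_const_bound[where B="1 / measure M S"]) (use fb in auto)
  have "(LINT x|M. \<bar>f x\<bar> powr 1) = (LINT x|M. f x)" using f0 by (intro Bochner_Integration.integral_cong) auto
  also have "\<dots> = 1" using S SM by (simp add: f_def Int_absorb2)
  finally have n1: "(LINT x|M. \<bar>f x\<bar> powr 1) = 1" .
  have fL: "f \<in> Lp_space (ereal 1) M" "Lp_norm (ereal 1) M f \<le> 1"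
    unfolding Lp_space_ereal Lp_norm_ereal n1 using f0 intf by auto
  have op_eq: "ennreal (kernel_op f x) = (\<integral>\<^sup>+y. ennreal (K x y * f y) \<partial>M)" if x: "x \<in> space M" for x
    unfolding kernel_op_def
    by (intro nn_integral_eq_integral[symmetric] op_bound_infinity[where c="1 / measure M S"] x AE_I2 mult_nonneg_nonneg K_nonneg f0 fb) auto
  have op0: "kernel_op f x \<ge> 0" if x: "x \<in> space M" for x
    unfolding kernel_op_def by (intro integral_nonneg_AE AE_I2 mult_nonneg_nonneg K_nonneg x f0)
  have one_eq: "ennreal (kernel_op (\<lambda>_. 1) y) = (\<integral>\<^sup>+x. ennreal (K y x) \<partial>M)" if y: "y \<in> space M" for y
    using op_bound_infinity(1)[OF _ _ _ y, of "\<lambda>_. 1" 1] unfolding kernel_op_def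
    by (intro trans[OF nn_integral_eq_integral[symmetric]]) (auto simp: K_nonneg[OF y])
  have "ennreal c = ennreal c * (\<integral>\<^sup>+y. ennreal (f y) \<partial>M)"
  proof -
    have "(\<integral>\<^sup>+y. ennreal (f y) \<partial>M) = ennreal (LINT y|M. f y)" using intf f0 by (intro nn_integral_eq_integral) auto
    also have "(LINT y|M. f y) = 1" using S SM by (simp add: f_def Int_absorb2)
    finally show ?thesis by simp
  qed
  also have "\<dots> = (\<integral>\<^sup>+y. ennreal c * ennreal (f y) \<partial>M)" by (rule nn_integral_cmult[symmetric]) simp
  also have "\<dots> \<le> (\<integral>\<^sup>+y. (\<integral>\<^sup>+x. ennreal (K x y * f y) \<partial>M) \<partial>M)"
  proof (rule nn_integral_mono)
    fix y assume y: "y \<in> space M"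
    note [measurable] = K_measurable_x[OF y]
    have "ennreal c * ennreal (f y) \<le> ennreal (kernel_op (\<lambda>_. 1) y) * ennreal (f y)"
    proof (cases "y \<in> S")
      case True
      then show ?thesis using g by (intro mult_right_mono ennreal_leI) auto
    qed (simp add: f_def)
    also have "\<dots> = (\<integral>\<^sup>+x. ennreal (K y x) * ennreal (f y) \<partial>M)"
      unfolding one_eq[OF y] by (rule nn_integral_multc[symmetric]) simp
    also have "\<dots> = (\<integral>\<^sup>+x. ennreal (K x y * f y) \<partial>M)"
      by (rule nn_integral_cong) (simp add: K_sym[OF _ y] K_nonneg y f0 ennreal_mult)
    finally show "ennreal c * ennreal (f y) \<le> (\<integral>\<^sup>+x. ennreal (K x y * f y) \<partial>M)" .
  qed
  also have "\<dots> = (\<integral>\<^sup>+x. (\<integral>\<^sup>+y. ennreal (K x y * f y) \<partial>M) \<partial>M)"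
    by (rule Fubini') (simp add: split_def)
  also have "\<dots> = (\<integral>\<^sup>+x. ennreal (\<bar>kernel_op f x\<bar> powr 1) \<partial>M)"
    by (rule nn_integral_cong) (use op_eq op0 in auto)
  also have "\<dots> = ennreal (LINT x|M. \<bar>kernel_op f x\<bar> powr 1)"
  proof (rule nn_integral_eq_integral)
    show "integrable M (\<lambda>x. \<bar>kernel_op f x\<bar> powr 1)"
      using op_Lp_finite(1)[of 1 0, OF _ _ _ _ fL(1)] by (simp only: Lp_space_ereal)
  qed auto
  finally have "c \<le> (LINT x|M. \<bar>kernel_op f x\<bar> powr 1)" by (subst (asm) ennreal_le_iff) auto
  then have "c \<le> Lp_norm (ereal 1) M (kernel_op f)" unfolding Lp_norm_ereal by simp
  also have "\<dots> \<le> Lp_operator_norm (ereal 1) M kernel_op" by (rule Lp_norm_le_operator_norm) (use fL in auto)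
  finally show ?thesis by (simp add: one_ereal_def)
qed

text \<open>The image of the constant 1 is at least \<open>c\<close> on a set of positive measure,
  so its essential supremum cannot be smaller.\<close>

lemma Linfinity_operator_norm_ge:
  assumes S: "S \<in> sets M" "measure M S > 0" and g: "\<And>y. y \<in> S \<Longrightarrow> c \<le> kernel_op (\<lambda>_. 1) y"
  shows "c \<le> Lp_operator_norm \<infinity> M kernel_op"
proof -
  have one: "(\<lambda>_. 1) \<in> Lp_space \<infinity> M" "Lp_norm \<infinity> M (\<lambda>_. 1) \<le> 1"
    using Lp_infinityI[OF M_nonzero, of "\<lambda>_. 1" 1] by auto
  have "c \<le> Lp_norm \<infinity> M (kernel_op (\<lambda>_. 1))"
  proof (rule ccontr)
    assume less: "\<not> ?thesis"
    have "AE x in M. \<bar>kernel_op (\<lambda>_. 1) x\<bar> \<le> Lp_norm \<infinity> M (kernel_op (\<lambda>_. 1))"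
      by (rule Lp_infinity_AE_le(2)[OF M_nonzero op_Lp_infinity(1)[OF one(1)]])
    then have "AE x in M. x \<notin> S" by eventually_elim (use g less in force)
    then have "S \<in> null_sets M" using S(1) sets.sets_into_space[OF S(1)]
      by (subst AE_iff_null_sets) auto
    then show False using S(2) by (simp add: measure_def null_setsD1)
  qed
  also have "\<dots> \<le> Lp_operator_norm \<infinity> M kernel_op" by (rule Lp_norm_le_operator_norm) (use one in auto)
  finally show ?thesis .
qed

end

section \<open>The Green operator\<close>

lemma measurable_lebesgue_on_borel: "(\<lambda>x. x) \<in> lebesgue_on S \<rightarrow>\<^sub>M borel"
  by (rule measurable_restrict_space1) (simp add: measurable_completion)

text \<open>The reason is the identity
  \<open>[x,y]^2 - |x - y|^2 = (1 - |x|^2) * (1 - |y|^2)\<close>. On the diagonal the first summand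
  is 0 by convention, and the sign would be wrong.\<close>

lemma green_nonneg:
  fixes x y :: "real ^ 'n::finite"
  assumes n: "CARD('n) \<ge> 3" and x: "norm x < 1" and y: "norm y < 1" and ne: "x \<noteq> y"
  shows "green x y \<ge> 0"
proof -
  have "(green_bracket x y)\<^sup>2 - (norm (x - y))\<^sup>2 = (1 - (norm x)\<^sup>2) * (1 - (norm y)\<^sup>2)"
    unfolding green_bracket_quad(1) quad_def power2_norm_eq_inner
    by (simp add: inner_diff_left inner_diff_right inner_commute algebra_simps)
  also have "\<dots> \<ge> 0" using x y by (intro mult_nonneg_nonneg) (simp_all add: power_le_one)
  finally have sq: "(norm (x - y))\<^sup>2 \<le> (green_bracket x y)\<^sup>2" by simp
  have b: "green_bracket x y > 0" using bracket_pos[of x y] x y by auto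
  have le: "norm (x - y) \<le> green_bracket x y" by (rule power2_le_imp_le[OF sq less_imp_le[OF b]])
  have "1 / green_bracket x y ^ (CARD('n) - 2) \<le> 1 / norm (x - y) ^ (CARD('n) - 2)"
  proof -
    have "0 < norm (x - y)" using ne by simp
    then show ?thesis using le b
      by (intro divide_left_mono power_mono mult_pos_pos zero_less_power) auto
  qed
  moreover have "green_const TYPE('n) \<ge> 0"
    using n by (simp add: green_const_eq)
  ultimately show ?thesis by (simp add: green_def)
qed

lemma green_commute: "green x y = green y x"
  by (simp add: green_def norm_minus_commute green_bracket_commute)

text \<open>A passage from the completed measure on the unit ball to \<open>lborel\<close>. The
  value at the single point \<open>x\<close> is replaced by 0, since nonnegativity may fail
  there.\<close>

lemma nn_integral_unit_ball:
  fixes f :: "real ^ 'n::finite \<Rightarrow> real"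
  assumes "integrable lborel (\<lambda>y. indicator (ball 0 1) y * f y)" and nn: "\<And>y. y \<in> ball 0 1 \<Longrightarrow> y \<noteq> x \<Longrightarrow> f y \<ge> 0"
    and [measurable]: "f \<in> borel_measurable borel"
  shows "(\<integral>\<^sup>+y. ennreal (if y = x then 0 else f y) \<partial>unit_ball_measure) = ennreal (LINT y|lborel. indicator (ball 0 1) y * f y)"
proof -
  have [measurable]: "ball (0 :: real ^ 'n) 1 \<in> sets borel" by simp
  let ?g = "\<lambda>y. ennreal (if y = x then 0 else f y) * indicator (ball 0 1) y"
  have "(\<integral>\<^sup>+y. ennreal (if y = x then 0 else f y) \<partial>unit_ball_measure) = (\<integral>\<^sup>+y. ?g y \<partial>lebesgue)"
    by (rule nn_integral_restrict_space) simp
  also have "\<dots> = (\<integral>\<^sup>+y. ?g y \<partial>lborel)"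
    by (rule nn_integral_completion)
  also have "\<dots> = (\<integral>\<^sup>+y. ennreal (indicator (ball 0 1) y * f y) \<partial>lborel)"
  proof (rule nn_integral_cong_AE)
    show "AE y in lborel. ?g y = ennreal (indicator (ball 0 1) y * f y)"
      using AE_lborel_singleton[of x] by eventually_elim (simp add: indicator_def)
  qed
  also have "\<dots> = ennreal (LINT y|lborel. indicator (ball 0 1) y * f y)"
  proof (rule nn_integral_eq_integral[OF assms(1)])
    show "AE y in lborel. 0 \<le> indicator (ball 0 1) y * f y"
      using AE_lborel_singleton[of x] by eventually_elim (simp add: indicator_def nn)
  qed
  finally show ?thesis .
qed

lemma green_measurable: "(\<lambda>z :: (real ^ 'n::finite) \<times> (real ^ 'n). green (fst z) (snd z)) \<in> borel_measurable (borel \<Otimes>\<^sub>M borel)"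
  unfolding green_def green_bracket_def by measurable

text \<open>The representation formula in the form of the nonnegative integrals that the kernel
  locale asks for; it is applied to \<open>w = 1\<close> and to the Bessel function.\<close>

lemma nn_integral_green:
  fixes f f' f'' :: "real \<Rightarrow> real" and x :: "real ^ 'n::finite"
  assumes n: "CARD('n) \<ge> 3" and x: "norm x < 1"
    and f: "\<And>t. (f has_real_derivative f' t) (at t)" "\<And>t. (f' has_real_derivative f'' t) (at t)"
    and cf'': "continuous_on UNIV f''" and f1: "f 1 = 0"
    and w: "\<And>y :: real ^ 'n. w y = - (4 * (y \<bullet> y) * f'' (y \<bullet> y) + 2 * real CARD('n) * f' (y \<bullet> y))"
    and w0: "\<And>y :: real ^ 'n. y \<in> ball 0 1 \<Longrightarrow> w y \<ge> 0"
  shows "(\<integral>\<^sup>+y. ennreal ((if x = y then 0 else green x y) * w y) \<partial>unit_ball_measure) = ennreal (f (x \<bullet> x))"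
proof -
  have cf: "continuous_on UNIV f'" using f by (auto intro!: continuous_at_imp_continuous_on DERIV_isCont)
  have cyy: "continuous_on UNIV (\<lambda>y :: real ^ 'n. g (y \<bullet> y))" if "continuous_on UNIV g" for g :: "real \<Rightarrow> real"
    by (rule continuous_on_compose2[OF that]) (auto intro!: continuous_intros)
  have cw: "continuous_on UNIV w"
  proof -
    have "continuous_on UNIV (\<lambda>y :: real ^ 'n. - (4 * (y \<bullet> y) * f'' (y \<bullet> y) + 2 * real CARD('n) * f' (y \<bullet> y)))"
      by (intro continuous_on_minus continuous_on_add continuous_on_mult continuous_on_const
          continuous_on_inner continuous_on_id cyy[OF cf] cyy[OF cf''])
    then show ?thesis by (simp add: w[abs_def])
  qed
  have wm: "w \<in> borel_measurable borel" using cw by (rule borel_measurable_continuous_onI)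
  have gm: "green x \<in> borel_measurable borel"
    using measurable_Pair2[OF green_measurable, of x] by simp
  have "compact (w ` cball 0 1)" by (intro compact_continuous_image continuous_on_subset[OF cw]) auto
  then obtain W where W: "\<And>y. y \<in> cball 0 1 \<Longrightarrow> \<bar>w y\<bar> \<le> W"
    using compact_imp_bounded[THEN bounded_iff[THEN iffD1]] by (metis imageI real_norm_def)
  have W0: "W \<ge> 0" using W[of 0] by simp
  have c0: "green_const TYPE('n) \<ge> 0" using n by (simp add: green_const_eq)
  let ?k = "\<lambda>y. norm (x - y) powr (2 - real CARD('n)) + (1 - norm x) powr (2 - real CARD('n))"
  have int: "integrable lborel (\<lambda>y. indicator (ball 0 1) y * (green x y * w y))"
  proof (rule Bochner_Integration.integrable_bound)
    show "integrable lborel (\<lambda>y. (green_const TYPE('n) * W) * (indicator (ball 0 1) y * ?k y))"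
      by (intro integrable_mult_right integrable_green_kernel n x)
    show "AE y in lborel. norm (indicator (ball 0 1) y * (green x y * w y)) \<le> norm ((green_const TYPE('n) * W) * (indicator (ball 0 1) y * ?k y))"
    proof (rule AE_I2)
      fix y
      show "norm (indicator (ball 0 1) y * (green x y * w y)) \<le> norm ((green_const TYPE('n) * W) * (indicator (ball 0 1) y * ?k y))"
      proof (cases "y \<in> ball 0 1")
        case True
        then have y: "norm y \<le> 1" by simp
        have "green_bracket x y powr (2 - real CARD('n)) \<le> (1 - norm x) powr (2 - real CARD('n))"
          using bracket_pos[OF x y] x n by (intro powr_mono2') auto
        then have "\<bar>norm (x - y) powr (2 - real CARD('n)) - green_bracket x y powr (2 - real CARD('n))\<bar> \<le> ?k y"
          using powr_ge_zero[of "norm (x - y)" "2 - real CARD('n)"] powr_ge_zero[of "green_bracket x y" "2 - real CARD('n)"]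
          by linarith
        then have "\<bar>green x y\<bar> \<le> green_const TYPE('n) * ?k y"
          unfolding green_eq_powr[OF n x y] using c0 by (simp add: abs_mult mult_left_mono)
        then have "\<bar>green x y\<bar> * \<bar>w y\<bar> \<le> (green_const TYPE('n) * ?k y) * W"
          using W[of y] y c0 by (intro mult_mono mult_nonneg_nonneg) auto
        also have "\<dots> \<le> norm ((green_const TYPE('n) * W) * (indicator (ball 0 1) y * ?k y))"
          using True c0 W0 by (simp add: abs_mult mult_ac)
        finally show ?thesis using True by (simp add: abs_mult)
      qed simp
    qed
    have "(\<lambda>y. indicat_real (ball 0 1) y * (green x y * w y)) \<in> borel_measurable borel"
      by (intro borel_measurable_times borel_measurable_indicator gm wm) simp
    then show "(\<lambda>y. indicat_real (ball 0 1) y * (green x y * w y)) \<in> borel_measurable lborel" by simp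
  qed
  have "(\<integral>\<^sup>+y. ennreal ((if x = y then 0 else green x y) * w y) \<partial>unit_ball_measure)
     = (\<integral>\<^sup>+y. ennreal (if y = x then 0 else green x y * w y) \<partial>unit_ball_measure)"
    by (rule nn_integral_cong) auto
  also have "\<dots> = ennreal (LINT y|lborel. indicator (ball 0 1) y * (green x y * w y))"
  proof (rule nn_integral_unit_ball[OF int])
    show "0 \<le> green x y * w y" if "y \<in> ball 0 1" "y \<noteq> x" for y
      using that by (intro mult_nonneg_nonneg green_nonneg n x w0) auto
    show "(\<lambda>y. green x y * w y) \<in> borel_measurable borel" by (intro borel_measurable_times gm wm)
  qed
  also have "(LINT y|lborel. indicator (ball 0 1) y * (green x y * w y)) = f (x \<bullet> x)"
    unfolding w by (rule green_representation[OF n x f cf'' f1])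
  finally show ?thesis .
qed

text \<open>On the diagonal \<^const>\<open>green\<close> takes a negative junk value.\<close>

definition green0 :: "real ^ 'n::finite \<Rightarrow> real ^ 'n \<Rightarrow> real" where
  "green0 x y = (if x = y then 0 else green x y)"

section \<open>The Green function as a positive kernel\<close>

context
  fixes n :: real and lam :: real and M :: "(real ^ 'n::finite) measure"
  defines "n \<equiv> real CARD('n)" and "lam \<equiv> bessel_zero TYPE('n)" and "M \<equiv> unit_ball_measure"
  assumes card: "CARD('n) \<ge> 3"
begin

lemma space_M: "space M = ball 0 1"
  by (simp add: M_def)

lemma n3: "n \<ge> 3" using card by (simp add: n_def)

lemma nn_integral_green0_one:
  assumes "x \<in> space M"
  shows "(\<integral>\<^sup>+y. ennreal (green0 x y) \<partial>M) = ennreal ((1 - x \<bullet> x) / (2 * n))"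
proof -
  have x: "norm x < 1" using assms by (simp add: space_M)
  have "(\<integral>\<^sup>+y. ennreal ((if x = y then 0 else green x y) * 1) \<partial>unit_ball_measure) = ennreal ((1 - x \<bullet> x) / (2 * n))"
  proof (rule nn_integral_green[OF card x, where f="\<lambda>s. (1 - s) / (2 * n)" and f'="\<lambda>s. - 1 / (2 * n)" and f''="\<lambda>s. 0"])
    show "1 = - (4 * (y \<bullet> y) * 0 + 2 * real CARD('n) * (- 1 / (2 * n)))" for y :: "real ^ 'n"
      using card by (simp add: n_def)
  qed (use n3 in \<open>auto intro!: derivative_eq_intros\<close>)
  then show ?thesis by (simp add: green0_def M_def)
qed

lemma bessel_ball_pos:
  assumes "x \<in> space M" shows "bessel_ball lam x > 0"
proof -
  have "x \<bullet> x < 1" using assms by (simp add: space_M power_less_one_iff flip: power2_norm_eq_inner)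
  then have "lam * (x \<bullet> x) < lam" using bessel_zero(1)[where 'n='n] by (simp add: lam_def)
  then show ?thesis
    unfolding bessel_ball_def lam_def using bessel_zero(1)[where 'n='n] by (intro bessel_zero(3)) auto
qed

lemma nn_integral_green0_bessel:
  assumes "x \<in> space M"
  shows "(\<integral>\<^sup>+y. ennreal (green0 x y * bessel_ball lam y) \<partial>M) = ennreal (bessel_ball lam x / lam)"
proof -
  have x: "norm x < 1" using assms by (simp add: space_M)
  have lam: "lam > 0" using bessel_zero(1)[where 'n='n] by (simp add: lam_def)
  define f f' f'' where "f t = bessel_series n (lam * t) / lam" and "f' t = (lam * bessel_series' n (lam * t)) / lam"
    and "f'' t = (lam\<^sup>2 * bessel_series'' n (lam * t)) / lam" for t
  note B = bessel_ball_deriv[where 'n='n and \<mu>=lam, folded n_def]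
  have "(\<integral>\<^sup>+y. ennreal ((if x = y then 0 else green x y) * bessel_ball lam y) \<partial>unit_ball_measure) = ennreal (f (x \<bullet> x))"
  proof (rule nn_integral_green[OF card x, where f=f and f'=f' and f''=f''])
    show "(f has_real_derivative f' t) (at t)" for t unfolding f_def[abs_def] f'_def by (rule DERIV_cdivide[OF B(1)])
    show "(f' has_real_derivative f'' t) (at t)" for t unfolding f'_def[abs_def] f''_def by (rule DERIV_cdivide[OF B(2)])
    show "continuous_on UNIV f''" unfolding f''_def[abs_def] by (intro continuous_intros B(3)) (use lam in auto)
    show "f 1 = 0" using bessel_zero(2)[where 'n='n] by (simp add: f_def lam_def n_def)
    show "bessel_ball lam y = - (4 * (y \<bullet> y) * f'' (y \<bullet> y) + 2 * real CARD('n) * f' (y \<bullet> y))" for y :: "real ^ 'n"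
    proof -
      have "4 * (y \<bullet> y) * f'' (y \<bullet> y) + 2 * n * f' (y \<bullet> y)
        = (4 * (y \<bullet> y) * (lam\<^sup>2 * bessel_series'' n (lam * (y \<bullet> y))) + 2 * n * (lam * bessel_series' n (lam * (y \<bullet> y)))) / lam"
        unfolding f''_def f'_def by (simp add: add_divide_distrib)
      also have "\<dots> = - bessel_ball lam y" unfolding B(4) using lam by (simp add: bessel_ball_def n_def)
      finally show ?thesis by (simp add: n_def)
    qed
    show "bessel_ball lam y \<ge> 0" if "y \<in> ball 0 1" for y :: "real ^ 'n"
      using bessel_ball_pos[of y] that by (simp add: space_M)
  qed
  then show ?thesis by (simp add: green0_def M_def f_def bessel_ball_def n_def)
qed

lemma continuous_bessel_ball: "continuous_on UNIV (bessel_ball lam :: real ^ 'n \<Rightarrow> real)"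
  unfolding bessel_ball_def[abs_def]
  by (rule continuous_on_compose2[OF continuous_bessel_series[of _ UNIV]]) (use n3 in \<open>auto intro!: continuous_intros simp: n_def\<close>)

lemma emeasure_M: "emeasure M (space M) \<noteq> 0" "emeasure M (space M) \<noteq> \<infinity>"
proof -
  have "emeasure M (space M) = emeasure lebesgue (ball (0 :: real ^ 'n) 1)"
    unfolding space_M unfolding M_def by (rule emeasure_restrict_space) auto
  also have "\<dots> = ennreal (unit_ball_vol n)" by (simp add: emeasure_ball n_def)
  finally have "emeasure M (space M) = ennreal (unit_ball_vol n)" .
  moreover have "unit_ball_vol n > 0" by (rule unit_ball_vol_pos) (use n3 in simp)
  ultimately show "emeasure M (space M) \<noteq> 0" "emeasure M (space M) \<noteq> \<infinity>" by auto
qed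

lemma green_positive_kernel: "positive_kernel_nonzero M green0 (1 / (2 * n)) lam (bessel_ball lam)"
proof (intro positive_kernel_nonzero.intro positive_kernel.intro finite_measureI
    positive_kernel_axioms.intro positive_kernel_nonzero_axioms.intro)
  have [measurable]: "(\<lambda>x. x) \<in> M \<rightarrow>\<^sub>M borel" unfolding M_def by (rule measurable_lebesgue_on_borel)
  have [measurable]: "fst \<in> M \<Otimes>\<^sub>M M \<rightarrow>\<^sub>M borel" "snd \<in> M \<Otimes>\<^sub>M M \<rightarrow>\<^sub>M borel"
    using measurable_compose[OF measurable_fst \<open>(\<lambda>x. x) \<in> M \<rightarrow>\<^sub>M borel\<close>]
      measurable_compose[OF measurable_snd \<open>(\<lambda>x. x) \<in> M \<rightarrow>\<^sub>M borel\<close>] by simp_all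
  show "(\<lambda>z. green0 (fst z) (snd z)) \<in> borel_measurable (M \<Otimes>\<^sub>M M)"
    unfolding green0_def green_def green_bracket_def by measurable
  have "bessel_ball lam \<in> borel_measurable (borel :: (real ^ 'n) measure)"
    using continuous_bessel_ball by (rule borel_measurable_continuous_onI)
  then show "bessel_ball lam \<in> borel_measurable M"
    using measurable_compose[OF \<open>(\<lambda>x. x) \<in> M \<rightarrow>\<^sub>M borel\<close>] by blast
  show "green0 x y \<ge> 0" if "x \<in> space M" "y \<in> space M" for x y
    using that green_nonneg[OF card, of x y] by (auto simp: green0_def space_M)
  show "green0 x y = green0 y x" for x y by (simp add: green0_def green_commute)
  show "1 / (2 * n) > 0" using n3 by simp
  show "lam > 0" using bessel_zero(1)[where 'n='n] by (simp add: lam_def)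
  show "(\<integral>\<^sup>+y. ennreal (green0 x y) \<partial>M) \<le> ennreal (1 / (2 * n))" if "x \<in> space M" for x
    unfolding nn_integral_green0_one[OF that] using n3 by (intro ennreal_leI divide_right_mono) auto
  show "bessel_ball lam x > 0" if "x \<in> space M" for x by (rule bessel_ball_pos[OF that])
  show "(\<integral>\<^sup>+y. ennreal (green0 x y * bessel_ball lam y) \<partial>M) \<le> ennreal (bessel_ball lam x / lam)" if "x \<in> space M" for x
    using nn_integral_green0_bessel[OF that] by simp
  show "emeasure M (space M) \<noteq> \<infinity>" "emeasure M (space M) \<noteq> 0" by (fact emeasure_M)+
qed

interpretation G: positive_kernel_nonzero M green0 "1 / (2 * n)" lam "bessel_ball lam"
  by (rule green_positive_kernel)

lemma AE_neq: "AE y in M. y \<noteq> x"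
proof -
  have "AE y in lebesgue. y \<noteq> x" by (rule AE_completion[OF AE_lborel_singleton])
  then show ?thesis unfolding M_def by (simp add: AE_restrict_space_iff) (auto elim: eventually_mono)
qed

lemma green_measurable_M: "green x \<in> borel_measurable M"
proof -
  have "green x \<in> borel_measurable borel"
    using measurable_Pair2[OF green_measurable, of x] by simp
  then show ?thesis unfolding M_def using measurable_compose[OF measurable_lebesgue_on_borel] by blast
qed

text \<open>The kernels \<open>green\<close> and \<open>green0\<close> differ at most at
  \<open>y = x\<close>, a null set.\<close>

lemma green_op_eq:
  assumes [measurable]: "f \<in> borel_measurable M"
  shows "integrable M (\<lambda>y. green x y * f y) \<longleftrightarrow> integrable M (\<lambda>y. green0 x y * f y)" "green_op f x = G.kernel_op f x"
proof -
  note [measurable] = green_measurable_M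
  have [measurable]: "(\<lambda>x. x) \<in> M \<rightarrow>\<^sub>M borel" unfolding M_def by (rule measurable_lebesgue_on_borel)
  have [measurable]: "green0 x \<in> borel_measurable M" unfolding green0_def[abs_def] by measurable
  have ae: "AE y in M. green x y * f y = green0 x y * f y"
    using AE_neq[of x] by eventually_elim (auto simp: green0_def)
  show "integrable M (\<lambda>y. green x y * f y) \<longleftrightarrow> integrable M (\<lambda>y. green0 x y * f y)"
    by (rule integrable_cong_AE) (use ae in auto)
  show "green_op f x = G.kernel_op f x" unfolding green_op_def G.kernel_op_def M_def[symmetric]
    by (rule integral_cong_AE) (use ae in auto)
qed

lemma green_op_one:
  assumes "x \<in> space M" shows "G.kernel_op (\<lambda>_. 1) x = (1 - x \<bullet> x) / (2 * n)"
proof -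
  have xx: "x \<bullet> x \<le> 1" using assms by (simp add: space_M power_le_one flip: power2_norm_eq_inner)
  have [measurable]: "green0 x \<in> borel_measurable M" by (rule G.K_measurable_x[OF assms])
  have "G.kernel_op (\<lambda>_. 1) x = enn2real (\<integral>\<^sup>+y. ennreal (green0 x y) \<partial>M)"
    unfolding G.kernel_op_def by (simp, intro integral_eq_nn_integral AE_I2) (auto intro: G.K_nonneg[OF assms])
  also have "\<dots> = (1 - x \<bullet> x) / (2 * n)"
    unfolding nn_integral_green0_one[OF assms] using xx n3 by (intro enn2real_ennreal) auto
  finally show ?thesis .
qed

lemma green_op_bessel:
  assumes "x \<in> space M" shows "G.kernel_op (bessel_ball lam) x = bessel_ball lam x / lam"
proof -
  have [measurable]: "green0 x \<in> borel_measurable M" by (rule G.K_measurable_x[OF assms])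
  have "G.kernel_op (bessel_ball lam) x = enn2real (\<integral>\<^sup>+y. ennreal (green0 x y * bessel_ball lam y) \<partial>M)"
    unfolding G.kernel_op_def
  proof (rule integral_eq_nn_integral)
    show "AE y in M. 0 \<le> green0 x y * bessel_ball lam y"
      by (intro AE_I2 mult_nonneg_nonneg G.K_nonneg[OF assms] less_imp_le G.u_pos)
  qed measurable
  also have "\<dots> = bessel_ball lam x / lam"
    unfolding nn_integral_green0_bessel[OF assms] using G.u_pos[OF assms] G.lam by (intro enn2real_ennreal) auto
  finally show ?thesis .
qed

lemma integrable_bessel_ball: "integrable M (\<lambda>x. \<bar>bessel_ball lam x\<bar> powr 2)"
proof -
  have "compact (bessel_ball lam ` cball (0 :: real ^ 'n) 1)"
    by (intro compact_continuous_image continuous_on_subset[OF continuous_bessel_ball]) auto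
  then obtain W where W: "\<And>y :: real ^ 'n. y \<in> cball 0 1 \<Longrightarrow> \<bar>bessel_ball lam y\<bar> \<le> W"
    using compact_imp_bounded[THEN bounded_iff[THEN iffD1]] by (metis imageI real_norm_def)
  show ?thesis
  proof (rule G.integrable_const_bound[where B="W powr 2"])
    show "AE x in M. norm (\<bar>bessel_ball lam x\<bar> powr 2) \<le> W powr 2"
    proof (rule AE_I2)
      fix x assume "x \<in> space M"
      then have "\<bar>bessel_ball lam x\<bar> \<le> W" by (intro W) (simp add: space_M)
      then have "\<bar>bessel_ball lam x\<bar> powr 2 \<le> W powr 2" by (intro powr_mono2) auto
      then show "norm (\<bar>bessel_ball lam x\<bar> powr 2) \<le> W powr 2" by simp
    qed
  qed simp
qed

text \<open>The image of 1 reaches \<open>1 / (2 * n)\<close> only at the origin, so the test sets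
  are balls of radius tending to 0. \<open>N\<close> stays abstract because the same argument serves
  both \<open>p = 1\<close> and \<open>p = \<infinity>\<close>.\<close>

lemma le_operator_normI:
  assumes p: "\<And>S c. S \<in> sets M \<Longrightarrow> measure M S > 0 \<Longrightarrow> (\<And>y. y \<in> S \<Longrightarrow> c \<le> G.kernel_op (\<lambda>_. 1) y) \<Longrightarrow> c \<le> N"
  shows "1 / (2 * n) \<le> N"
proof -
  have "(1 - r\<^sup>2) / (2 * n) \<le> N" if r: "0 < r" "r < 1" for r
  proof (rule p[of "ball 0 r"])
    have sub: "ball 0 r \<subseteq> ball (0 :: real ^ 'n) 1" using r by auto
    show "ball 0 r \<in> sets M" unfolding M_def using sub by (simp add: sets_restrict_space_iff)
    have "measure M (ball 0 r) = measure lebesgue (ball (0 :: real ^ 'n) r)"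
      unfolding M_def using sub by (intro measure_restrict_space) auto
    also have "\<dots> > 0" using r content_ball_pos[of r "0 :: real ^ 'n"] by simp
    finally show "measure M (ball 0 r) > 0" .
    fix y :: "real ^ 'n" assume y: "y \<in> ball 0 r"
    have "y \<bullet> y \<le> r\<^sup>2" using y r unfolding power2_norm_eq_inner[symmetric] by (intro power_mono) auto
    then show "(1 - r\<^sup>2) / (2 * n) \<le> G.kernel_op (\<lambda>_. 1) y"
      using green_op_one[of y] y sub n3 by (auto simp: space_M divide_right_mono)
  qed
  then have "eventually (\<lambda>r. (1 - r\<^sup>2) / (2 * n) \<le> N) (at_right 0)"
    by (auto simp: eventually_at_right_field intro!: exI[of _ 1])
  moreover have "((\<lambda>r. (1 - r\<^sup>2) / (2 * n)) \<longlongrightarrow> (1 - 0\<^sup>2) / (2 * n)) (at_right 0)"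
    by (intro tendsto_intros) (use n3 in auto)
  ultimately have "(1 - 0\<^sup>2) / (2 * n) \<le> N" by (intro tendsto_upperbound[rotated]) auto
  then show ?thesis by simp
qed

lemma green_op_eq_Lp: "f \<in> Lp_space p M \<Longrightarrow> green_op f = G.kernel_op f"
  using green_op_eq(2)[of f] by (auto simp: Lp_space_def)

lemma Lp_operator_norm_green: "Lp_operator_norm p M green_op = Lp_operator_norm p M G.kernel_op"
  unfolding Lp_operator_norm_def by (rule SUP_cong) (auto simp: green_op_eq_Lp)

lemma green_op_bounded:
  assumes p: "1 \<le> p"
  shows "g \<in> Lp_space p M \<Longrightarrow> AE x in M. integrable M (\<lambda>y. green x y * g y)"
    and "Lp_bounded_operator p M green_op"
proof -
  show "AE x in M. integrable M (\<lambda>y. green x y * g y)" if g: "g \<in> Lp_space p M"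
    using G.AE_integrable[OF G.Lp_space_integrable[OF p g]] green_op_eq(1)[of g] g by (simp add: Lp_space_def)
  have B: "Lp_bounded_operator p M G.kernel_op" by (rule G.Lp_bounded_operator_op[OF p])
  have lin: "green_op (\<lambda>y. a * f y + b * g y) = G.kernel_op (\<lambda>y. a * f y + b * g y)"
    if f: "f \<in> Lp_space p M" and g: "g \<in> Lp_space p M" for f g a b
  proof -
    have [measurable]: "f \<in> borel_measurable M" "g \<in> borel_measurable M" using f g by (auto simp: Lp_space_def)
    show ?thesis by (rule ext, rule green_op_eq(2)) measurable
  qed
  show "Lp_bounded_operator p M green_op"
    using B unfolding Lp_bounded_operator_def by (simp add: green_op_eq_Lp lin cong: ball_cong)
qed

lemma operator_norm_le_2:
  assumes r: "1 \<le> r" "r \<le> 2"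
  shows "Lp_operator_norm (ereal r) M green_op \<le> (2 * n) powr ((r - 2) / r) * lam powr (2 * (1 - r) / r)"
proof -
  have "Lp_operator_norm (ereal r) M green_op \<le> ((1 / (2 * n)) powr (r - 2 * (1 * (r - 1))) * lam powr (- 2 * (1 * (r - 1)))) powr (1 / r)"
    unfolding Lp_operator_norm_green by (rule G.operator_norm_le_finite) (use r in auto)
  also have "\<dots> = (2 * n) powr ((r - 2) / r) * lam powr (2 * (1 - r) / r)"
  proof -
    have a: "(1 / (2 * n)) powr (r - 2 * (1 * (r - 1))) = (2 * n) powr (r - 2)"
      using n3 by (simp add: powr_divide powr_minus_divide[symmetric] algebra_simps)
    have b: "- 2 * (1 * (r - 1)) = 2 * (1 - r)" by simp
    show ?thesis unfolding a b using r by (simp add: powr_mult powr_powr)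
  qed
  finally show ?thesis .
qed

text \<open>The name refers to the range \<open>2 \<le> r\<close> of exponents. The choice
  \<open>t = 1 / (r - 1)\<close> makes \<open>t * (r - 1)\<close> equal to 1, the largest value
  allowed.\<close>

lemma operator_norm_ge_2:
  assumes r: "2 \<le> r"
  shows "Lp_operator_norm (ereal r) M green_op \<le> lam powr (- 2 / r) * (2 * n) powr ((2 - r) / r)"
proof -
  have t: "1 / (r - 1) * (r - 1) = 1" using r by simp
  have "Lp_operator_norm (ereal r) M green_op \<le> ((1 / (2 * n)) powr (r - 2 * (1 / (r - 1) * (r - 1))) * lam powr (- 2 * (1 / (r - 1) * (r - 1)))) powr (1 / r)"
    unfolding Lp_operator_norm_green by (rule G.operator_norm_le_finite) (use r in auto)
  also have "\<dots> = lam powr (- 2 / r) * (2 * n) powr ((2 - r) / r)"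
  proof -
    have a: "(1 / (2 * n)) powr (r - 2 * 1) = (2 * n) powr (2 - r)"
      using n3 by (simp add: powr_divide powr_minus_divide[symmetric] algebra_simps)
    show ?thesis unfolding t a using r by (simp add: powr_mult powr_powr mult.commute)
  qed
  finally show ?thesis .
qed

lemma operator_norm_1: "Lp_operator_norm 1 M green_op = 1 / (2 * n)"
proof (rule antisym)
  have "Lp_operator_norm (ereal 1) M green_op \<le> (2 * n) powr ((1 - 2) / 1) * lam powr (2 * (1 - 1) / 1)"
    by (rule operator_norm_le_2) auto
  then show "Lp_operator_norm 1 M green_op \<le> 1 / (2 * n)"
    using n3 G.lam by (simp add: one_ereal_def powr_minus_divide)
  show "1 / (2 * n) \<le> Lp_operator_norm 1 M green_op"
    unfolding Lp_operator_norm_green by (rule le_operator_normI, rule G.L1_operator_norm_ge)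
qed

lemma operator_norm_infinity: "Lp_operator_norm \<infinity> M green_op = 1 / (2 * n)"
proof (rule antisym)
  show "Lp_operator_norm \<infinity> M green_op \<le> 1 / (2 * n)"
    unfolding Lp_operator_norm_green by (rule G.operator_norm_le_infinity)
  show "1 / (2 * n) \<le> Lp_operator_norm \<infinity> M green_op"
    unfolding Lp_operator_norm_green by (rule le_operator_normI, rule G.Linfinity_operator_norm_ge)
qed

lemma operator_norm_2: "Lp_operator_norm 2 M green_op = 1 / lam"
proof (rule antisym)
  have "Lp_operator_norm (ereal 2) M green_op \<le> (2 * n) powr ((2 - 2) / 2) * lam powr (2 * (1 - 2) / 2)"
    by (rule operator_norm_le_2) auto
  then show "Lp_operator_norm 2 M green_op \<le> 1 / lam"
    using n3 G.lam by (simp add: powr_minus_divide)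
  show "1 / lam \<le> Lp_operator_norm 2 M green_op"
    unfolding Lp_operator_norm_green
    by (rule G.L2_operator_norm_ge[OF green_op_bessel integrable_bessel_ball])
qed

end

theorem theorem1p3:
  assumes "CARD('n::finite) \<ge> 3"
  shows
    "let n = real CARD('n);
         lam = first_dirichlet_eigenvalue TYPE('n);
         M = (unit_ball_measure :: (real ^ 'n) measure);
         G = (green_op :: (real ^ 'n \<Rightarrow> real) \<Rightarrow> real ^ 'n \<Rightarrow> real);
         N = (\<lambda>p :: ereal. Lp_operator_norm p M G);
         bound1 = (\<lambda>p :: ereal. let r = real_of_ereal p in
                     (2 * n) powr ((r - 2) / r) * lam powr (2 * (1 - r) / r));
         bound2 = (\<lambda>p :: ereal. let r = real_of_ereal p in
                     if p = \<infinity> then lam powr 0 * (2 * n) powr (-1)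
                     else lam powr (- 2 / r) * (2 * n) powr ((2 - r) / r))
     in (\<forall>p. 1 \<le> p \<longrightarrow>
            (\<forall>g \<in> Lp_space p M. AE x in M. integrable M (\<lambda>y. green x y * g y)) \<and>
            Lp_bounded_operator p M G) \<and>
        (\<forall>p. 1 \<le> p \<and> p \<le> 2 \<longrightarrow> N p \<le> bound1 p) \<and>
        (\<forall>p. 2 \<le> p \<longrightarrow> N p \<le> bound2 p) \<and>
        N 1 = bound1 1 \<and> N 2 = bound1 2 \<and> N 2 = bound2 2 \<and> N \<infinity> = bound2 \<infinity>"
proof -
  have lam: "bessel_zero TYPE('n) > 0" by (rule bessel_zero(1))
  have N1: "Lp_operator_norm 1 unit_ball_measure (green_op :: (real ^ 'n \<Rightarrow> real) \<Rightarrow> _) = 1 / (2 * real CARD('n))"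
    by (rule operator_norm_1[OF assms])
  have N2: "Lp_operator_norm 2 unit_ball_measure (green_op :: (real ^ 'n \<Rightarrow> real) \<Rightarrow> _) = 1 / bessel_zero TYPE('n)"
    by (rule operator_norm_2[OF assms])
  have Ninf: "Lp_operator_norm \<infinity> unit_ball_measure (green_op :: (real ^ 'n \<Rightarrow> real) \<Rightarrow> _) = 1 / (2 * real CARD('n))"
    by (rule operator_norm_infinity[OF assms])
  have le1: "Lp_operator_norm p unit_ball_measure (green_op :: (real ^ 'n \<Rightarrow> real) \<Rightarrow> _)
      \<le> (2 * real CARD('n)) powr ((real_of_ereal p - 2) / real_of_ereal p) *
         bessel_zero TYPE('n) powr (2 * (1 - real_of_ereal p) / real_of_ereal p)" if p: "1 \<le> p" "p \<le> 2" for p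
  proof (cases p)
    case (real r)
    then show ?thesis using operator_norm_le_2[OF assms, of r] p by simp
  qed (use p in auto)
  have le2: "Lp_operator_norm p unit_ball_measure (green_op :: (real ^ 'n \<Rightarrow> real) \<Rightarrow> _)
      \<le> bessel_zero TYPE('n) powr (- 2 / real_of_ereal p) *
        (2 * real CARD('n)) powr ((2 - real_of_ereal p) / real_of_ereal p)" if p: "2 \<le> p" "p \<noteq> \<infinity>" for p
  proof (cases p)
    case (real r)
    then show ?thesis using operator_norm_ge_2[OF assms, of r] p by simp
  qed (use p in auto)
  show ?thesis
    unfolding Let_def first_dirichlet_eigenvalue_eq
    using green_op_bounded[OF assms] le1 le2 lam
    by (auto simp: N1 N2[simplified] Ninf powr_minus_divide)
qed

end
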